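(* For every integer $m\geq 9$, let ${\rm S}_{\rm gen}$ be the value semigroup of a generic parameterization (of a cusp in $\mathbb{C}^3$) with ramification profile $(2m,2m+2,2m+4)$, and let $g=\#(\mathbb{N}\setminus{\rm S}_{\rm gen})$. Then the corresponding Severi variety $M^3_{d,g;{\rm S}_{\rm gen}}$ is of codimension strictly less than $g$ in $M^3_d$ whenever $d\gg g$.
   Context: We work over $\mathbb{C}$. $M^3_d$ denotes the space of nondegenerate morphisms $f:\mathbb{P}^1\to\mathbb{P}^3$ of degree $d>0$, each morphism being identified with the set of coefficients of its homogeneous parameterizing polynomials. $M^3_{d,g}\subset M^3_d$ is the subvariety of morphisms whose images have arithmetic genus $g>0$. A cusp is a unibranch curve singularity, parameterized near $t=0$ by a triple of power series $(f_1(t),f_2(t),f_3(t))$; its value semigroup is the set of $t$-adic valuations of elements of the image of the ring map $\mathbb{C}[[x_1,x_2,x_3]]\to\mathbb{C}[[t]]$, $x_i\mapsto f_i(t)$. $M^3_{d,g;{\rm S}}\subset M^3_{d,g}$ is the subvariety parameterizing morphisms whose image has a unique singularity, which is a cusp with value semigroup ${\rm S}$ (so $\#(\mathbb{N}\setminus{\rm S})=g$). A parameterization has ramification profile $(k_1,k_2,k_3)$ if $0<k_1<k_2<k_3$ are the vanishing orders at $t=0$, together with $0$, of linear combinations of $1,f_1,f_2,f_3$. A generic parameterization with ramification profile $(2m,2m+2,2m+4)$ is a triple of power series with $v_t(f_i)=2m+2i-2$, $i=1,2,3$, and otherwise generic coefficients. The notation $d\gg g$ means that $d$ is sufficiently large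 relative to $g$. *)

theory Defs
  imports
    "HOL-Analysis.Analysis"
    "HOL-Computational_Algebra.Formal_Power_Series"
    "HOL-Library.Function_Algebras"
begin

section \<open>Polynomial functions, projective spaces and the Zariski topology\<close>

text \<open>
  Points of affine space are functions from an index type to the complex numbers.  The affine
  space with coordinates indexed by a set \<open>I\<close> consists of the functions supported on \<open>I\<close>, so that
  a dimension depending on a variable (such as the degree of a morphism) causes no typing problem.
\<close>

definition smul :: "complex \<Rightarrow> ('i \<Rightarrow> complex) \<Rightarrow> 'i \<Rightarrow> complex"
  where "smul c v = (\<lambda>i. c * v i)"

text \<open>Provides \<open>cfun.dim\<close>, the dimension of a complex linear subspace of a function space.\<close>

interpretation cfun: vector_space "smul :: complex \<Rightarrow> ('i \<Rightarrow> complex) \<Rightarrow> 'i \<Rightarrow> complex"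
  by unfold_locales (auto simp: smul_def fun_eq_iff algebra_simps)

definition coord_space :: "'i set \<Rightarrow> ('i \<Rightarrow> complex) set"
  where "coord_space I = {v. \<forall>i. i \<notin> I \<longrightarrow> v i = 0}"

text \<open>
  Polynomials are represented by the functions they induce (no loss over an infinite field).
  Each of them involves finitely many coordinates, also when the index type is infinite.
\<close>

inductive_set poly_fun :: "(('i \<Rightarrow> complex) \<Rightarrow> complex) set" where
  const: "(\<lambda>_. c) \<in> poly_fun"
| coord: "(\<lambda>v. v i) \<in> poly_fun"
| add: "p \<in> poly_fun \<Longrightarrow> q \<in> poly_fun \<Longrightarrow> (\<lambda>v. p v + q v) \<in> poly_fun"
| mult: "p \<in> poly_fun \<Longrightarrow> q \<in> poly_fun \<Longrightarrow> (\<lambda>v. p v * q v) \<in> poly_fun"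

definition hom_poly :: "nat \<Rightarrow> (('i \<Rightarrow> complex) \<Rightarrow> complex) set"
  where "hom_poly n = {p \<in> poly_fun. \<forall>c v. p (smul c v) = c ^ n * p v}"

text \<open>
  A point of projective space is the set of all its homogeneous coordinate vectors.  Hence the
  union of a set of points is the punctured affine cone over it.
\<close>

definition proj_pt :: "('i \<Rightarrow> complex) \<Rightarrow> ('i \<Rightarrow> complex) set"
  where "proj_pt v = {smul c v | c. c \<noteq> 0}"

definition zariski :: "'i set \<Rightarrow> ('i \<Rightarrow> complex) set topology"
  where "zariski I = topology_generated_by
    {{proj_pt v | v. v \<in> coord_space I \<and> v \<noteq> 0 \<and> p v \<noteq> 0} | p. \<exists>n. p \<in> hom_poly n}"

section \<open>Codimension\<close>

definition irreducible_in :: "'a topology \<Rightarrow> 'a set \<Rightarrow> bool"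
  where "irreducible_in X Z \<longleftrightarrow> Z \<subseteq> topspace X \<and> Z \<noteq> {} \<and>
    (\<forall>A B. closedin X A \<and> closedin X B \<and> Z \<subseteq> A \<union> B \<longrightarrow> Z \<subseteq> A \<or> Z \<subseteq> B)"

definition codim_irreducible :: "'a topology \<Rightarrow> 'a set \<Rightarrow> enat"
  where "codim_irreducible X Z = Sup {enat n | n. \<exists>W :: nat \<Rightarrow> 'a set. W 0 = Z \<and>
    (\<forall>i\<le>n. closedin X (W i) \<and> irreducible_in X (W i)) \<and> (\<forall>i<n. W i \<subset> W (Suc i))}"

text \<open>
  The usual codimension of a closed subset, applied to the closure of \<open>V\<close>.  The empty set has
  codimension \<open>\<infinity>\<close>.
\<close>

definition codim :: "'a topology \<Rightarrow> 'a set \<Rightarrow> enat"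
  where "codim X V = (INF Z \<in> {Z. closedin X Z \<and> irreducible_in X Z \<and> Z \<subseteq> X closure_of V}.
    codim_irreducible X Z)"

section \<open>Value semigroups\<close>

text \<open>
  A triple of power series is a family \<open>\<phi>\<close> of which only \<open>\<phi> 0, \<phi> 1, \<phi> 2\<close> matter.  \<open>subst3 c \<phi>\<close> is the
  result of substituting it into the trivariate series with coefficients \<open>c i j k\<close>.  If the \<open>\<phi> l\<close>
  have no constant term, the monomials omitted from the sum do not contribute to degree \<open>n\<close>.
\<close>

definition subst3 :: "(nat \<Rightarrow> nat \<Rightarrow> nat \<Rightarrow> complex) \<Rightarrow> (nat \<Rightarrow> complex fps) \<Rightarrow> complex fps"
  where "subst3 c \<phi> = Abs_fps (\<lambda>n. \<Sum>i\<le>n. \<Sum>j\<le>n. \<Sum>k\<le>n.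
    c i j k * fps_nth (\<phi> 0 ^ i * \<phi> 1 ^ j * \<phi> 2 ^ k) n)"

definition value_semigroup :: "(nat \<Rightarrow> complex fps) \<Rightarrow> nat set"
  where "value_semigroup \<phi> = subdegree ` ({subst3 c \<phi> | c. True} - {0})"

text \<open>All triples with \<open>v\<^sub>t(f\<^sub>i) = 2m + 2i - 2\<close> for \<open>i = 1, 2, 3\<close> (here indexed from 0).\<close>

definition profile_triples :: "nat \<Rightarrow> (nat \<Rightarrow> complex fps) set"
  where "profile_triples m = {\<phi>. (\<forall>i<3. \<phi> i \<noteq> 0 \<and> subdegree (\<phi> i) = 2 * m + 2 * i) \<and>
    (\<forall>i\<ge>3. \<phi> i = 0)}"

definition coeffs_of :: "(nat \<Rightarrow> complex fps) \<Rightarrow> nat \<times> nat \<Rightarrow> complex"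
  where "coeffs_of \<phi> = (\<lambda>(i, j). fps_nth (\<phi> i) j)"

text \<open>Genericity: off the zero locus of a polynomial in the coefficients that is not identically
  zero on \<open>profile_triples m\<close>.\<close>

definition generic_value_semigroup :: "nat \<Rightarrow> nat set \<Rightarrow> bool"
  where "generic_value_semigroup m S \<longleftrightarrow> (\<exists>p \<in> poly_fun.
    (\<exists>\<phi> \<in> profile_triples m. p (coeffs_of \<phi>) \<noteq> 0) \<and>
    (\<forall>\<phi> \<in> profile_triples m. p (coeffs_of \<phi>) \<noteq> 0 \<longrightarrow> value_semigroup \<phi> = S))"

definition S_gen :: "nat \<Rightarrow> nat set"
  where "S_gen m = (THE S. generic_value_semigroup m S)"

section \<open>Morphisms from the projective line to projective 3-space\<close>

text \<open>
  Index sets: \<open>{..<2}\<close> for the line, \<open>{..<4}\<close> for 3-space, and \<open>param_index d\<close> for the coefficients of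
  quadruples of binary forms of degree \<open>d\<close>; the entry \<open>a (i, j)\<close> is the coefficient of
  \<open>s\<^bsup>d-j\<^esup> t\<^bsup>j\<^esup>\<close> in the \<open>i\<close>-th form.
\<close>

definition param_index :: "nat \<Rightarrow> (nat \<times> nat) set"
  where "param_index d = {..<4} \<times> {..d}"

definition param :: "nat \<Rightarrow> (nat \<times> nat \<Rightarrow> complex) \<Rightarrow> (nat \<Rightarrow> complex) \<Rightarrow> nat \<Rightarrow> complex"
  where "param d a x = (\<lambda>i. \<Sum>j\<le>d. a (i, j) * x 0 ^ (d - j) * x 1 ^ j)"

text \<open>No common zero, and image not contained in a plane.\<close>

definition nondegenerate_morphism :: "nat \<Rightarrow> (nat \<times> nat \<Rightarrow> complex) \<Rightarrow> bool"
  where "nondegenerate_morphism d a \<longleftrightarrow> a \<in> coord_space (param_index d) \<and>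
    (\<forall>x \<in> coord_space {..<2}. x \<noteq> 0 \<longrightarrow> param d a x \<noteq> 0) \<and>
    (\<forall>l \<in> coord_space {..<4}. l \<noteq> 0 \<longrightarrow>
      (\<exists>x \<in> coord_space {..<2}. (\<Sum>i<4. l i * param d a x i) \<noteq> 0))"

definition nondegenerate_morphisms :: "nat \<Rightarrow> (nat \<times> nat \<Rightarrow> complex) set set"
  where "nondegenerate_morphisms d = proj_pt ` {a. nondegenerate_morphism d a}"

definition morphism_space :: "nat \<Rightarrow> (nat \<times> nat \<Rightarrow> complex) set topology"
  where "morphism_space d = subtopology (zariski (param_index d)) (nondegenerate_morphisms d)"

definition image_curve :: "nat \<Rightarrow> (nat \<times> nat \<Rightarrow> complex) \<Rightarrow> (nat \<Rightarrow> complex) set set"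
  where "image_curve d a = {proj_pt (param d a x) | x. x \<in> coord_space {..<2} \<and> x \<noteq> 0}"

section \<open>Arithmetic genus and singular points of a curve in projective 3-space\<close>

text \<open>
  The degree \<open>n\<close> part of the homogeneous coordinate ring of \<open>C\<close> is identified with the space of
  restrictions of forms of degree \<open>n\<close> to the punctured cone \<open>\<Union>C\<close>.
\<close>

definition hilbert_function :: "(nat \<Rightarrow> complex) set set \<Rightarrow> nat \<Rightarrow> nat"
  where "hilbert_function C n =
    cfun.dim {(\<lambda>v. if v \<in> \<Union>C then p v else 0) | p. p \<in> hom_poly n}"

text \<open>The Hilbert polynomial of a curve is \<open>P(n) = e n + P(0)\<close>, and \<open>p\<^sub>a = 1 - P(0)\<close>.\<close>

definition has_arith_genus :: "(nat \<Rightarrow> complex) set set \<Rightarrow> nat \<Rightarrow> bool"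
  where "has_arith_genus C g \<longleftrightarrow> (\<exists>e :: int.
    \<forall>\<^sub>F n in sequentially. int (hilbert_function C n) = e * int n + 1 - int g)"

text \<open>
  The tangent space at \<open>v\<close> to the affine cone over \<open>C\<close>, cut out by the differentials at \<open>v\<close> of all
  forms vanishing on \<open>C\<close>.  It contains \<open>v\<close>, so its dimension exceeds that of the Zariski tangent
  space of \<open>C\<close> at the point \<open>proj_pt v\<close> by one.
\<close>

definition cone_tangent_space ::
    "(nat \<Rightarrow> complex) set set \<Rightarrow> (nat \<Rightarrow> complex) \<Rightarrow> (nat \<Rightarrow> complex) set"
  where "cone_tangent_space C v = {w \<in> coord_space {..<4}.
    \<forall>n. \<forall>p \<in> hom_poly n. (\<forall>u \<in> \<Union>C. p u = 0) \<longrightarrow> deriv (\<lambda>z. p (v + smul z w)) 0 = 0}"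

definition singular_points :: "(nat \<Rightarrow> complex) set set \<Rightarrow> (nat \<Rightarrow> complex) set set"
  where "singular_points C = {P \<in> C. \<forall>v \<in> P. cfun.dim (cone_tangent_space C v) \<noteq> 2}"

section \<open>Cusps of the image of a morphism\<close>

text \<open>The \<open>i\<close>-th homogeneous coordinate of the morphism along \<open>t \<mapsto> x + t y\<close>.  If \<open>x\<close> and \<open>y\<close> are linearly
  independent, \<open>t\<close> is a local coordinate of the line at the point \<open>proj_pt x\<close>.\<close>

definition param_fps :: "nat \<Rightarrow> (nat \<times> nat \<Rightarrow> complex) \<Rightarrow> (nat \<Rightarrow> complex) \<Rightarrow> (nat \<Rightarrow> complex) \<Rightarrow>
    nat \<Rightarrow> complex fps"
  where "param_fps d a x y i = (\<Sum>j\<le>d. fps_const (a (i, j)) *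
    (fps_const (x 0) + fps_const (y 0) * fps_X) ^ (d - j) *
    (fps_const (x 1) + fps_const (y 1) * fps_X) ^ j)"

text \<open>The three affine coordinates, in the chart where the \<open>k\<close>-th homogeneous coordinate does not
  vanish, centred at the image of \<open>proj_pt x\<close>.\<close>

definition local_param :: "nat \<Rightarrow> (nat \<times> nat \<Rightarrow> complex) \<Rightarrow> nat \<Rightarrow> (nat \<Rightarrow> complex) \<Rightarrow> (nat \<Rightarrow> complex) \<Rightarrow>
    nat \<Rightarrow> complex fps"
  where "local_param d a k x y i =
    (let h = param_fps d a x y (if i < k then i else Suc i) / param_fps d a x y k
     in h - fps_const (fps_nth h 0))"

text \<open>
  The branches of the image curve at \<open>P\<close> are the images of the germs of the line at the preimages
  of \<open>P\<close>.  The curve is unibranch at \<open>P\<close>, parameterized by \<open>\<phi>\<close>, iff all of them factor through \<open>\<phi>\<close>,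
  where \<open>\<phi>\<close> must be generically injective, i.e. its value semigroup must have finite complement.
  When the morphism is birational onto its image, there is one preimage and \<open>\<tau>\<close> is merely a change
  of local coordinate; allowing a general \<open>\<tau>\<close> makes this a property of the image only.
\<close>

definition cusp_of_image ::
    "nat \<Rightarrow> (nat \<times> nat \<Rightarrow> complex) \<Rightarrow> (nat \<Rightarrow> complex) set \<Rightarrow> nat set \<Rightarrow> bool"
  where "cusp_of_image d a P S \<longleftrightarrow> P \<in> singular_points (image_curve d a) \<and>
    (\<exists>k<4. \<exists>\<phi> :: nat \<Rightarrow> complex fps. (\<forall>v \<in> P. v k \<noteq> 0) \<and>
      (\<forall>i<3. fps_nth (\<phi> i) 0 = 0) \<and> finite (UNIV - value_semigroup \<phi>) \<and> value_semigroup \<phi> = S \<and>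
      (\<forall>x \<in> coord_space {..<2}. \<forall>y \<in> coord_space {..<2}.
        x 0 * y 1 - x 1 * y 0 \<noteq> 0 \<and> proj_pt (param d a x) = P \<longrightarrow>
        (\<exists>\<tau> :: complex fps. fps_nth \<tau> 0 = 0 \<and> (\<forall>i<3. local_param d a k x y i = \<phi> i oo \<tau>))))"

definition severi :: "nat \<Rightarrow> nat \<Rightarrow> nat set \<Rightarrow> (nat \<times> nat \<Rightarrow> complex) set set"
  where "severi d g S = proj_pt ` {a. nondegenerate_morphism d a \<and>
    has_arith_genus (image_curve d a) g \<and>
    (\<exists>P. singular_points (image_curve d a) = {P} \<and> cusp_of_image d a P S)}"

end

theory Submission
  imports Defs
begin

text \<open>
  The codimension is small because the generic semigroup has many gaps, whereas the curves which realize
  it are cut out by few conditions.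

  \<^emph>\<open>Gaps.\<close>  The local ring of the cusp is generated by three series of order at least \<open>2 m\<close>.  A monomial
  of degree at least five in them has order at least \<open>10 m\<close>, and there are only 35 monomials of smaller
  degree.  Elements of different orders are linearly independent, so at most 35 values lie below \<open>10 m\<close>
  and \<open>g \<ge> 10 m - 35\<close> (\<open>S_gen_gaps\<close>).  For \<open>m \<ge> 9\<close> this exceeds \<open>6 m\<close>.

  \<^emph>\<open>Conditions.\<close>  It suffices to look at curves whose cusp is the image of the fixed point \<open>t = 0\<close> of the
  line.  Up to a unipotent change of coordinates of space, such a curve is given by four forms \<open>h\<^sub>i\<close>
  vanishing at \<open>t = 0\<close> to the orders \<open>0, 2 m, 2 m + 2, 2 m + 4\<close>.  These curves form an irreducible family in
  which \<open>4 (d + 1) - 6 m\<close> of the \<open>4 (d + 1)\<close> coefficients are independent (\<open>card_family_index\<close>,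
  \<open>family_dominant\<close>).  If a general member lies in the Severi variety, then its codimension is at most \<open>6 m\<close>,
  by \<open>codim_le_of_family\<close>.  That theorem replaces dimension theory by counting: whenever an irreducible
  closed set is enlarged, a form vanishing on the smaller set is a nonzerodivisor on the larger one, so that
  the number of independent forms of degree \<open>j\<close> grows faster by one power of \<open>j\<close>.

  \<^emph>\<open>The general member.\<close>  Two properties of it are needed, and both come from semicontinuity: the
  number of values below \<open>n\<close> is the rank of a matrix with polynomial entries.
  First, its semigroup is \<open>S_gen m\<close>, since all these numbers are simultaneously maximal for a general
  member (\<open>S_gen_generic\<close>).  Secondly, the monomials \<open>t\<^sup>v\<close> with \<open>c \<le> v \<le> n d\<close>, for a constant \<open>c\<close>, are
  restrictions of forms of degree \<open>n\<close>, for all large \<open>n\<close> (\<open>generic_many_monomials\<close>).  For this, one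
  compares with an explicit curve.  The space of forms vanishing to a high power at the cusp has at most a
  certain dimension for every curve of the family; the explicit curve attains this dimension, hence so does the
  general member.

  The second property contains the global geometry: it gives the Hilbert function, and therefore the
  arithmetic genus (\<open>arith_genus\<close>); it shows that the line can be recovered from the curve away from the
  cusp, so that tangent spaces there have dimension one and the cusp has only one preimage
  (\<open>singular_points_eq\<close>, \<open>cusp_of_curve\<close>).
\<close>

section \<open>Polynomial functions\<close>

lemma poly_fun_sum:
  "(\<And>x. x \<in> A \<Longrightarrow> p x \<in> poly_fun) \<Longrightarrow> (\<lambda>v. \<Sum>x\<in>A. p x v) \<in> poly_fun"
proof (induction A rule: infinite_finite_induct)
  case (insert x F)
  then show ?case using poly_fun.add[of "p x" "\<lambda>v. \<Sum>x\<in>F. p x v"] by simp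
qed (auto intro: poly_fun.const)

lemma poly_fun_prod:
  "(\<And>x. x \<in> A \<Longrightarrow> p x \<in> poly_fun) \<Longrightarrow> (\<lambda>v. \<Prod>x\<in>A. p x v) \<in> poly_fun"
proof (induction A rule: infinite_finite_induct)
  case (insert x F)
  then show ?case using poly_fun.mult[of "p x" "\<lambda>v. \<Prod>x\<in>F. p x v"] by simp
qed (auto intro: poly_fun.const)

lemma poly_fun_diff: "p \<in> poly_fun \<Longrightarrow> q \<in> poly_fun \<Longrightarrow> (\<lambda>v. p v - q v) \<in> poly_fun"
  using poly_fun.add[of p "\<lambda>v. (-1) * q v"] poly_fun.mult[OF poly_fun.const[of "-1"], of q] by simp

lemma poly_fun_subst:
  assumes "p \<in> poly_fun" "\<And>i. (\<lambda>v. \<sigma> v i) \<in> poly_fun"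
  shows "(\<lambda>v. p (\<sigma> v)) \<in> poly_fun"
  using assms(1) by induction (auto intro: poly_fun.intros assms(2))

lemma poly_fun_on_line:
  assumes "p \<in> poly_fun"
  shows "\<exists>q :: complex poly. \<forall>s. p (\<lambda>i. u i + s * w i) = poly q s"
  using assms
proof induction
  case (const c)
  show ?case by (intro exI[of _ "[:c:]"]) auto
next
  case (coord i)
  show ?case by (intro exI[of _ "[:u i, w i:]"]) auto
next
  case (add p q)
  then obtain f g where "\<forall>s. p (\<lambda>i. u i + s * w i) = poly f s" "\<forall>s. q (\<lambda>i. u i + s * w i) = poly g s"
    by blast
  then show ?case by (intro exI[of _ "f + g"]) auto
next
  case (mult p q)
  then obtain f g where "\<forall>s. p (\<lambda>i. u i + s * w i) = poly f s" "\<forall>s. q (\<lambda>i. u i + s * w i) = poly g s"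
    by blast
  then show ?case by (intro exI[of _ "f * g"]) auto
qed

text \<open>On the line through \<open>u\<close> and \<open>w\<close> both functions are nonzero polynomials in one variable, which
  have finitely many roots.\<close>

lemma coord_space_irreducible:
  assumes "p \<in> poly_fun" "q \<in> poly_fun" "u \<in> coord_space I" "w \<in> coord_space I" "p u \<noteq> 0" "q w \<noteq> 0"
  shows "\<exists>v \<in> coord_space I. p v \<noteq> 0 \<and> q v \<noteq> 0"
proof -
  obtain f where f: "\<And>s. p (\<lambda>i. u i + s * (w i - u i)) = poly f s"
    using poly_fun_on_line[OF assms(1), of u "\<lambda>i. w i - u i"] by blast
  obtain g where g: "\<And>s. q (\<lambda>i. u i + s * (w i - u i)) = poly g s"
    using poly_fun_on_line[OF assms(2), of u "\<lambda>i. w i - u i"] by blast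
  have "poly f 0 \<noteq> 0" "poly g 1 \<noteq> 0"
    using f[of 0] g[of 1] assms by auto
  hence "f \<noteq> 0" "g \<noteq> 0" by auto
  hence "finite {s. poly (f * g) s = 0}" by (intro poly_roots_finite) auto
  then obtain s where "s \<notin> {s. poly (f * g) s = 0}"
    using ex_new_if_finite[OF infinite_UNIV_char_0] by blast
  hence "poly f s \<noteq> 0" "poly g s \<noteq> 0" by auto
  moreover have "(\<lambda>i. u i + s * (w i - u i)) \<in> coord_space I"
    using assms(3,4) by (auto simp: coord_space_def)
  ultimately show ?thesis using f g by metis
qed

lemma coord_space_irreducible_finite:
  assumes "finite A" "coord_space I \<noteq> {}"
    "\<And>x. x \<in> A \<Longrightarrow> p x \<in> poly_fun" "\<And>x. x \<in> A \<Longrightarrow> \<exists>v \<in> coord_space I. p x v \<noteq> 0"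
  shows "\<exists>v \<in> coord_space I. \<forall>x \<in> A. p x v \<noteq> 0"
  using assms
proof (induction A rule: finite_induct)
  case (insert x F)
  from insert obtain v where v: "v \<in> coord_space I" "\<forall>x\<in>F. p x v \<noteq> 0" by auto
  obtain u where u: "u \<in> coord_space I" "p x u \<noteq> 0" using insert.prems(3)[of x] by blast
  have "(\<Prod>x\<in>F. p x v) \<noteq> 0" using v insert by simp
  with coord_space_irreducible[of "p x" "\<lambda>v. \<Prod>x\<in>F. p x v" u I v] u v insert
  obtain w where "w \<in> coord_space I" "p x w \<noteq> 0" "(\<Prod>x\<in>F. p x w) \<noteq> 0"
    using poly_fun_prod[of F p] by auto
  then show ?case using insert by auto
qed auto

section \<open>Linear independence on a set of coordinates\<close>

text \<open>The vectors \<open>w i\<close> are linearly independent already when restricted to the coordinates in \<open>C\<close>.  Coordinates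
  may be coefficients or points at which functions are evaluated.\<close>

definition indep_on :: "'i set \<Rightarrow> 'c set \<Rightarrow> ('i \<Rightarrow> 'c \<Rightarrow> complex) \<Rightarrow> bool"
  where "indep_on I C w \<longleftrightarrow> (\<forall>x. (\<forall>c\<in>C. (\<Sum>i\<in>I. x i * w i c) = 0) \<longrightarrow> (\<forall>i\<in>I. x i = 0))"

lemma indep_onI:
  "(\<And>x i. (\<And>c. c \<in> C \<Longrightarrow> (\<Sum>i\<in>I. x i * w i c) = 0) \<Longrightarrow> i \<in> I \<Longrightarrow> x i = 0) \<Longrightarrow> indep_on I C w"
  by (auto simp: indep_on_def)

lemma indep_onD:
  "indep_on I C w \<Longrightarrow> (\<And>c. c \<in> C \<Longrightarrow> (\<Sum>i\<in>I. x i * w i c) = 0) \<Longrightarrow> i \<in> I \<Longrightarrow> x i = 0"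
  by (auto simp: indep_on_def)

lemma indep_on_subset:
  assumes "indep_on I C w" "J \<subseteq> I" "finite I"
  shows "indep_on J C w"
proof (rule indep_onI)
  fix x i assume *: "\<And>c. c \<in> C \<Longrightarrow> (\<Sum>i\<in>J. x i * w i c) = 0" "i \<in> J"
  have "(\<Sum>i\<in>I. (if i \<in> J then x i else 0) * w i c) = (\<Sum>i\<in>J. x i * w i c)" for c
    using assms by (intro sum.mono_neutral_cong_right) auto
  hence "(if i \<in> J then x i else 0) = 0"
    using * assms(2) by (intro indep_onD[OF assms(1), where x = "\<lambda>i. if i \<in> J then x i else 0"]) auto
  thus "x i = 0" using * by simp
qed

text \<open>One step of Gaussian elimination with the pivot \<open>(i0, c0)\<close>, written without division so that
  polynomial entries remain polynomial.\<close>

lemma indep_on_eliminate: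
  assumes "indep_on (insert i0 I) C w" "i0 \<notin> I" "finite I" "c0 \<in> C" "w i0 c0 \<noteq> 0"
  shows "indep_on I (C - {c0}) (\<lambda>i c. w i0 c0 * w i c - w i c0 * w i0 c)"
proof (rule indep_onI)
  fix x i
  assume *: "\<And>c. c \<in> C - {c0} \<Longrightarrow> (\<Sum>i\<in>I. x i * (w i0 c0 * w i c - w i c0 * w i0 c)) = 0"
    and i: "i \<in> I"
  \<comment> \<open>The coefficient of \<open>w i0\<close> makes the combination vanish at \<open>c0\<close>.\<close>
  define y where "y = (\<lambda>i. if i = i0 then - (\<Sum>i\<in>I. x i * w i c0) else w i0 c0 * x i)"
  have eq: "(\<Sum>i\<in>insert i0 I. y i * w i c) = (\<Sum>i\<in>I. x i * (w i0 c0 * w i c - w i c0 * w i0 c))" for c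
  proof -
    have "(\<Sum>i\<in>insert i0 I. y i * w i c) = y i0 * w i0 c + (\<Sum>i\<in>I. y i * w i c)"
      using assms by simp
    also have "(\<Sum>i\<in>I. y i * w i c) = (\<Sum>i\<in>I. w i0 c0 * x i * w i c)"
      using assms(2) by (intro sum.cong) (auto simp: y_def)
    also have "y i0 * w i0 c = (\<Sum>i\<in>I. - (x i * w i c0 * w i0 c))"
      by (simp add: y_def sum_distrib_right sum_negf)
    also have "\<dots> + (\<Sum>i\<in>I. w i0 c0 * x i * w i c) = (\<Sum>i\<in>I. x i * (w i0 c0 * w i c - w i c0 * w i0 c))"
      unfolding sum.distrib[symmetric] by (intro sum.cong) (auto simp: algebra_simps)
    finally show ?thesis .
  qed
  have "(\<Sum>i\<in>insert i0 I. y i * w i c) = 0" if "c \<in> C" for c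
  proof (cases "c = c0")
    case True
    then show ?thesis unfolding eq by (auto simp: algebra_simps)
  next
    case False
    with that show ?thesis unfolding eq using * by auto
  qed
  hence "y i = 0" using i by (intro indep_onD[OF assms(1), where x = y]) auto
  thus "x i = 0" using i assms by (auto simp: y_def split: if_splits)
qed

lemma indep_on_uneliminate:
  assumes "indep_on I (C - {c0}) (\<lambda>i c. w i0 c0 * w i c - w i c0 * w i0 c)"
    "i0 \<notin> I" "finite I" "c0 \<in> C" "w i0 c0 \<noteq> 0"
  shows "indep_on (insert i0 I) C w"
proof (rule indep_onI)
  fix x i
  assume *: "\<And>c. c \<in> C \<Longrightarrow> (\<Sum>i\<in>insert i0 I. x i * w i c) = 0" and i: "i \<in> insert i0 I"
  have **: "x i0 * w i0 c + (\<Sum>i\<in>I. x i * w i c) = 0" if "c \<in> C" for c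
    using *[OF that] assms by simp
  have "(\<Sum>i\<in>I. x i * (w i0 c0 * w i c - w i c0 * w i0 c)) = 0" if "c \<in> C - {c0}" for c
  proof -
    have "(\<Sum>i\<in>I. x i * (w i0 c0 * w i c - w i c0 * w i0 c)) =
      w i0 c0 * (\<Sum>i\<in>I. x i * w i c) - w i0 c * (\<Sum>i\<in>I. x i * w i c0)"
      unfolding sum_distrib_left sum_subtractf[symmetric]
      by (intro sum.cong) (auto simp: algebra_simps)
    also have "(\<Sum>i\<in>I. x i * w i c) = - (x i0 * w i0 c)"
      using **[of c] that by (simp add: eq_neg_iff_add_eq_0 add.commute)
    also have "(\<Sum>i\<in>I. x i * w i c0) = - (x i0 * w i0 c0)"
      using **[of c0] assms by (simp add: eq_neg_iff_add_eq_0 add.commute)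
    finally show ?thesis by (simp add: algebra_simps)
  qed
  hence 0: "x i = 0" if "i \<in> I" for i using that by (intro indep_onD[OF assms(1), where x = x]) auto
  have "x i0 = 0" using **[of c0] assms 0 by simp
  thus "x i = 0" using 0 i by auto
qed

lemma indep_on_pivot:
  assumes "indep_on (insert i0 I) C w" "i0 \<notin> I" "finite I"
  shows "\<exists>c0\<in>C. w i0 c0 \<noteq> 0"
proof (rule ccontr)
  assume "\<not> ?thesis"
  hence *: "\<And>c. c \<in> C \<Longrightarrow> w i0 c = 0" by auto
  have "(\<Sum>i\<in>insert i0 I. (if i = i0 then 1 else 0) * w i c) = 0" if "c \<in> C" for c
    using * that assms by (intro sum.neutral) auto
  from indep_onD[OF assms(1) this, of i0] have "(if i0 = i0 then 1 else 0 :: complex) = 0" by blast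
  thus False by simp
qed

lemma indep_on_card_le:
  assumes "finite I" "finite C" "indep_on I C w"
  shows "card I \<le> card C"
  using assms
proof (induction I arbitrary: C w rule: finite_induct)
  case (insert i0 I)
  obtain c0 where c0: "c0 \<in> C" "w i0 c0 \<noteq> 0" using indep_on_pivot insert by metis
  have "card I \<le> card (C - {c0})"
    using insert c0 by (intro insert.IH[OF _ indep_on_eliminate]) auto
  moreover have "0 < card C" using c0 insert by (auto simp: card_gt_0_iff)
  ultimately show ?case using insert c0 by simp
qed auto

text \<open>Lower semicontinuity of the rank: the product of the pivots of the Gaussian elimination at \<open>a0\<close> is a
  polynomial, and wherever it does not vanish the same elimination succeeds.\<close>

lemma indep_on_open:
  assumes "finite I" "indep_on I C (\<lambda>i c. w i c a0)" "\<And>i c. i \<in> I \<Longrightarrow> w i c \<in> poly_fun"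
  shows "\<exists>p \<in> poly_fun. p a0 \<noteq> 0 \<and> (\<forall>a. p a \<noteq> 0 \<longrightarrow> indep_on I C (\<lambda>i c. w i c a))"
  using assms
proof (induction I arbitrary: C w rule: finite_induct)
  case empty
  show ?case by (intro bexI[of _ "\<lambda>_. 1"]) (auto simp: indep_on_def intro: poly_fun.const)
next
  case (insert i0 I)
  obtain c0 where c0: "c0 \<in> C" "w i0 c0 a0 \<noteq> 0" using indep_on_pivot[OF insert.prems(1)] insert by blast
  have "\<exists>p\<in>poly_fun. p a0 \<noteq> 0 \<and> (\<forall>a. p a \<noteq> 0 \<longrightarrow> indep_on I (C - {c0})
      (\<lambda>i c. (\<lambda>a. w i0 c0 a * w i c a - w i c0 a * w i0 c a) a))"
  proof (rule insert.IH)
    show "indep_on I (C - {c0}) (\<lambda>i c. w i0 c0 a0 * w i c a0 - w i c0 a0 * w i0 c a0)"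
      using indep_on_eliminate[OF insert.prems(1) insert.hyps(2,1) c0] .
    fix i c assume "i \<in> I"
    thus "(\<lambda>a. w i0 c0 a * w i c a - w i c0 a * w i0 c a) \<in> poly_fun"
      using insert.prems(2) by (intro poly_fun_diff poly_fun.mult) auto
  qed
  then obtain p where p: "p \<in> poly_fun" "p a0 \<noteq> 0"
    "\<And>a. p a \<noteq> 0 \<Longrightarrow> indep_on I (C - {c0}) (\<lambda>i c. w i0 c0 a * w i c a - w i c0 a * w i0 c a)"
    by blast
  show ?case
  proof (intro bexI[of _ "\<lambda>a. w i0 c0 a * p a"] conjI allI impI)
    show "(\<lambda>a. w i0 c0 a * p a) \<in> poly_fun" using p insert.prems(2) by (auto intro: poly_fun.mult)
    show "w i0 c0 a0 * p a0 \<noteq> 0" using p c0 by simp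
    fix a assume "w i0 c0 a * p a \<noteq> 0"
    thus "indep_on (insert i0 I) C (\<lambda>i c. w i c a)"
      using insert.hyps c0 p(3) by (intro indep_on_uneliminate[where ?c0.0 = c0]) auto
  qed
qed

section \<open>Forms\<close>

lemma hom_poly_imp_poly_fun: "p \<in> hom_poly n \<Longrightarrow> p \<in> poly_fun" by (simp add: hom_poly_def)

lemma hom_polyD: "p \<in> hom_poly n \<Longrightarrow> p (smul c v) = c ^ n * p v" by (simp add: hom_poly_def)

lemma hom_poly_mult: "p \<in> hom_poly n \<Longrightarrow> q \<in> hom_poly k \<Longrightarrow> (\<lambda>v. p v * q v) \<in> hom_poly (n + k)"
  by (auto simp: hom_poly_def power_add intro: poly_fun.mult)

lemma hom_poly_sum:
  "(\<And>x. x \<in> A \<Longrightarrow> p x \<in> hom_poly n) \<Longrightarrow> (\<lambda>v. \<Sum>x\<in>A. c x * p x v) \<in> hom_poly n"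
proof (induction A rule: infinite_finite_induct)
  case (insert x F)
  have "(\<lambda>v. c x * p x v + (\<Sum>x\<in>F. c x * p x v)) \<in> hom_poly n"
    using insert.prems[of x] insert.IH insert.prems
    by (auto simp: hom_poly_def distrib_left mult.left_commute
        intro!: poly_fun.add poly_fun.mult poly_fun.const)
  then show ?case using insert by simp
qed (auto simp: hom_poly_def intro: poly_fun.const)

lemma hom_poly_coord: "(\<lambda>v. v i) \<in> hom_poly 1"
  by (auto simp: hom_poly_def smul_def intro: poly_fun.coord)

lemma hom_poly_const: "(\<lambda>v. c) \<in> hom_poly 0"
  by (auto simp: hom_poly_def intro: poly_fun.const)

lemma hom_poly_power: "p \<in> hom_poly n \<Longrightarrow> (\<lambda>v. p v ^ k) \<in> hom_poly (n * k)"
proof (induction k)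
  case 0 then show ?case using hom_poly_const[of 1] by simp
next
  case (Suc k) then show ?case using hom_poly_mult[of p n "\<lambda>v. p v ^ k" "n * k"] by simp
qed

lemma hom_poly_prod:
  "finite A \<Longrightarrow> (\<And>x. x \<in> A \<Longrightarrow> p x \<in> hom_poly (n x)) \<Longrightarrow> (\<lambda>v. \<Prod>x\<in>A. p x v) \<in> hom_poly (\<Sum>x\<in>A. n x)"
proof (induction A rule: finite_induct)
  case empty then show ?case using hom_poly_const[of 1] by simp
next
  case (insert x F)
  then show ?case using hom_poly_mult[of "p x" "n x" "\<lambda>v. \<Prod>x\<in>F. p x v" "\<Sum>x\<in>F. n x"] by simp
qed

lemma hom_poly_word: "(\<lambda>v. prod_list (map v w)) \<in> hom_poly (length w)"
proof (induction w)
  case Nil then show ?case using hom_poly_const[of 1] by simp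
next
  case (Cons i w)
  then show ?case using hom_poly_mult[OF hom_poly_coord[of i] Cons] by simp
qed

text \<open>Words in the coordinates are used as monomials.  The same monomial may occur as several words, but
  multiplication of monomials is concatenation.\<close>

lemma poly_fun_words:
  assumes "p \<in> poly_fun"
  shows "\<exists>T c. finite T \<and> (\<forall>w\<in>T. set w \<subseteq> I) \<and>
    (\<forall>v\<in>coord_space I. p v = (\<Sum>w\<in>T. c w * prod_list (map v w)))"
  using assms
proof induction
  case (const c)
  show ?case by (intro exI[of _ "{[]}"] exI[of _ "\<lambda>_. c"]) auto
next
  case (coord i)
  show ?case
  proof (cases "i \<in> I")
    case True
    then show ?thesis by (intro exI[of _ "{[i]}"] exI[of _ "\<lambda>_. 1"]) auto
  next
    case False
    then show ?thesis by (intro exI[of _ "{}"]) (auto simp: coord_space_def)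
  qed
next
  case (add p q)
  then obtain T c U e where T: "finite T" "\<forall>w\<in>T. set w \<subseteq> I"
      "\<forall>v\<in>coord_space I. p v = (\<Sum>w\<in>T. c w * prod_list (map v w))"
    and U: "finite U" "\<forall>w\<in>U. set w \<subseteq> I"
      "\<forall>v\<in>coord_space I. q v = (\<Sum>w\<in>U. e w * prod_list (map v w))"
    by blast
  show ?case
  proof (intro exI[of _ "T \<union> U"] exI[of _ "\<lambda>w. (if w \<in> T then c w else 0) + (if w \<in> U then e w else 0)"]
      conjI ballI)
    fix v assume v: "v \<in> coord_space I"
    have "(\<Sum>w\<in>T. c w * prod_list (map v w)) =
      (\<Sum>w\<in>T \<union> U. (if w \<in> T then c w else 0) * prod_list (map v w))"
      using T U by (intro sum.mono_neutral_cong_left) auto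
    moreover have "(\<Sum>w\<in>U. e w * prod_list (map v w)) =
      (\<Sum>w\<in>T \<union> U. (if w \<in> U then e w else 0) * prod_list (map v w))"
      using T U by (intro sum.mono_neutral_cong_left) auto
    ultimately show "p v + q v = (\<Sum>w\<in>T \<union> U.
       ((if w \<in> T then c w else 0) + (if w \<in> U then e w else 0)) * prod_list (map v w))"
      using T U v unfolding distrib_right sum.distrib by simp
  qed (use T U in auto)
next
  case (mult p q)
  then obtain T c U e where T: "finite T" "\<forall>w\<in>T. set w \<subseteq> I"
      "\<forall>v\<in>coord_space I. p v = (\<Sum>w\<in>T. c w * prod_list (map v w))"
    and U: "finite U" "\<forall>w\<in>U. set w \<subseteq> I"
      "\<forall>v\<in>coord_space I. q v = (\<Sum>w\<in>U. e w * prod_list (map v w))"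
    by blast
  define f where "f = (\<lambda>(x, y :: 'a list). x @ y)"
  show ?case
  proof (intro exI[of _ "f ` (T \<times> U)"] exI[of _ "\<lambda>w. \<Sum>z | z \<in> T \<times> U \<and> f z = w. c (fst z) * e (snd z)"]
      conjI ballI)
    fix v assume v: "v \<in> coord_space I"
    have "(\<Sum>w\<in>f ` (T \<times> U). (\<Sum>z | z \<in> T \<times> U \<and> f z = w. c (fst z) * e (snd z)) * prod_list (map v w)) =
      (\<Sum>w\<in>f ` (T \<times> U). (\<Sum>z | z \<in> T \<times> U \<and> f z = w. c (fst z) * e (snd z) * prod_list (map v (f z))))"
      unfolding sum_distrib_right by (intro sum.cong) auto
    also have "\<dots> = (\<Sum>z\<in>T \<times> U. c (fst z) * e (snd z) * prod_list (map v (f z)))"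
      using T U by (intro sum.image_gen[symmetric]) auto
    also have "\<dots> = (\<Sum>w\<in>T. c w * prod_list (map v w)) * (\<Sum>w\<in>U. e w * prod_list (map v w))"
      unfolding sum_product sum.cartesian_product f_def by (intro sum.cong) auto
    finally show "p v * q v = (\<Sum>w\<in>f ` (T \<times> U).
        (\<Sum>z | z \<in> T \<times> U \<and> f z = w. c (fst z) * e (snd z)) * prod_list (map v w))"
      using T U v by simp
  next
    fix w assume "w \<in> f ` (T \<times> U)"
    then obtain x y where "x \<in> T" "y \<in> U" "w = x @ y" by (auto simp: f_def)
    then show "set w \<subseteq> I" using T(2) U(2) by auto
  qed (use T U in auto)
qed

lemma prod_list_smul:
  "prod_list (map (smul t v) w) = t ^ length w * prod_list (map v w)"
  by (induction w) (auto simp: smul_def)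

text \<open>Compare the coefficients of \<open>t ^ n\<close> in \<open>p (t v)\<close>.\<close>

lemma hom_poly_words:
  assumes "p \<in> hom_poly n"
  shows "\<exists>T c. finite T \<and> (\<forall>w\<in>T. set w \<subseteq> I \<and> length w = n) \<and>
    (\<forall>v\<in>coord_space I. p v = (\<Sum>w\<in>T. c w * prod_list (map v w)))"
proof -
  obtain T c where T: "finite T" "\<forall>w\<in>T. set w \<subseteq> I"
    "\<And>v. v\<in>coord_space I \<Longrightarrow> p v = (\<Sum>w\<in>T. c w * prod_list (map v w))"
    using poly_fun_words[OF hom_poly_imp_poly_fun[OF assms]] by metis
  show ?thesis
  proof (intro exI[of _ "{w \<in> T. length w = n}"] exI[of _ c] conjI ballI)
    fix v assume v: "v \<in> coord_space I"
    define P where "P = (\<Sum>w\<in>T. monom (c w * prod_list (map v w)) (length w))"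
    have "poly P t = poly (monom (p v) n) t" for t
    proof -
      have "poly P t = (\<Sum>w\<in>T. c w * prod_list (map (smul t v) w))"
        by (simp add: P_def poly_sum poly_monom prod_list_smul mult_ac)
      also have "\<dots> = p (smul t v)"
        using v by (intro T(3)[symmetric]) (auto simp: coord_space_def smul_def)
      finally show ?thesis using assms by (simp add: hom_polyD poly_monom mult_ac)
    qed
    hence "P = monom (p v) n" by (simp add: poly_eq_poly_eq_iff[symmetric] fun_eq_iff)
    hence "p v = coeff P n" by simp
    also have "\<dots> = (\<Sum>w\<in>T. if length w = n then c w * prod_list (map v w) else 0)"
      by (auto simp: P_def coeff_sum intro!: sum.cong)
    also have "\<dots> = (\<Sum>w\<in>{w \<in> T. length w = n}. c w * prod_list (map v w))"
      using T(1) by (subst sum.inter_filter) auto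
    finally show "p v = (\<Sum>w\<in>{w \<in> T. length w = n}. c w * prod_list (map v w))" .
  qed (use T in auto)
qed

section \<open>Growth of the spaces of forms on a cone\<close>

text \<open>The Hilbert function of the cone \<open>W\<close> at \<open>j\<close> is at least \<open>r\<close>.\<close>

definition indep_forms :: "('i \<Rightarrow> complex) set \<Rightarrow> nat \<Rightarrow> nat \<Rightarrow> bool"
  where "indep_forms W j r \<longleftrightarrow> (\<exists>P :: nat \<Rightarrow> _. (\<forall>i<r. P i \<in> hom_poly j) \<and> indep_on {..<r} W P)"

lemma indep_forms_antimono: "indep_forms W j r \<Longrightarrow> r' \<le> r \<Longrightarrow> indep_forms W j r'"
  unfolding indep_forms_def by (metis finite_lessThan indep_on_subset lessThan_subset_iff order_less_le_trans)

text \<open>Forms that are independent on \<open>W\<close>, together with the multiples by \<open>f\<close> of forms that are independent on \<open>W'\<close>: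
  restricting a relation to \<open>W\<close>, where \<open>f\<close> vanishes, kills the coefficients of the former, and \<open>f\<close> can be
  cancelled from what remains.\<close>

lemma indep_forms_step:
  assumes "indep_forms W (e + j) r" "indep_forms W' j r'" "W \<subseteq> W'"
    "f \<in> hom_poly e" "\<And>v. v \<in> W \<Longrightarrow> f v = 0"
    "\<And>p. p \<in> hom_poly j \<Longrightarrow> (\<And>v. v \<in> W' \<Longrightarrow> f v * p v = 0) \<Longrightarrow> (\<And>v. v \<in> W' \<Longrightarrow> p v = 0)"
  shows "indep_forms W' (e + j) (r + r')"
proof -
  obtain P where P: "\<And>i. i < r \<Longrightarrow> P i \<in> hom_poly (e + j)" "indep_on {..<r} W P"
    using assms(1) by (auto simp: indep_forms_def)
  obtain Q where Q: "\<And>i. i < r' \<Longrightarrow> Q i \<in> hom_poly j" "indep_on {..<r'} W' Q"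
    using assms(2) by (auto simp: indep_forms_def)
  define R where "R = (\<lambda>i. if i < r then P i else (\<lambda>v. f v * Q (i - r) v))"
  have split: "(\<Sum>i<r + r'. x i * R i v) = (\<Sum>i<r. x i * P i v) + f v * (\<Sum>i<r'. x (r + i) * Q i v)" for x v
  proof -
    have "(\<Sum>i<r + r'. x i * R i v) = (\<Sum>i<r. x i * R i v) + (\<Sum>i<r'. x (r + i) * R (r + i) v)"
      by (induction r') (auto simp: add.assoc)
    thus ?thesis by (simp add: R_def sum_distrib_left mult_ac)
  qed
  have "indep_on {..<r + r'} W' R"
  proof (rule indep_onI)
    fix x i assume *: "\<And>v. v \<in> W' \<Longrightarrow> (\<Sum>i<r + r'. x i * R i v) = 0" and i: "i \<in> {..<r + r'}"
    have "(\<Sum>i<r. x i * P i v) = 0" if "v \<in> W" for v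
      using *[of v] assms(3,5) that unfolding split by auto
    hence 1: "x i = 0" if "i < r" for i
      using indep_onD[OF P(2), of x i] that by simp
    have 2: "f v * (\<Sum>i<r'. x (r + i) * Q i v) = 0" if "v \<in> W'" for v
      using *[OF that] 1 unfolding split by simp
    have "(\<Sum>i<r'. x (r + i) * Q i v) = 0" if "v \<in> W'" for v
      by (rule assms(6)[OF hom_poly_sum[of "{..<r'}" Q j "\<lambda>i. x (r + i)"] 2 that]) (use Q in auto)
    hence 3: "x (r + i) = 0" if "i < r'" for i
      using indep_onD[OF Q(2), of "\<lambda>i. x (r + i)" i] that by simp
    show "x i = 0" using 1 3[of "i - r"] i by (cases "i < r") auto
  qed
  moreover have "R i \<in> hom_poly (e + j)" if "i < r + r'" for i
    using that P(1) hom_poly_mult[OF assms(4) Q(1)[of "i - r"]] by (auto simp: R_def)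
  ultimately show ?thesis unfolding indep_forms_def by blast
qed

text \<open>Iterating the previous lemma about \<open>j div (2 e A)\<close> times adds up that many values of the Hilbert function of
  \<open>W\<close>, all taken at degrees at least \<open>j / 2\<close>.\<close>

lemma indep_forms_growth:
  assumes "\<And>j. indep_forms W j ((j div A) ^ p)" "A \<ge> 1" "e \<ge> 1" "W \<subseteq> W'"
    "f \<in> hom_poly e" "\<And>v. v \<in> W \<Longrightarrow> f v = 0"
    "\<And>j p. p \<in> hom_poly j \<Longrightarrow> (\<And>v. v \<in> W' \<Longrightarrow> f v * p v = 0) \<Longrightarrow> (\<And>v. v \<in> W' \<Longrightarrow> p v = 0)"
  shows "\<exists>A' \<ge> 1. \<forall>j. indep_forms W' j ((j div A') ^ Suc p)"
proof (intro exI[of _ "2 * e * A"] conjI allI)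
  show "2 * e * A \<ge> 1" using assms(2,3) by simp
  fix j
  have *: "indep_forms W' j (\<Sum>i<t. ((j - i * e) div A) ^ p)" if "t * e \<le> j" for t j
    using that
  proof (induction t arbitrary: j)
    case 0
    show ?case by (auto simp: indep_forms_def indep_on_def)
  next
    case (Suc t)
    have "indep_forms W' (e + (j - e)) ((j div A) ^ p + (\<Sum>i<t. ((j - e - i * e) div A) ^ p))"
    proof (rule indep_forms_step[OF _ _ assms(4,5,6)])
      have "e \<le> j" "t * e \<le> j - e" using Suc.prems by auto
      thus "indep_forms W (e + (j - e)) ((j div A) ^ p)" using assms(1)[of j] by simp
      show "indep_forms W' (j - e) (\<Sum>i<t. ((j - e - i * e) div A) ^ p)"
        by (rule Suc.IH) fact
    next
      fix p v
      assume "p \<in> hom_poly (j - e)" "\<And>v. v \<in> W' \<Longrightarrow> f v * p v = 0" "v \<in> W'"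
      thus "p v = 0" by (rule assms(7))
    qed
    also have "(j div A) ^ p + (\<Sum>i<t. ((j - e - i * e) div A) ^ p) = (\<Sum>i<Suc t. ((j - i * e) div A) ^ p)"
      unfolding sum.lessThan_Suc_shift by (simp add: algebra_simps)
    finally show ?case using Suc.prems by simp
  qed
  define q where "q = j div (2 * e * A)"
  have q: "2 * e * A * q \<le> j" by (simp add: q_def)
  have e: "e * q \<le> e * q * A" using assms(2) by simp
  have "2 * (e * q * A) \<le> j" using q by (simp only: mult_ac)
  hence "q * e \<le> j" using e by (simp only: mult.commute[of q e]; linarith)
  hence "indep_forms W' j (\<Sum>i<q. ((j - i * e) div A) ^ p)" by (rule *)
  moreover have "q ^ p \<le> ((j - i * e) div A) ^ p" if "i < q" for i
  proof -
    have "i * e \<le> e * q" using that by (simp add: mult_ac)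
    moreover have "2 * e * A * q = 2 * (e * q * A)" by (simp only: mult_ac)
    ultimately have "i * e + e * q * A \<le> 2 * e * A * q" using e by linarith
    hence "e * q * A \<le> j - i * e" using q by linarith
    moreover have "q * A \<le> e * q * A" using assms(3) by simp
    ultimately have "q * A \<le> j - i * e" by linarith
    hence "q \<le> (j - i * e) div A" using assms(2) by (simp add: less_eq_div_iff_mult_less_eq)
    thus ?thesis by (intro power_mono) auto
  qed
  hence "(\<Sum>i<q. q ^ p) \<le> (\<Sum>i<q. ((j - i * e) div A) ^ p)" by (intro sum_mono) auto
  hence "q ^ Suc p \<le> (\<Sum>i<q. ((j - i * e) div A) ^ p)" by simp
  ultimately show "indep_forms W' j ((j div (2 * e * A)) ^ Suc p)"
    unfolding q_def[symmetric] by (rule indep_forms_antimono)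
qed

lemma prod_list_map_eq_prod_count:
  fixes v :: "'a \<Rightarrow> complex"
  assumes "finite I" "set w \<subseteq> I"
  shows "prod_list (map v w) = (\<Prod>i\<in>I. v i ^ count_list w i)"
  using assms(2)
proof (induction w)
  case (Cons x w)
  have "(\<Prod>i\<in>I. v i ^ count_list (x # w) i) = (\<Prod>i\<in>I. v i ^ count_list w i * (if i = x then v i else 1))"
    by (intro prod.cong) auto
  also have "\<dots> = (\<Prod>i\<in>I. v i ^ count_list w i) * v x"
    using Cons.prems assms(1) by (simp add: prod.distrib prod.delta)
  finally show ?case using Cons by simp
qed auto

lemma length_eq_sum_count:
  assumes "finite I" "set w \<subseteq> I" shows "length w = (\<Sum>i\<in>I. count_list w i)"
  using assms(2)
proof (induction w)
  case (Cons x w)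
  have "(\<Sum>i\<in>I. count_list (x # w) i) = (\<Sum>i\<in>I. count_list w i + (if i = x then 1 else 0))"
    by (intro sum.cong) auto
  also have "\<dots> = (\<Sum>i\<in>I. count_list w i) + 1"
    using Cons.prems assms(1) by (simp add: sum.distrib sum.delta)
  finally show ?case using Cons by simp
qed auto

text \<open>A monomial of degree \<open>j\<close> is determined by the exponents of all variables but one.\<close>

lemma indep_forms_upper_bound:
  assumes "finite I" "I \<noteq> {}" "W \<subseteq> coord_space I" "indep_forms W j r"
  shows "r \<le> (j + 1) ^ (card I - 1)"
proof -
  obtain k where k: "k \<in> I" using assms by blast
  define I' where "I' = I - {k}"
  have I': "finite I'" "k \<notin> I'" "I = insert k I'" using k assms by (auto simp: I'_def)
  define E where "E = PiE I' (\<lambda>_. {..j})"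
  have E: "finite E" using I' by (auto simp: E_def intro: finite_PiE)
  define mon where "mon = (\<lambda>e v. (\<Prod>i\<in>I'. v i ^ e i) * v k ^ (j - (\<Sum>i\<in>I'. e i)) :: complex)"
  define cnt where "cnt = (\<lambda>w. restrict (count_list w) I')"
  have mon: "prod_list (map v w) = mon (cnt w) v" "cnt w \<in> E" if "set w \<subseteq> I" "length w = j" for w v
  proof -
    have len: "j = count_list w k + (\<Sum>i\<in>I'. count_list w i)"
      using length_eq_sum_count[of I w] that I' assms by simp
    have "prod_list (map v w) = v k ^ count_list w k * (\<Prod>i\<in>I'. v i ^ count_list w i)"
      using prod_list_map_eq_prod_count[of I w v] that I' assms by simp
    also have "count_list w k = j - (\<Sum>i\<in>I'. count_list w i)" using len by simp
    finally show "prod_list (map v w) = mon (cnt w) v"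
      by (simp add: mon_def cnt_def mult_ac)
    have "count_list w i \<le> j" for i using that count_le_length[of w i] by simp
    thus "cnt w \<in> E" by (auto simp: cnt_def E_def)
  qed
  obtain P where P: "\<And>i. i < r \<Longrightarrow> P i \<in> hom_poly j" "indep_on {..<r} W P"
    using assms(4) by (auto simp: indep_forms_def)
  have "\<exists>c. \<forall>v\<in>coord_space I. P i v = (\<Sum>e\<in>E. c e * mon e v)" if i: "i < r" for i
  proof -
    obtain T c where T: "finite T" "\<And>w. w\<in>T \<Longrightarrow> set w \<subseteq> I \<and> length w = j"
      "\<And>v. v\<in>coord_space I \<Longrightarrow> P i v = (\<Sum>w\<in>T. c w * prod_list (map v w))"
      using hom_poly_words[OF P(1)[OF i], of I] by metis
    show ?thesis
    proof (intro exI[of _ "\<lambda>e. \<Sum>w | w \<in> T \<and> cnt w = e. c w"] ballI)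
      fix v assume v: "v \<in> coord_space I"
      have "P i v = (\<Sum>w\<in>T. c w * mon (cnt w) v)"
        unfolding T(3)[OF v] using T(2) mon by (intro sum.cong) auto
      also have "\<dots> = (\<Sum>e\<in>E. \<Sum>w | w \<in> T \<and> cnt w = e. c w * mon (cnt w) v)"
        using T mon E by (intro sum.group[symmetric]) auto
      also have "\<dots> = (\<Sum>e\<in>E. (\<Sum>w | w \<in> T \<and> cnt w = e. c w) * mon e v)"
        unfolding sum_distrib_right by (intro sum.cong) auto
      finally show "P i v = (\<Sum>e\<in>E. (\<Sum>w | w \<in> T \<and> cnt w = e. c w) * mon e v)" .
    qed
  qed
  then obtain c where c: "\<And>i v. i < r \<Longrightarrow> v\<in>coord_space I \<Longrightarrow> P i v = (\<Sum>e\<in>E. c i e * mon e v)"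
    by metis
  have "indep_on {..<r} E c"
  proof (rule indep_onI)
    fix x i assume *: "\<And>e. e \<in> E \<Longrightarrow> (\<Sum>i<r. x i * c i e) = 0" "i \<in> {..<r}"
    have "(\<Sum>i<r. x i * P i v) = 0" if "v \<in> W" for v
    proof -
      have "(\<Sum>i<r. x i * P i v) = (\<Sum>i<r. \<Sum>e\<in>E. x i * c i e * mon e v)"
        using that assms(3) c by (intro sum.cong) (auto simp: sum_distrib_left mult_ac)
      also have "\<dots> = (\<Sum>e\<in>E. (\<Sum>i<r. x i * c i e) * mon e v)"
        by (subst sum.swap) (simp add: sum_distrib_right)
      also have "\<dots> = 0" using * by simp
      finally show ?thesis .
    qed
    thus "x i = 0" using indep_onD[OF P(2)] *(2) by blast
  qed
  hence "card {..<r} \<le> card E" using E by (intro indep_on_card_le) auto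
  also have "card E = (j + 1) ^ card I'" using I' by (simp add: E_def card_PiE)
  also have "card I' = card I - 1" using I' by simp
  finally show ?thesis by simp
qed

text \<open>Evaluate both bounds at \<open>j = A x\<close>: a polynomial of degree \<open>p\<close> in \<open>x\<close> is bounded by one of degree
  \<open>card I - 1\<close>.\<close>

lemma indep_forms_exponent_le:
  assumes "finite I" "I \<noteq> {}" "W \<subseteq> coord_space I" "\<And>j. indep_forms W j ((j div A) ^ p)" "A \<ge> 1"
  shows "p \<le> card I - 1"
proof (rule ccontr)
  assume *: "\<not> p \<le> card I - 1"
  define M where "M = card I - 1"
  have M: "M < p" using * by (simp add: M_def)
  define x where "x = Suc ((2 * A) ^ M)"
  have "x ^ p \<le> (A * x + 1) ^ M"
    using indep_forms_upper_bound[OF assms(1-3) assms(4)[of "A * x"]] assms(5) by (simp add: M_def)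
  also have "\<dots> \<le> (2 * A * x) ^ M" using assms(5) by (intro power_mono) (auto simp: x_def)
  also have "\<dots> = (2 * A) ^ M * x ^ M" by (simp add: power_mult_distrib)
  also have "\<dots> < x * x ^ M" by (simp add: x_def)
  also have "\<dots> \<le> x ^ p" using M power_increasing[of "Suc M" p x] by (simp add: x_def)
  finally show False by simp
qed

text \<open>Induction on the set of variables, comparing coefficients with respect to one of them.\<close>

lemma monomials_independent:
  assumes "finite K" "\<And>y. (\<Sum>e\<in>PiE K (\<lambda>_. {..<q}). x e * (\<Prod>k\<in>K. y k ^ e k)) = (0::complex)"
    "e \<in> PiE K (\<lambda>_. {..<q})"
  shows "x e = 0"
  using assms
proof (induction K arbitrary: x e rule: finite_induct)
  case (insert k F)
  define T where "T = PiE F (\<lambda>_. {..<q})"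
  define C where "C = (\<lambda>y a. \<Sum>e\<in>T. x (e(k := a)) * (\<Prod>l\<in>F. y l ^ e l))"
  have sum: "(\<Sum>e\<in>PiE (insert k F) (\<lambda>_. {..<q}). x e * (\<Prod>l\<in>insert k F. y l ^ e l)) =
    (\<Sum>a<q. y k ^ a * C y a)" for y
  proof -
    have "(\<Sum>e\<in>PiE (insert k F) (\<lambda>_. {..<q}). x e * (\<Prod>l\<in>insert k F. y l ^ e l)) =
      (\<Sum>(a, e)\<in>{..<q} \<times> T. x (e(k := a)) * (\<Prod>l\<in>insert k F. y l ^ (e(k := a)) l))"
      unfolding PiE_insert_eq T_def
      by (subst sum.reindex[OF inj_combinator[OF insert.hyps(2)]]) (simp add: case_prod_unfold)
    also have "\<dots> = (\<Sum>(a, e)\<in>{..<q} \<times> T. y k ^ a * (x (e(k := a)) * (\<Prod>l\<in>F. y l ^ e l)))"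
    proof (intro sum.cong refl, clarify)
      fix a and e :: "'a \<Rightarrow> nat"
      have "(\<Prod>l\<in>F. y l ^ (e(k := a)) l) = (\<Prod>l\<in>F. y l ^ e l)"
        using insert.hyps by (intro prod.cong) auto
      thus "x (e(k := a)) * (\<Prod>l\<in>insert k F. y l ^ (e(k := a)) l) =
          y k ^ a * (x (e(k := a)) * (\<Prod>l\<in>F. y l ^ e l))"
        using insert.hyps by simp
    qed
    finally show ?thesis by (simp add: C_def sum.cartesian_product sum_distrib_left)
  qed
  have C0: "C y a = 0" if "a < q" for y a
  proof -
    define P where "P = (\<Sum>a<q. monom (C y a) a)"
    have "poly P t = 0" for t
    proof -
      have C: "C (y(k := t)) a = C y a" for a
        unfolding C_def using insert.hyps by (intro sum.cong arg_cong2[of _ _ _ _ "(*)"] prod.cong) auto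
      have "(\<Sum>a<q. t ^ a * C y a) = 0"
        using insert.prems(1)[of "y(k := t)"] unfolding sum C by simp
      thus ?thesis by (simp add: P_def poly_sum poly_monom mult_ac)
    qed
    hence "P = 0" using poly_all_0_iff_0 by blast
    hence "coeff P a = 0" by simp
    thus ?thesis using that by (simp add: P_def coeff_sum sum.delta)
  qed
  from insert.prems(2) obtain a f where af: "a < q" "f \<in> T" "e = f(k := a)"
    unfolding PiE_insert_eq T_def by auto
  have "x (f(k := a)) = 0"
    using insert.IH[of "\<lambda>f. x (f(k := a))" f] C0[OF af(1)] af(2) by (simp add: C_def T_def)
  thus ?case using af by (simp only:)
qed auto

text \<open>If the coordinates in \<open>K\<close> satisfy no polynomial relation on the family, then the monomials of degree \<open>j\<close> in
  them are independent.  It suffices to use those in which every variable except one has exponent less than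
  \<open>j div card K\<close>.\<close>

lemma indep_forms_dominant:
  fixes \<Phi> :: "('b \<Rightarrow> complex) \<Rightarrow> ('i \<Rightarrow> complex)"
  assumes "finite K" "K \<noteq> {}" "\<And>i. (\<lambda>b. \<Phi> b i) \<in> poly_fun" "G \<in> poly_fun" "b0 \<in> coord_space L" "G b0 \<noteq> 0"
    and dom: "\<And>q y. q \<in> poly_fun \<Longrightarrow> y \<in> coord_space K \<Longrightarrow> q y \<noteq> 0 \<Longrightarrow>
      \<exists>b \<in> coord_space L. q (\<lambda>i. if i \<in> K then \<Phi> b i else 0) \<noteq> 0"
    and W: "\<And>b. b \<in> coord_space L \<Longrightarrow> G b \<noteq> 0 \<Longrightarrow> \<Phi> b \<in> W"
  shows "indep_forms W j ((j div card K) ^ (card K - 1))"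
proof -
  obtain k where k: "k \<in> K" using assms by blast
  define K' where "K' = K - {k}"
  have K': "finite K'" "k \<notin> K'" "K = insert k K'" using k assms by (auto simp: K'_def)
  define q where "q = j div card K"
  define E where "E = PiE K' (\<lambda>_. {..<q})"
  have E: "finite E" using K' by (auto simp: E_def intro: finite_PiE)
  have cE: "card E = q ^ (card K - 1)" using K' by (simp add: E_def card_PiE)
  define mon where "mon = (\<lambda>e v. (\<Prod>i\<in>K'. v i ^ e i) * v k ^ (j - (\<Sum>i\<in>K'. e i)) :: complex)"
  have mon: "mon e \<in> hom_poly j" if "e \<in> E" for e
  proof -
    have "(\<Sum>i\<in>K'. e i) \<le> (\<Sum>i\<in>K'. q)" using that
      by (intro sum_mono) (fastforce simp: E_def PiE_iff)
    also have "\<dots> \<le> card K * q" using K' by simp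
    also have "\<dots> \<le> j" by (simp add: q_def)
    finally have "(\<Sum>i\<in>K'. e i) \<le> j" .
    moreover have "mon e \<in> hom_poly ((\<Sum>i\<in>K'. e i) + (j - (\<Sum>i\<in>K'. e i)))"
      unfolding mon_def using K'
      by (intro hom_poly_mult hom_poly_prod)
         (use hom_poly_power[OF hom_poly_coord] in auto)
    ultimately show ?thesis by simp
  qed
  obtain h where h: "bij_betw h {0..<card E} E" using ex_bij_betw_nat_finite[OF E] by blast
  have "indep_on {..<card E} W (\<lambda>i. mon (h i))"
  proof (rule indep_onI, rule ccontr)
    fix x i assume *: "\<And>v. v \<in> W \<Longrightarrow> (\<Sum>i<card E. x i * mon (h i) v) = 0" "i \<in> {..<card E}" "x i \<noteq> 0"
    define Q where "Q = (\<lambda>v. \<Sum>i<card E. x i * mon (h i) v)"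
    have hE: "h i \<in> E" if "i < card E" for i using h that by (auto simp: bij_betw_def)
    have Qp: "Q \<in> poly_fun" unfolding Q_def
      using mon hE by (intro poly_fun_sum poly_fun.mult poly_fun.const) (auto intro: hom_poly_imp_poly_fun)
    have "\<exists>y. Q (\<lambda>i. if i \<in> K' then y i else if i = k then 1 else 0) \<noteq> 0"
    proof (rule ccontr)
      assume "\<not> ?thesis"
      hence 0: "Q (\<lambda>i. if i \<in> K' then y i else if i = k then 1 else 0) = 0" for y by blast
      have "(\<Sum>e\<in>E. x (inv_into {..<card E} h e) * (\<Prod>i\<in>K'. y i ^ e i)) = 0" for y
      proof -
        have "(\<Sum>e\<in>E. x (inv_into {..<card E} h e) * (\<Prod>i\<in>K'. y i ^ e i)) =
          (\<Sum>i<card E. x (inv_into {..<card E} h (h i)) * (\<Prod>l\<in>K'. y l ^ h i l))"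
          using h by (subst sum.reindex_bij_betw[symmetric, where g = "\<lambda>e. x (inv_into {..<card E} h e) * (\<Prod>i\<in>K'. y i ^ e i)"])
            (auto simp: atLeast0LessThan)
        also have "\<dots> = Q (\<lambda>i. if i \<in> K' then y i else if i = k then 1 else 0)"
          unfolding Q_def mon_def using K' h
          by (intro sum.cong refl arg_cong2[of _ _ _ _ "(*)"])
             (auto simp: atLeast0LessThan bij_betw_def inv_into_f_f)
        finally show ?thesis using 0 by simp
      qed
      hence "x (inv_into {..<card E} h (h i)) = 0"
        using hE *(2) by (intro monomials_independent[OF K'(1), where q = q and x = "\<lambda>e. x (inv_into {..<card E} h e)" and e = "h i"]) (auto simp: E_def)
      thus False using *(2,3) h by (auto simp: atLeast0LessThan bij_betw_def inv_into_f_f)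
    qed
    then obtain y where y: "Q (\<lambda>i. if i \<in> K' then y i else if i = k then 1 else 0) \<noteq> 0" by blast
    obtain b where b: "b \<in> coord_space L" "Q (\<lambda>i. if i \<in> K then \<Phi> b i else 0) \<noteq> 0"
      using dom[OF Qp _ y] K' by (auto simp: coord_space_def)
    have "Q (\<lambda>i. if i \<in> K then \<Phi> b i else 0) = Q (\<Phi> b)" for b
      unfolding Q_def mon_def using K' by (intro sum.cong refl) auto
    hence b2: "Q (\<Phi> b) \<noteq> 0" using b by metis
    have "(\<lambda>b. Q (\<Phi> b)) \<in> poly_fun" by (rule poly_fun_subst[OF Qp assms(3)])
    then obtain b' where "b' \<in> coord_space L" "Q (\<Phi> b') \<noteq> 0" "G b' \<noteq> 0"
      using coord_space_irreducible[of "\<lambda>b. Q (\<Phi> b)" G b L b0] assms b b2 by blast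
    thus False using *(1)[OF W] by (auto simp: Q_def)
  qed
  moreover have "mon (h i) \<in> hom_poly j" if "i < card E" for i
    using mon bij_betwE[OF h] that by simp
  ultimately show ?thesis unfolding indep_forms_def cE[symmetric] q_def[symmetric]
    by (intro exI[of _ "\<lambda>i. mon (h i)"] conjI allI impI)
qed

section \<open>Closed sets of the space of morphisms\<close>

lemma proj_pt_self: "v \<in> proj_pt v"
  by (auto simp: proj_pt_def smul_def intro!: exI[of _ 1])

lemma proj_pt_eq: "u \<in> proj_pt v \<Longrightarrow> proj_pt u = proj_pt v"
proof -
  assume "u \<in> proj_pt v"
  then obtain c where c: "c \<noteq> 0" "u = smul c v" by (auto simp: proj_pt_def)
  have "smul b u = smul (b * c) v" for b by (simp add: c smul_def mult_ac)
  hence 1: "smul b u \<in> proj_pt v" if "b \<noteq> 0" for b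
    using that c(1) unfolding proj_pt_def by (intro CollectI exI[of _ "b * c"]) simp
  have "smul b v = smul (b / c) u" for b using c by (simp add: smul_def fun_eq_iff)
  hence 2: "smul b v \<in> proj_pt u" if "b \<noteq> 0" for b
    using that c(1) unfolding proj_pt_def by (intro CollectI exI[of _ "b / c"]) simp
  show ?thesis
  proof (intro subset_antisym subsetI)
    fix x assume "x \<in> proj_pt u"
    then obtain b where "b \<noteq> 0" "x = smul b u" by (auto simp: proj_pt_def)
    thus "x \<in> proj_pt v" using 1 by simp
  next
    fix x assume "x \<in> proj_pt v"
    then obtain b where "b \<noteq> 0" "x = smul b v" by (auto simp: proj_pt_def)
    thus "x \<in> proj_pt u" using 2 by simp
  qed
qed

lemma hom_poly_zero_on_proj_pt:
  assumes "p \<in> hom_poly n" "u \<in> proj_pt v"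
  shows "p u = 0 \<longleftrightarrow> p v = 0"
  using assms by (auto simp: proj_pt_def hom_polyD)

lemma nondegenerate_nonzero:
  assumes "nondegenerate_morphism d a"
  shows "a \<noteq> 0" "a \<in> coord_space (param_index d)"
proof
  assume "a = 0"
  have "(\<lambda>i. if i = 0 then 1 else 0) \<in> coord_space {..<2::nat}" "(\<lambda>i. if i = 0 then 1 else 0 :: complex) \<noteq> (0 :: nat \<Rightarrow> _)"
    by (auto simp: coord_space_def fun_eq_iff zero_fun_def)
  hence "param d a (\<lambda>i. if i = 0 then 1 else 0) \<noteq> 0"
    using assms unfolding nondegenerate_morphism_def by blast
  thus False by (simp add: param_def \<open>a = 0\<close> zero_fun_def)
qed (use assms in \<open>auto simp: nondegenerate_morphism_def\<close>)

definition hom_open :: "'i set \<Rightarrow> (('i \<Rightarrow> complex) \<Rightarrow> complex) \<Rightarrow> ('i \<Rightarrow> complex) set set"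
  where "hom_open I p = {proj_pt v | v. v \<in> coord_space I \<and> v \<noteq> 0 \<and> p v \<noteq> 0}"

text \<open>Intersections of basic open sets are basic, because products of forms are forms.\<close>

lemma zariski_base:
  assumes "openin (zariski I) T" "Q \<in> T"
  shows "\<exists>n. \<exists>p \<in> hom_poly n. Q \<in> hom_open I p \<and> hom_open I p \<subseteq> T"
proof -
  have "generate_topology_on {hom_open I p | p. \<exists>n. p \<in> hom_poly n} T"
    using assms(1) by (simp add: zariski_def hom_open_def openin_topology_generated_by_iff)
  thus ?thesis using assms(2)
  proof induction
    case (Int A B)
    then obtain n p m q where p: "p \<in> hom_poly n" "Q \<in> hom_open I p" "hom_open I p \<subseteq> A"
      and q: "q \<in> hom_poly m" "Q \<in> hom_open I q" "hom_open I q \<subseteq> B" by blast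
    from p(2) obtain v where v: "Q = proj_pt v" "v \<in> coord_space I" "v \<noteq> 0" "p v \<noteq> 0"
      by (auto simp: hom_open_def)
    from q(2) obtain u where u: "Q = proj_pt u" "q u \<noteq> 0" by (auto simp: hom_open_def)
    have "q v \<noteq> 0" using hom_poly_zero_on_proj_pt[OF q(1), of u v] u v proj_pt_self by metis
    hence "Q \<in> hom_open I (\<lambda>v. p v * q v)" using v by (auto simp: hom_open_def)
    moreover have "hom_open I (\<lambda>v. p v * q v) \<subseteq> A \<inter> B"
      using p(3) q(3) by (fastforce simp: hom_open_def)
    ultimately show ?case using hom_poly_mult[OF p(1) q(1)] by blast
  next
    case (UN \<K>)
    then show ?case by (meson Union_iff Union_upper subset_trans)
  qed auto
qed

lemma openin_hom_open: "p \<in> hom_poly n \<Longrightarrow> openin (zariski I) (hom_open I p)"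
  unfolding zariski_def hom_open_def by (intro topology_generated_by_Basis) auto

lemma nondegenerate_in_hom_open:
  assumes "nondegenerate_morphism d a" "p \<in> hom_poly n"
  shows "proj_pt a \<in> hom_open (param_index d) p \<longleftrightarrow> p a \<noteq> 0"
proof
  assume "proj_pt a \<in> hom_open (param_index d) p"
  then obtain v where "proj_pt a = proj_pt v" "p v \<noteq> 0" by (auto simp: hom_open_def)
  thus "p a \<noteq> 0" using hom_poly_zero_on_proj_pt[OF assms(2), of a v] proj_pt_self by metis
qed (use nondegenerate_nonzero[OF assms(1)] in \<open>auto simp: hom_open_def\<close>)

lemma topspace_morphism_space: "topspace (morphism_space d) = nondegenerate_morphisms d"
proof -
  have "nondegenerate_morphisms d \<subseteq> hom_open (param_index d) (\<lambda>_. 1)"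
    using nondegenerate_in_hom_open[OF _ hom_poly_const[of 1]] by (auto simp: nondegenerate_morphisms_def)
  also have "\<dots> \<subseteq> topspace (zariski (param_index d))"
    by (rule openin_subset[OF openin_hom_open[OF hom_poly_const]])
  finally show ?thesis by (auto simp: morphism_space_def)
qed

lemma closedin_zero_locus:
  assumes "p \<in> hom_poly n"
  shows "closedin (morphism_space d) {Q \<in> nondegenerate_morphisms d. \<forall>v\<in>Q. p v = 0}"
proof -
  have *: "{Q \<in> nondegenerate_morphisms d. \<forall>v\<in>Q. p v = 0} =
    nondegenerate_morphisms d - nondegenerate_morphisms d \<inter> hom_open (param_index d) p"
  proof (intro set_eqI iffI)
    fix Q assume Q: "Q \<in> {Q \<in> nondegenerate_morphisms d. \<forall>v\<in>Q. p v = 0}"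
    then obtain a where "nondegenerate_morphism d a" "Q = proj_pt a" by (auto simp: nondegenerate_morphisms_def)
    thus "Q \<in> nondegenerate_morphisms d - nondegenerate_morphisms d \<inter> hom_open (param_index d) p"
      using Q nondegenerate_in_hom_open[OF _ assms] proj_pt_self by blast
  next
    fix Q assume Q: "Q \<in> nondegenerate_morphisms d - nondegenerate_morphisms d \<inter> hom_open (param_index d) p"
    then obtain a where "nondegenerate_morphism d a" "Q = proj_pt a" by (auto simp: nondegenerate_morphisms_def)
    thus "Q \<in> {Q \<in> nondegenerate_morphisms d. \<forall>v\<in>Q. p v = 0}"
      using Q nondegenerate_in_hom_open[OF _ assms] hom_poly_zero_on_proj_pt[OF assms, of _ a] by blast
  qed
  have "openin (morphism_space d) (nondegenerate_morphisms d \<inter> hom_open (param_index d) p)"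
    unfolding morphism_space_def by (rule openin_subtopology_Int2[OF openin_hom_open[OF assms]])
  thus ?thesis unfolding * using topspace_morphism_space[of d] by (metis closedin_diff closedin_topspace)
qed

lemma closedin_separate:
  assumes "closedin (morphism_space d) W" "nondegenerate_morphism d a" "proj_pt a \<notin> W"
  shows "\<exists>n. \<exists>p \<in> hom_poly n. p a \<noteq> 0 \<and> (\<forall>v\<in>\<Union>W. p v = 0)"
proof -
  have W: "W \<subseteq> nondegenerate_morphisms d"
    using closedin_subset[OF assms(1)] by (simp add: topspace_morphism_space)
  have "openin (morphism_space d) (nondegenerate_morphisms d - W)"
    using assms(1) topspace_morphism_space[of d] by (metis closedin_def)
  then obtain T where T: "openin (zariski (param_index d)) T" "nondegenerate_morphisms d - W = T \<inter> nondegenerate_morphisms d"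
    by (auto simp: morphism_space_def openin_subtopology)
  have "proj_pt a \<in> T" using T assms by (auto simp: nondegenerate_morphisms_def)
  then obtain n p where p: "p \<in> hom_poly n" "proj_pt a \<in> hom_open (param_index d) p" "hom_open (param_index d) p \<subseteq> T"
    using zariski_base[OF T(1)] by blast
  have "p v = 0" if vQ: "v \<in> Q" "Q \<in> W" for v Q
  proof (rule ccontr)
    assume "p v \<noteq> 0"
    obtain b where b: "nondegenerate_morphism d b" "Q = proj_pt b" using vQ W
      unfolding nondegenerate_morphisms_def by blast
    have "p b \<noteq> 0" using \<open>p v \<noteq> 0\<close> hom_poly_zero_on_proj_pt[OF p(1), of v b] b vQ by auto
    hence "Q \<in> T" using nondegenerate_in_hom_open[OF b(1) p(1)] p b by auto
    thus False using T(2) W vQ by blast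
  qed
  thus ?thesis using p nondegenerate_in_hom_open[OF assms(2) p(1)] by blast
qed

text \<open>The zero loci of the two forms are closed and cover \<open>W\<close>.\<close>

lemma irreducible_prime:
  assumes "irreducible_in (morphism_space d) W" "p \<in> hom_poly n" "q \<in> hom_poly k"
    "\<And>v. v \<in> \<Union>W \<Longrightarrow> p v * q v = 0"
  shows "(\<forall>v\<in>\<Union>W. p v = 0) \<or> (\<forall>v\<in>\<Union>W. q v = 0)"
proof -
  let ?A = "\<lambda>p. {Q \<in> nondegenerate_morphisms d. \<forall>v\<in>Q. p v = 0}"
  have W: "W \<subseteq> nondegenerate_morphisms d" using assms(1)
    by (auto simp: irreducible_in_def topspace_morphism_space)
  have "W \<subseteq> ?A p \<union> ?A q"
  proof
    fix Q assume Q: "Q \<in> W"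
    then obtain a where a: "Q = proj_pt a" using W by (auto simp: nondegenerate_morphisms_def)
    have "p a = 0 \<or> q a = 0" using assms(4)[of a] Q a proj_pt_self by auto
    thus "Q \<in> ?A p \<union> ?A q" using W Q a
      hom_poly_zero_on_proj_pt[OF assms(2)] hom_poly_zero_on_proj_pt[OF assms(3)] by auto
  qed
  moreover have "closedin (morphism_space d) A \<and> closedin (morphism_space d) B \<and> W \<subseteq> A \<union> B \<Longrightarrow>
      W \<subseteq> A \<or> W \<subseteq> B" for A B
    using assms(1) unfolding irreducible_in_def by simp
  ultimately have "W \<subseteq> ?A p \<or> W \<subseteq> ?A q"
    using closedin_zero_locus[OF assms(2), of d] closedin_zero_locus[OF assms(3), of d] by presburger
  thus ?thesis by blast
qed

lemma finite_param_index: "finite (param_index d)" "card (param_index d) = 4 * (d + 1)" "param_index d \<noteq> {}"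
  by (auto simp: param_index_def lessThan_empty_iff)

lemma cone_subset_coord_space:
  assumes "W \<subseteq> nondegenerate_morphisms d" shows "\<Union>W \<subseteq> coord_space (param_index d)"
proof
  fix v assume "v \<in> \<Union>W"
  then obtain a where "nondegenerate_morphism d a" "v \<in> proj_pt a"
    using assms by (auto simp: nondegenerate_morphisms_def)
  thus "v \<in> coord_space (param_index d)"
    using nondegenerate_nonzero(2) by (auto simp: proj_pt_def smul_def coord_space_def)
qed

text \<open>Each step of a chain above \<open>Z\<close> raises the growth exponent by one, and the exponent cannot exceed the
  dimension of the projective space of all parameterizations.\<close>

lemma codim_irreducible_le:
  assumes "Z \<noteq> {}" "\<And>j. indep_forms (\<Union>Z) j ((j div A) ^ p)" "A \<ge> 1"
  shows "codim_irreducible (morphism_space d) Z \<le> enat (4 * (d + 1) - 1 - p)"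
  unfolding codim_irreducible_def
proof (rule Sup_least, clarify)
  fix n and W :: "nat \<Rightarrow> (nat \<times> nat \<Rightarrow> complex) set set"
  assume W: "Z = W 0" "\<forall>i\<le>n. closedin (morphism_space d) (W i) \<and> irreducible_in (morphism_space d) (W i)"
    "\<forall>i<n. W i \<subset> W (Suc i)"
  have N: "W i \<subseteq> nondegenerate_morphisms d" "W i \<noteq> {}" if "i \<le> n" for i
    using W(2) that by (auto simp: irreducible_in_def topspace_morphism_space)
  have "\<exists>A\<ge>1. \<forall>j. indep_forms (\<Union>(W i)) j ((j div A) ^ (p + i))" if "i \<le> n" for i
    using that
  proof (induction i)
    case 0
    then show ?case using assms W(1) by auto
  next
    case (Suc i)
    then obtain A where A: "A \<ge> 1" "\<And>j. indep_forms (\<Union>(W i)) j ((j div A) ^ (p + i))" by auto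
    have sub: "W i \<subset> W (Suc i)" using W(3) Suc.prems by simp
    then obtain Q where Q: "Q \<in> W (Suc i)" "Q \<notin> W i" by blast
    obtain a where a: "nondegenerate_morphism d a" "Q = proj_pt a"
      using Q N(1)[OF Suc.prems] by (auto simp: nondegenerate_morphisms_def)
    obtain e f where f: "f \<in> hom_poly e" "f a \<noteq> 0" "\<And>v. v \<in> \<Union>(W i) \<Longrightarrow> f v = 0"
      using closedin_separate[of d "W i" a] W(2) Suc.prems a Q by (metis Suc_leD)
    have "e \<noteq> 0"
    proof
      assume "e = 0"
      obtain Q0 where Q0: "Q0 \<in> W i" using N(2)[of i] Suc.prems by auto
      then obtain b where "Q0 = proj_pt b" using N(1)[of i] Suc.prems by (auto simp: nondegenerate_morphisms_def)
      hence "f b = 0" using f(3)[of b] Q0 proj_pt_self by auto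
      moreover have "f v = f (smul 0 v)" for v using hom_polyD[OF f(1), of 0 v] \<open>e = 0\<close> by simp
      moreover have "smul 0 a = smul 0 b" by (simp add: smul_def)
      ultimately show False using f(2) by metis
    qed
    have "\<exists>A'\<ge>1. \<forall>j. indep_forms (\<Union>(W (Suc i))) j ((j div A') ^ Suc (p + i))"
    proof (rule indep_forms_growth[OF A(2,1) _ _ f(1) f(3)])
      show "\<Union>(W i) \<subseteq> \<Union>(W (Suc i))" using sub by blast
      fix j q v assume q: "q \<in> hom_poly j" "\<And>v. v \<in> \<Union>(W (Suc i)) \<Longrightarrow> f v * q v = 0" "v \<in> \<Union>(W (Suc i))"
      have "(\<forall>v\<in>\<Union>(W (Suc i)). f v = 0) \<or> (\<forall>v\<in>\<Union>(W (Suc i)). q v = 0)"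
        using W(2) Suc.prems by (intro irreducible_prime[OF _ f(1) q(1) q(2)]) auto
      moreover have "a \<in> \<Union>(W (Suc i))" using Q a proj_pt_self by auto
      ultimately show "q v = 0" using f(2) q(3) by blast
    qed (use \<open>e \<noteq> 0\<close> in auto)
    then show ?case by simp
  qed
  then obtain A where A: "A \<ge> 1" "\<And>j. indep_forms (\<Union>(W n)) j ((j div A) ^ (p + n))" by auto
  have "p + n \<le> card (param_index d) - 1"
    using indep_forms_exponent_le[OF finite_param_index(1,3) cone_subset_coord_space[OF N(1)] A(2,1)] by simp
  thus "enat n \<le> enat (4 * (d + 1) - 1 - p)" by (simp add: finite_param_index)
qed

lemma closure_of_family_irreducible:
  assumes "\<And>i. (\<lambda>b. \<Phi> b i) \<in> poly_fun" "G \<in> poly_fun" "b0 \<in> coord_space L" "G b0 \<noteq> 0"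
    and nd: "\<And>b. b \<in> coord_space L \<Longrightarrow> G b \<noteq> 0 \<Longrightarrow> nondegenerate_morphism d (\<Phi> b)"
  defines "V \<equiv> {proj_pt (\<Phi> b) | b. b \<in> coord_space L \<and> G b \<noteq> 0}"
  shows "irreducible_in (morphism_space d) (morphism_space d closure_of V)"
    "\<And>b. b \<in> coord_space L \<Longrightarrow> G b \<noteq> 0 \<Longrightarrow> \<Phi> b \<in> \<Union>(morphism_space d closure_of V)"
proof -
  let ?X = "morphism_space d"
  have V: "V \<subseteq> nondegenerate_morphisms d" using nd by (auto simp: V_def nondegenerate_morphisms_def)
  hence sub: "V \<subseteq> ?X closure_of V" by (simp add: closure_of_subset topspace_morphism_space)
  have "proj_pt (\<Phi> b0) \<in> V" using assms(3,4) by (auto simp: V_def)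
  show "\<Phi> b \<in> \<Union>(morphism_space d closure_of V)" if "b \<in> coord_space L" "G b \<noteq> 0" for b
    using sub that proj_pt_self[of "\<Phi> b"] by (auto simp: V_def)
  show "irreducible_in ?X (?X closure_of V)"
    unfolding irreducible_in_def
  proof (intro conjI allI impI)
    show "?X closure_of V \<subseteq> topspace ?X" by (rule closure_of_subset_topspace)
    show "?X closure_of V \<noteq> {}" using sub \<open>proj_pt (\<Phi> b0) \<in> V\<close> by blast
    fix A B assume AB: "closedin ?X A \<and> closedin ?X B \<and> ?X closure_of V \<subseteq> A \<union> B"
    have "V \<subseteq> A \<or> V \<subseteq> B"
    proof (rule ccontr)
      assume "\<not> ?thesis"
      then obtain b1 b2 where b: "b1 \<in> coord_space L" "G b1 \<noteq> 0" "proj_pt (\<Phi> b1) \<notin> A"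
        "b2 \<in> coord_space L" "G b2 \<noteq> 0" "proj_pt (\<Phi> b2) \<notin> B" by (auto simp: V_def)
      obtain n p where p: "p \<in> hom_poly n" "p (\<Phi> b1) \<noteq> 0" "\<And>v. v\<in>\<Union>A \<Longrightarrow> p v = 0"
        using closedin_separate[of d A "\<Phi> b1"] AB b nd by blast
      obtain m q where q: "q \<in> hom_poly m" "q (\<Phi> b2) \<noteq> 0" "\<And>v. v\<in>\<Union>B \<Longrightarrow> q v = 0"
        using closedin_separate[of d B "\<Phi> b2"] AB b nd by blast
      have P: "(\<lambda>b. p (\<Phi> b)) \<in> poly_fun" "(\<lambda>b. q (\<Phi> b)) \<in> poly_fun"
        using p(1) q(1) by (auto intro!: poly_fun_subst[OF _ assms(1)] intro: hom_poly_imp_poly_fun)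
      have "\<exists>b\<in>coord_space L. \<forall>f\<in>{\<lambda>b. p (\<Phi> b), \<lambda>b. q (\<Phi> b), G}. f b \<noteq> 0"
        using P assms(2) b p(2) q(2)
        by (intro coord_space_irreducible_finite[of _ L "\<lambda>f. f"]) auto
      then obtain b where b: "b \<in> coord_space L" "p (\<Phi> b) \<noteq> 0" "q (\<Phi> b) \<noteq> 0" "G b \<noteq> 0" by auto
      have "proj_pt (\<Phi> b) \<in> A \<union> B" using AB sub b by (auto simp: V_def)
      hence "\<Phi> b \<in> \<Union>A \<or> \<Phi> b \<in> \<Union>B" using proj_pt_self[of "\<Phi> b"] by (metis UnE UnionI)
      thus False using p(3)[of "\<Phi> b"] q(3)[of "\<Phi> b"] b(2,3) by argo
    qed
    thus "?X closure_of V \<subseteq> A \<or> ?X closure_of V \<subseteq> B" using AB closure_of_minimal by blast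
  qed
qed

text \<open>The closure of the family is irreducible.  As the coordinates in \<open>K\<close> satisfy no relation on it, the
  number of independent forms grows at least like the power \<open>card K - 1\<close> of the degree.\<close>

theorem codim_le_of_family:
  fixes \<Phi> :: "('b \<Rightarrow> complex) \<Rightarrow> (nat \<times> nat \<Rightarrow> complex)"
  assumes "finite K" "K \<noteq> {}" "\<And>i. (\<lambda>b. \<Phi> b i) \<in> poly_fun" "G \<in> poly_fun" "b0 \<in> coord_space L" "G b0 \<noteq> 0"
    and dom: "\<And>q y. q \<in> poly_fun \<Longrightarrow> y \<in> coord_space K \<Longrightarrow> q y \<noteq> 0 \<Longrightarrow>
      \<exists>b \<in> coord_space L. q (\<lambda>i. if i \<in> K then \<Phi> b i else 0) \<noteq> 0"
    and nd: "\<And>b. b \<in> coord_space L \<Longrightarrow> G b \<noteq> 0 \<Longrightarrow> nondegenerate_morphism d (\<Phi> b)"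
    and V: "\<And>b. b \<in> coord_space L \<Longrightarrow> G b \<noteq> 0 \<Longrightarrow> proj_pt (\<Phi> b) \<in> V"
  shows "codim (morphism_space d) V \<le> enat (4 * (d + 1) - card K)"
proof -
  let ?X = "morphism_space d"
  define V' where "V' = {proj_pt (\<Phi> b) | b. b \<in> coord_space L \<and> G b \<noteq> 0}"
  define Z where "Z = ?X closure_of V'"
  have irr: "irreducible_in ?X Z" "\<And>b. b \<in> coord_space L \<Longrightarrow> G b \<noteq> 0 \<Longrightarrow> \<Phi> b \<in> \<Union>Z"
    unfolding Z_def V'_def using closure_of_family_irreducible[where \<Phi> = \<Phi>, OF assms(3-6) nd] by blast+
  have "indep_forms (\<Union>Z) j ((j div card K) ^ (card K - 1))" for j
    by (rule indep_forms_dominant[OF assms(1-7)]) (use irr(2) in auto)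
  moreover have "card K \<ge> 1" using assms(1,2) by (simp add: Suc_le_eq card_gt_0_iff)
  ultimately have "codim_irreducible ?X Z \<le> enat (4 * (d + 1) - 1 - (card K - 1))"
    using irr(1) by (intro codim_irreducible_le[where A = "card K"]) (auto simp: irreducible_in_def)
  also have "4 * (d + 1) - 1 - (card K - 1) = 4 * (d + 1) - card K" using \<open>card K \<ge> 1\<close> by simp
  finally have *: "codim_irreducible ?X Z \<le> enat (4 * (d + 1) - card K)" .
  have "V' \<subseteq> V" using V by (auto simp: V'_def)
  hence "Z \<subseteq> ?X closure_of V" unfolding Z_def by (rule closure_of_mono)
  hence "codim ?X V \<le> codim_irreducible ?X Z" unfolding codim_def
    using irr(1) by (intro INF_lower) (auto simp: Z_def)
  thus ?thesis using * by simp
qed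

section \<open>Orders of vanishing in spaces of power series\<close>

interpretation fpsv: vector_space "\<lambda>(c :: complex) F. fps_const c * F"
  by unfold_locales (auto simp: algebra_simps fps_const_add[symmetric] fps_const_mult[symmetric]
      simp del: fps_const_add fps_const_mult)

lemma X_power_dvd_iff: "fps_X ^ N dvd F \<longleftrightarrow> (\<forall>j<N. fps_nth (F :: complex fps) j = 0)"
proof
  assume "fps_X ^ N dvd F"
  thus "\<forall>j<N. fps_nth F j = 0" by (auto simp: dvd_def fps_X_power_mult_nth)
next
  assume *: "\<forall>j<N. fps_nth F j = 0"
  have "F = fps_X ^ N * fps_shift N F"
    using * by (auto simp: fps_eq_iff fps_X_power_mult_nth)
  thus "fps_X ^ N dvd F" by (metis dvd_triv_left)
qed

lemma span_mult:
  assumes "F \<in> fpsv.span A" "G \<in> fpsv.span B" "\<And>x y. x \<in> A \<Longrightarrow> y \<in> B \<Longrightarrow> x * y \<in> fpsv.span C"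
  shows "F * G \<in> fpsv.span C"
proof -
  have *: "x * G \<in> fpsv.span C" if "x \<in> A" for x
    using assms(2)
  proof (induction rule: fpsv.span_induct_alt)
    case (step c y H)
    have "x * (fps_const c * y + H) = fps_const c * (x * y) + x * H" by (simp add: algebra_simps)
    then show ?case using step assms(3)[OF that] by (auto intro: fpsv.span_add fpsv.span_scale)
  qed (auto intro: fpsv.span_zero)
  show ?thesis using assms(1)
  proof (induction rule: fpsv.span_induct_alt)
    case (step c y H)
    have "(fps_const c * y + H) * G = fps_const c * (y * G) + H * G" by (simp add: algebra_simps)
    then show ?case using step * by (auto intro: fpsv.span_add fpsv.span_scale)
  qed (auto intro: fpsv.span_zero)
qed

lemma span_image_finite:
  assumes "finite T" "F \<in> fpsv.span (h ` T)"
  shows "\<exists>c. F = (\<Sum>w\<in>T. fps_const (c w) * h w)"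
  using assms(2)
proof (induction rule: fpsv.span_induct_alt)
  case base
  show ?case by (intro exI[of _ "\<lambda>_. 0"]) simp
next
  case (step a x G)
  then obtain c u where c: "G = (\<Sum>w\<in>T. fps_const (c w) * h w)" and u: "u \<in> T" "x = h u" by blast
  have "fps_const a * x + G = (\<Sum>w\<in>T. fps_const (if w = u then a else 0) * h w + fps_const (c w) * h w)"
    using u assms(1) unfolding sum.distrib c
    by (simp add: if_distrib[of fps_const] if_distribR if_distrib[of "\<lambda>z. z * _"] sum.delta cong: if_cong)
  thus ?case by (intro exI[of _ "\<lambda>w. (if w = u then a else 0) + c w"])
    (simp add: fps_const_add[symmetric] distrib_right del: fps_const_add)
qed

text \<open>A finite-dimensional space of power series has as many orders as its dimension.  Dimensions are
  therefore counted by orders.\<close>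

definition ords :: "complex fps set \<Rightarrow> nat set"
  where "ords U = subdegree ` (U - {0})"

lemma ords_mono: "U \<subseteq> V \<Longrightarrow> ords U \<subseteq> ords V" by (auto simp: ords_def)

lemma ordsI: "F \<in> U \<Longrightarrow> fps_nth F v \<noteq> 0 \<Longrightarrow> (\<And>j. j < v \<Longrightarrow> fps_nth F j = 0) \<Longrightarrow> v \<in> ords U"
  unfolding ords_def by (intro image_eqI[of _ _ F]) (auto intro!: subdegreeI[symmetric])

lemma ordsE:
  assumes "v \<in> ords U"
  obtains F where "F \<in> U" "fps_nth F v \<noteq> 0" "\<And>j. j < v \<Longrightarrow> fps_nth F j = 0"
  using assms nth_less_subdegree_zero nth_subdegree_nonzero unfolding ords_def by blast

text \<open>A combination whose coefficients at all orders occurring in \<open>U\<close> vanish has no order below \<open>n\<close>.\<close>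

lemma card_le_ords:
  assumes "fpsv.subspace U" "finite I" "\<And>i. i \<in> I \<Longrightarrow> F i \<in> U"
    "indep_on I {..<n} (\<lambda>i c. fps_nth (F i) c)"
  shows "card I \<le> card (ords U \<inter> {..<n})"
proof (rule indep_on_card_le[OF assms(2)])
  show "indep_on I (ords U \<inter> {..<n}) (\<lambda>i c. fps_nth (F i) c)"
  proof (rule indep_onI)
    fix x i assume *: "\<And>c. c \<in> ords U \<inter> {..<n} \<Longrightarrow> (\<Sum>i\<in>I. x i * fps_nth (F i) c) = 0" "i \<in> I"
    define G where "G = (\<Sum>i\<in>I. fps_const (x i) * F i)"
    have G: "G \<in> U" unfolding G_def using assms
      by (intro fpsv.subspace_sum fpsv.subspace_scale) auto
    have nth: "fps_nth G c = (\<Sum>i\<in>I. x i * fps_nth (F i) c)" for c by (simp add: G_def fps_sum_nth)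
    have "fps_nth G c = 0" if "c < n" for c
    proof (rule ccontr)
      assume "fps_nth G c \<noteq> 0"
      hence "subdegree G \<le> c" "G \<noteq> 0" by (auto intro: subdegree_leI)
      hence "subdegree G \<in> ords U \<inter> {..<n}" using G that by (auto simp: ords_def)
      from *(1)[OF this] show False using \<open>G \<noteq> 0\<close> nth by (metis nth_subdegree_nonzero)
    qed
    thus "x i = 0" using indep_onD[OF assms(4) _ *(2)] nth by (metis lessThan_iff)
  qed
qed auto

lemma indep_on_triangular:
  assumes "finite T" "T \<subseteq> {..<n}" "\<And>v. v \<in> T \<Longrightarrow> fps_nth (F v) v \<noteq> 0"
    "\<And>v j. v \<in> T \<Longrightarrow> j < v \<Longrightarrow> fps_nth (F v) j = 0"
  shows "indep_on T {..<n} (\<lambda>v c. fps_nth (F v) c :: complex)"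
proof (rule indep_onI, rule ccontr)
  fix x i assume *: "\<And>c. c \<in> {..<n} \<Longrightarrow> (\<Sum>v\<in>T. x v * fps_nth (F v) c) = 0" "i \<in> T" "x i \<noteq> 0"
  define v where "v = (LEAST v. v \<in> T \<and> x v \<noteq> 0)"
  have v: "v \<in> T" "x v \<noteq> 0" unfolding v_def using LeastI[of "\<lambda>v. v \<in> T \<and> x v \<noteq> 0" i] * by auto
  have less: "x u = 0" if "u \<in> T" "u < v" for u
    using not_less_Least[of u "\<lambda>v. v \<in> T \<and> x v \<noteq> 0"] that by (auto simp: v_def)
  have "(\<Sum>u\<in>T. x u * fps_nth (F u) v) = (\<Sum>u\<in>T. if u = v then x v * fps_nth (F v) v else 0)"
    using assms(4) less by (intro sum.cong) (auto, metis linorder_neqE_nat)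
  also have "\<dots> = x v * fps_nth (F v) v" using v assms(1) by simp
  finally show False using *(1)[of v] v assms(2,3) by auto
qed

section \<open>Spans of products of power series\<close>

definition word_span :: "(nat \<Rightarrow> complex fps) \<Rightarrow> nat list set \<Rightarrow> complex fps set"
  where "word_span f T = fpsv.span ((\<lambda>w. prod_list (map f w)) ` T)"

definition words :: "nat \<Rightarrow> nat list set"
  where "words k = {w. set w \<subseteq> {..<4} \<and> length w = k}"

text \<open>The restrictions to a curve of the forms of degree \<open>k\<close>, in terms of a local parameter.\<close>

abbreviation forms_on :: "(nat \<Rightarrow> complex fps) \<Rightarrow> nat \<Rightarrow> complex fps set"
  where "forms_on f k \<equiv> word_span f (words k)"

lemma finite_words: "finite (words k)"
  unfolding words_def using finite_lists_length_eq[of "{..<4 :: nat}" k] by simp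

lemma subspace_word_span: "fpsv.subspace (word_span f T)"
  unfolding word_span_def by (rule fpsv.subspace_span)

lemma word_span_mono: "T \<subseteq> T' \<Longrightarrow> word_span f T \<subseteq> word_span f T'"
  unfolding word_span_def by (intro fpsv.span_mono image_mono)

lemma word_in_span: "w \<in> T \<Longrightarrow> prod_list (map f w) \<in> word_span f T"
  unfolding word_span_def by (intro fpsv.span_base) auto

lemma word_span_mult:
  assumes "F \<in> word_span f A" "G \<in> word_span f B" "\<And>u w. u \<in> A \<Longrightarrow> w \<in> B \<Longrightarrow> u @ w \<in> C"
  shows "F * G \<in> word_span f C"
  unfolding word_span_def
proof (rule span_mult[OF assms(1,2)[unfolded word_span_def]], clarify)
  fix u w assume "u \<in> A" "w \<in> B"
  thus "prod_list (map f u) * prod_list (map f w) \<in> fpsv.span ((\<lambda>w. prod_list (map f w)) ` C)"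
    using assms(3)[of u w] by (intro fpsv.span_base image_eqI[of _ _ "u @ w"]) auto
qed

lemma forms_on_mult: "F \<in> forms_on f k \<Longrightarrow> G \<in> forms_on f l \<Longrightarrow> F * G \<in> forms_on f (k + l)"
  by (erule word_span_mult) (auto simp: words_def)

lemma row_in_forms_on: "i < 4 \<Longrightarrow> f i \<in> forms_on f 1"
  using word_in_span[of "[i]" "words 1" f] by (simp add: words_def)

lemma one_in_forms_on: "1 \<in> forms_on f 0"
  using word_in_span[of "[]" "words 0" f] by (simp add: words_def)

lemma power_in_forms_on: "F \<in> forms_on f k \<Longrightarrow> F ^ n \<in> forms_on f (n * k)"
  by (induction n) (use one_in_forms_on forms_on_mult in auto)

lemma row_power_in_forms_on: "i < 4 \<Longrightarrow> f i ^ n \<in> forms_on f n"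
  using power_in_forms_on[OF row_in_forms_on, of i f n] by simp

lemma forms_on_subset:
  assumes "\<And>i. i < 4 \<Longrightarrow> g i \<in> forms_on f 1"
  shows "forms_on g k \<subseteq> forms_on f k"
proof -
  have "prod_list (map g w) \<in> forms_on f (length w)" if "set w \<subseteq> {..<4}" for w
    using that
  proof (induction w)
    case (Cons i w)
    then show ?case using forms_on_mult[OF assms[of i] Cons.IH] by simp
  qed (use one_in_forms_on in simp)
  thus ?thesis unfolding word_span_def[of g]
    by (intro fpsv.span_minimal subspace_word_span) (auto simp: words_def)
qed

text \<open>The number of orders below \<open>n\<close> is the dimension of the space of truncations, and the rank of a polynomial
  matrix is lower semicontinuous.\<close>

lemma ords_semicontinuous:
  assumes "\<And>i j. (\<lambda>a. fps_nth (f a i) j) \<in> poly_fun" "finite T"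
  shows "\<exists>p \<in> poly_fun. p a0 \<noteq> 0 \<and> (\<forall>a. p a \<noteq> 0 \<longrightarrow>
    card (ords (word_span (f a0) T) \<inter> {..<n}) \<le> card (ords (word_span (f a) T) \<inter> {..<n}))"
proof -
  define S where "S = ords (word_span (f a0) T) \<inter> {..<n}"
  define H where "H = (\<lambda>a c. \<Sum>w\<in>T. fps_const (c w) * prod_list (map (f a) w))"
  have "\<exists>c. fps_nth (H a0 c) v \<noteq> 0 \<and> (\<forall>j<v. fps_nth (H a0 c) j = 0)" if v: "v \<in> S" for v
  proof -
    have "v \<in> ords (word_span (f a0) T)" using v by (simp add: S_def)
    then obtain F where F: "F \<in> word_span (f a0) T" "fps_nth F v \<noteq> 0" "\<And>j. j < v \<Longrightarrow> fps_nth F j = 0"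
      by (rule ordsE) blast
    obtain c where "F = H a0 c"
      using span_image_finite[OF assms(2) F(1)[unfolded word_span_def]] unfolding H_def by blast
    thus ?thesis using F by blast
  qed
  then obtain c where c: "\<And>v. v \<in> S \<Longrightarrow> fps_nth (H a0 (c v)) v \<noteq> 0"
    "\<And>v j. v \<in> S \<Longrightarrow> j < v \<Longrightarrow> fps_nth (H a0 (c v)) j = 0"
    by metis
  define F where "F = (\<lambda>a v. H a (c v))"
  have P: "(\<lambda>a. fps_nth (prod_list (map (f a) w)) j) \<in> poly_fun" for w j
  proof (induction w arbitrary: j)
    case Nil
    show ?case by (auto intro: poly_fun.const)
  next
    case (Cons i w)
    then show ?case by (auto simp: fps_mult_nth intro!: poly_fun_sum poly_fun.mult assms(1))
  qed
  have "\<exists>p\<in>poly_fun. p a0 \<noteq> 0 \<and> (\<forall>a. p a \<noteq> 0 \<longrightarrow> indep_on S {..<n} (\<lambda>v j. fps_nth (F a v) j))"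
  proof (rule indep_on_open)
    show "finite S" by (simp add: S_def)
    show "indep_on S {..<n} (\<lambda>v j. fps_nth (F a0 v) j)"
      unfolding F_def by (rule indep_on_triangular) (use c in \<open>auto simp: S_def\<close>)
    show "(\<lambda>a. fps_nth (F a v) j) \<in> poly_fun" for v j
      by (auto simp: F_def H_def fps_sum_nth intro!: poly_fun_sum poly_fun.mult poly_fun.const P)
  qed
  moreover have "card S \<le> card (ords (word_span (f a) T) \<inter> {..<n})"
    if "indep_on S {..<n} (\<lambda>v j. fps_nth (F a v) j)" for a
  proof (rule card_le_ords[OF subspace_word_span _ _ that])
    show "finite S" by (simp add: S_def)
    show "F a v \<in> word_span (f a) T" for v
      unfolding F_def H_def word_span_def by (intro fpsv.span_sum fpsv.span_scale fpsv.span_base) auto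
  qed
  ultimately show ?thesis unfolding S_def by blast
qed

section \<open>Value semigroups\<close>

text \<open>The values of the local ring at \<open>t = 0\<close> of the curve with homogeneous coordinates \<open>f\<close>, written in terms of
  forms.  In this description it is visibly invariant under linear changes of coordinates.\<close>

definition semigroup_of :: "(nat \<Rightarrow> complex fps) \<Rightarrow> nat set"
  where "semigroup_of f = (\<Union>k. ords (forms_on f k))"

definition triple_algebra :: "(nat \<Rightarrow> complex fps) \<Rightarrow> complex fps set"
  where "triple_algebra \<phi> = fpsv.span {\<phi> 0 ^ i * \<phi> 1 ^ j * \<phi> 2 ^ k | i j k. True}"

lemma subst3_nth:
  assumes "\<And>i. i < 3 \<Longrightarrow> fps_nth (\<phi> i) 0 = 0" "n \<le> B"
  shows "fps_nth (subst3 c \<phi>) n = (\<Sum>i\<le>B. \<Sum>j\<le>B. \<Sum>k\<le>B. c i j k * fps_nth (\<phi> 0 ^ i * \<phi> 1 ^ j * \<phi> 2 ^ k) n)"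
proof -
  have X: "fps_X ^ (i + j + k) dvd \<phi> 0 ^ i * \<phi> 1 ^ j * \<phi> 2 ^ k" for i j k
  proof -
    have "fps_X dvd \<phi> i" if "i < 3" for i using X_power_dvd_iff[of 1 "\<phi> i"] assms(1)[OF that] by simp
    thus ?thesis unfolding power_add by (intro mult_dvd_mono dvd_power_same) auto
  qed
  have 0: "fps_nth (\<phi> 0 ^ i * \<phi> 1 ^ j * \<phi> 2 ^ k) n = 0" if "n < i \<or> n < j \<or> n < k" for i j k
    using X[of i j k] that unfolding X_power_dvd_iff by auto
  have "(\<Sum>i\<le>B. \<Sum>j\<le>B. \<Sum>k\<le>B. c i j k * fps_nth (\<phi> 0 ^ i * \<phi> 1 ^ j * \<phi> 2 ^ k) n) =
    (\<Sum>i\<le>n. \<Sum>j\<le>B. \<Sum>k\<le>B. c i j k * fps_nth (\<phi> 0 ^ i * \<phi> 1 ^ j * \<phi> 2 ^ k) n)"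
    using assms(2) 0 by (intro sum.mono_neutral_right) auto
  also have "\<dots> = (\<Sum>i\<le>n. \<Sum>j\<le>n. \<Sum>k\<le>B. c i j k * fps_nth (\<phi> 0 ^ i * \<phi> 1 ^ j * \<phi> 2 ^ k) n)"
    using assms(2) 0 by (intro sum.cong refl sum.mono_neutral_right) auto
  also have "\<dots> = (\<Sum>i\<le>n. \<Sum>j\<le>n. \<Sum>k\<le>n. c i j k * fps_nth (\<phi> 0 ^ i * \<phi> 1 ^ j * \<phi> 2 ^ k) n)"
    using assms(2) 0 by (intro sum.cong refl sum.mono_neutral_right) auto
  finally show ?thesis by (simp add: subst3_def)
qed

text \<open>A power series in \<open>\<phi>\<close> of order \<open>v\<close> can be truncated to a polynomial in \<open>\<phi>\<close> of the same order.\<close>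

lemma value_semigroup_eq:
  assumes "\<And>i. i < 3 \<Longrightarrow> fps_nth (\<phi> i) 0 = 0"
  shows "value_semigroup \<phi> = ords (triple_algebra \<phi>)"
proof -
  let ?S = "{subst3 c \<phi> | c. True}"
  have "triple_algebra \<phi> \<subseteq> ?S"
    unfolding triple_algebra_def
  proof (rule fpsv.span_minimal)
    show "fpsv.subspace ?S"
    proof (rule fpsv.subspaceI)
      show "0 \<in> ?S" by (auto simp: subst3_def fps_eq_iff intro!: exI[of _ "\<lambda>_ _ _. 0"])
      show "x + y \<in> ?S" if xy: "x \<in> ?S" "y \<in> ?S" for x y
      proof -
        from xy obtain a b where "x = subst3 a \<phi>" "y = subst3 b \<phi>" by blast
        hence "x + y = subst3 (\<lambda>i j k. a i j k + b i j k) \<phi>"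
          by (simp add: subst3_def fps_eq_iff sum.distrib distrib_right)
        thus ?thesis by blast
      qed
      show "fps_const c * x \<in> ?S" if x: "x \<in> ?S" for x c
      proof -
        from x obtain a where "x = subst3 a \<phi>" by blast
        hence "fps_const c * x = subst3 (\<lambda>i j k. c * a i j k) \<phi>"
          by (simp add: subst3_def fps_eq_iff sum_distrib_left mult.assoc)
        thus ?thesis by blast
      qed
    qed
    show "{\<phi> 0 ^ i * \<phi> 1 ^ j * \<phi> 2 ^ k | i j k. True} \<subseteq> ?S"
    proof clarify
      fix i j k
      have "\<phi> 0 ^ i * \<phi> 1 ^ j * \<phi> 2 ^ k = subst3 (\<lambda>i' j' k'. if k' = k then if j' = j then if i' = i then 1 else 0 else 0 else 0) \<phi>"
      proof (rule fps_ext)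
        fix n
        show "fps_nth (\<phi> 0 ^ i * \<phi> 1 ^ j * \<phi> 2 ^ k) n =
          fps_nth (subst3 (\<lambda>i' j' k'. if k' = k then if j' = j then if i' = i then 1 else 0 else 0 else 0) \<phi>) n"
          by (subst subst3_nth[where B = "n + i + j + k", OF assms])
            (simp_all add: if_distrib[of "\<lambda>z. z * _"] sum.delta cong: if_cong)
      qed
      thus "\<exists>c. \<phi> 0 ^ i * \<phi> 1 ^ j * \<phi> 2 ^ k = subst3 c \<phi> \<and> True" by blast
    qed
  qed
  moreover have "ords ?S \<subseteq> ords (triple_algebra \<phi>)"
  proof
    fix v assume "v \<in> ords ?S"
    then obtain c where c: "fps_nth (subst3 c \<phi>) v \<noteq> 0" "\<And>j. j < v \<Longrightarrow> fps_nth (subst3 c \<phi>) j = 0"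
      by (auto elim!: ordsE)
    define F where "F = (\<Sum>i\<le>v. \<Sum>j\<le>v. \<Sum>k\<le>v. fps_const (c i j k) * (\<phi> 0 ^ i * \<phi> 1 ^ j * \<phi> 2 ^ k))"
    have "fps_nth F n = fps_nth (subst3 c \<phi>) n" if "n \<le> v" for n
      using subst3_nth[OF assms that] by (simp add: F_def fps_sum_nth)
    moreover have "F \<in> triple_algebra \<phi>" unfolding F_def triple_algebra_def
      by (intro fpsv.span_sum fpsv.span_scale fpsv.span_base) auto
    ultimately show "v \<in> ords (triple_algebra \<phi>)" using c by (intro ordsI[of F]) auto
  qed
  ultimately show ?thesis unfolding value_semigroup_def ords_def[symmetric] using ords_mono by blast
qed

lemma triple_algebra_mult:
  assumes "F \<in> triple_algebra \<phi>" "G \<in> triple_algebra \<phi>"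
  shows "F * G \<in> triple_algebra \<phi>"
  unfolding triple_algebra_def
proof (rule span_mult[OF assms[unfolded triple_algebra_def]], clarify)
  fix i j k i' j' k'
  have "\<phi> 0 ^ i * \<phi> 1 ^ j * \<phi> 2 ^ k * (\<phi> 0 ^ i' * \<phi> 1 ^ j' * \<phi> 2 ^ k') =
    \<phi> 0 ^ (i + i') * \<phi> 1 ^ (j + j') * \<phi> 2 ^ (k + k')" by (simp add: power_add)
  thus "\<phi> 0 ^ i * \<phi> 1 ^ j * \<phi> 2 ^ k * (\<phi> 0 ^ i' * \<phi> 1 ^ j' * \<phi> 2 ^ k')
    \<in> fpsv.span {\<phi> 0 ^ i * \<phi> 1 ^ j * \<phi> 2 ^ k | i j k. True}"
    by (intro fpsv.span_base) blast
qed

lemma triple_algebra_monomial: "\<phi> 0 ^ i * \<phi> 1 ^ j * \<phi> 2 ^ k \<in> triple_algebra \<phi>"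
  unfolding triple_algebra_def by (intro fpsv.span_base) blast

lemma fps_unit_mult_ord:
  assumes "fps_nth (u :: complex fps) 0 \<noteq> 0" "F \<noteq> 0" shows "subdegree (u ^ k * F) = subdegree F" "u ^ k * F \<noteq> 0"
proof -
  have "u \<noteq> 0" using assms by auto
  thus "u ^ k * F \<noteq> 0" using assms by simp
  show "subdegree (u ^ k * F) = subdegree F" using assms \<open>u \<noteq> 0\<close> by simp
qed

text \<open>Homogenization: multiplying by powers of the unit \<open>f 0\<close> does not change orders.\<close>

lemma semigroup_of_eq_ords:
  assumes "fps_nth (f 0) 0 \<noteq> 0"
  shows "semigroup_of f = ords (triple_algebra (\<lambda>i. f (Suc i) / f 0))"
proof -
  define \<phi> where "\<phi> = (\<lambda>i. f (Suc i) / f 0)"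
  have f: "f (Suc i) = f 0 * \<phi> i" for i
    using assms by (simp add: \<phi>_def fps_divide_unit mult.left_commute inverse_mult_eq_1')
  have 1: "\<exists>k. f 0 ^ k * F \<in> forms_on f k" if "F \<in> triple_algebra \<phi>" for F
    using that unfolding triple_algebra_def
  proof (induction rule: fpsv.span_induct_alt)
    case base
    show ?case by (intro exI[of _ 0]) (use fpsv.subspace_0[OF subspace_word_span] in auto)
  next
    case (step c x G)
    then obtain i j k l where x: "x = \<phi> 0 ^ i * \<phi> 1 ^ j * \<phi> 2 ^ k" and l: "f 0 ^ l * G \<in> forms_on f l" by blast
    define N where "N = i + j + k"
    have "f 0 ^ N * x = f 1 ^ i * f 2 ^ j * f 3 ^ k"
      using f[of 0] f[of 1] f[of 2] by (simp add: x N_def power_mult_distrib power_add numeral_2_eq_2 numeral_3_eq_3)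
    also have "\<dots> \<in> forms_on f N" unfolding N_def
      by (intro forms_on_mult row_power_in_forms_on) auto
    finally have "f 0 ^ l * (f 0 ^ N * x) \<in> forms_on f (l + N)"
      by (intro forms_on_mult row_power_in_forms_on) auto
    moreover have "f 0 ^ N * (f 0 ^ l * G) \<in> forms_on f (N + l)"
      by (intro forms_on_mult row_power_in_forms_on l) auto
    ultimately have "fps_const c * (f 0 ^ l * (f 0 ^ N * x)) + f 0 ^ N * (f 0 ^ l * G) \<in> forms_on f (l + N)"
      by (auto simp: add.commute intro!: fpsv.subspace_add[OF subspace_word_span] fpsv.subspace_scale[OF subspace_word_span])
    thus ?case by (intro exI[of _ "l + N"]) (simp add: power_add algebra_simps)
  qed
  have 2: "\<exists>F\<in>triple_algebra \<phi>. H = f 0 ^ k * F" if "H \<in> forms_on f k" for H k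
  proof -
    have word: "\<exists>F\<in>triple_algebra \<phi>. prod_list (map f w) = f 0 ^ length w * F" if "set w \<subseteq> {..<4}" for w
      using that
    proof (induction w)
      case Nil
      then show ?case using triple_algebra_monomial[of \<phi> 0 0 0] by (intro bexI[of _ 1]) auto
    next
      case (Cons i w)
      then obtain F where F: "F \<in> triple_algebra \<phi>" "prod_list (map f w) = f 0 ^ length w * F" by auto
      have "\<exists>E\<in>triple_algebra \<phi>. f i = f 0 * E"
      proof (cases i)
        case 0
        then show ?thesis using triple_algebra_monomial[of \<phi> 0 0 0] by (intro bexI[of _ 1]) auto
      next
        case (Suc n)
        hence "n = 0 \<or> n = 1 \<or> n = 2" using Cons.prems by auto
        hence "\<phi> n \<in> triple_algebra \<phi>"
          using triple_algebra_monomial[of \<phi> 1 0 0] triple_algebra_monomial[of \<phi> 0 1 0]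
            triple_algebra_monomial[of \<phi> 0 0 1] by auto
        then show ?thesis using f[of n] Suc by blast
      qed
      then obtain E where "E \<in> triple_algebra \<phi>" "f i = f 0 * E" by blast
      thus ?case using F triple_algebra_mult[of E \<phi> F]
        by (intro bexI[of _ "E * F"]) (auto simp: mult_ac)
    qed
    show ?thesis using that unfolding word_span_def
    proof (induction rule: fpsv.span_induct_alt)
      case base
      show ?case by (intro bexI[of _ 0]) (auto simp: triple_algebra_def intro: fpsv.span_zero)
    next
      case (step c x G)
      then obtain F where F: "F \<in> triple_algebra \<phi>" "G = f 0 ^ k * F" by blast
      from step obtain w where w: "set w \<subseteq> {..<4}" "length w = k" "x = prod_list (map f w)"
        by (auto simp: words_def)
      obtain E where E: "E \<in> triple_algebra \<phi>" "x = f 0 ^ k * E" using word[OF w(1)] w by auto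
      have "fps_const c * E + F \<in> triple_algebra \<phi>" using E F unfolding triple_algebra_def
        by (intro fpsv.span_add fpsv.span_scale)
      moreover have "fps_const c * x + G = f 0 ^ k * (fps_const c * E + F)" using E F by (simp add: algebra_simps)
      ultimately show ?case by blast
    qed
  qed
  show ?thesis unfolding \<phi>_def[symmetric]
  proof (intro subset_antisym subsetI)
    fix v assume "v \<in> semigroup_of f"
    then obtain k H where H: "H \<in> forms_on f k" "H \<noteq> 0" "v = subdegree H"
      by (auto simp: semigroup_of_def ords_def)
    then obtain F where F: "F \<in> triple_algebra \<phi>" "H = f 0 ^ k * F" using 2 by blast
    hence "F \<noteq> 0" using H by auto
    hence "v = subdegree F" using F(2) H(3) fps_unit_mult_ord(1)[OF assms] by simp
    thus "v \<in> ords (triple_algebra \<phi>)" using F(1) \<open>F \<noteq> 0\<close> by (auto simp: ords_def)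
  next
    fix v assume "v \<in> ords (triple_algebra \<phi>)"
    then obtain F where F: "F \<in> triple_algebra \<phi>" "F \<noteq> 0" "v = subdegree F" by (auto simp: ords_def)
    then obtain k where k: "f 0 ^ k * F \<in> forms_on f k" using 1 by blast
    have "v \<in> ords (forms_on f k)" unfolding ords_def
      using F k fps_unit_mult_ord[OF assms F(2), of k] by (intro image_eqI[of _ _ "f 0 ^ k * F"]) simp_all
    thus "v \<in> semigroup_of f" by (auto simp: semigroup_of_def)
  qed
qed

text \<open>Subtracting constants from the affine coordinates is a linear change of the homogeneous ones.\<close>

lemma value_semigroup_quotients:
  assumes "fps_nth (f 0) 0 \<noteq> 0"
  shows "value_semigroup (\<lambda>i. f (Suc i) / f 0 - fps_const (fps_nth (f (Suc i) / f 0) 0)) = semigroup_of f"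
proof -
  define c where "c = (\<lambda>i. if i = 0 then 0 else fps_nth (f i / f 0) 0)"
  define g where "g = (\<lambda>i. f i - fps_const (c i) * f 0)"
  have g0: "g 0 = f 0" by (simp add: g_def c_def)
  have "f i = fps_const 1 * g i + fps_const (c i) * g 0" for i by (simp add: g_def c_def)
  hence "f i \<in> forms_on g 1" if "i < 4" for i using that
    by (metis fpsv.subspace_add fpsv.subspace_scale row_in_forms_on subspace_word_span zero_less_numeral)
  moreover have "g i \<in> forms_on f 1" if "i < 4" for i unfolding g_def
    by (intro fpsv.subspace_diff fpsv.subspace_scale row_in_forms_on subspace_word_span) (use that in auto)
  ultimately have eq: "semigroup_of f = semigroup_of g"
    unfolding semigroup_of_def using forms_on_subset by (metis subset_antisym)
  have "f 0 \<noteq> 0" using assms by auto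
  have quot: "g (Suc i) / g 0 = f (Suc i) / f 0 - fps_const (fps_nth (f (Suc i) / f 0) 0)" for i
    unfolding g0 using assms \<open>f 0 \<noteq> 0\<close> by (simp add: g_def c_def fps_divide_unit algebra_simps inverse_mult_eq_1 inverse_mult_eq_1')
  have "fps_nth (g (Suc i)) 0 = 0" for i
    using assms by (simp add: g_def c_def fps_divide_unit)
  hence "value_semigroup (\<lambda>i. g (Suc i) / g 0) = semigroup_of g"
    using assms by (subst value_semigroup_eq) (auto simp: semigroup_of_eq_ords g0 quot)
  thus ?thesis unfolding quot eq .
qed

lemma semigroup_of_add:
  assumes "u \<in> semigroup_of f" "v \<in> semigroup_of f" shows "u + v \<in> semigroup_of f"
proof -
  obtain k F where F: "F \<in> forms_on f k" "F \<noteq> 0" "u = subdegree F"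
    using assms by (auto simp: semigroup_of_def ords_def)
  obtain l G where G: "G \<in> forms_on f l" "G \<noteq> 0" "v = subdegree G"
    using assms by (auto simp: semigroup_of_def ords_def)
  have "u + v \<in> ords (forms_on f (k + l))" unfolding ords_def
    by (rule image_eqI[of _ _ "F * G"]) (use F G forms_on_mult in auto)
  thus ?thesis by (auto simp: semigroup_of_def)
qed

lemma ords_forms_on_mono:
  assumes "fps_nth (f 0) 0 \<noteq> 0" "k \<le> l"
  shows "ords (forms_on f k) \<subseteq> ords (forms_on f l)"
proof
  fix v assume "v \<in> ords (forms_on f k)"
  then obtain F where F: "F \<in> forms_on f k" "F \<noteq> 0" "v = subdegree F" by (auto simp: ords_def)
  have "f 0 ^ (l - k) * F \<in> forms_on f (l - k + k)" by (intro forms_on_mult row_power_in_forms_on F) auto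
  thus "v \<in> ords (forms_on f l)" unfolding ords_def using F assms
      fps_unit_mult_ord[OF assms(1) F(2), of "l - k"]
    by (intro image_eqI[of _ _ "f 0 ^ (l - k) * F"]) (simp_all del: subdegree_mult)
qed

lemma finite_part_of_semigroup_of:
  assumes "fps_nth (f 0) 0 \<noteq> 0" "finite T" "T \<subseteq> semigroup_of f"
  shows "\<exists>k. T \<subseteq> ords (forms_on f k)"
  using assms(2,3)
proof (induction T rule: finite_induct)
  case (insert v T)
  then obtain k l where "T \<subseteq> ords (forms_on f k)" "v \<in> ords (forms_on f l)"
    by (auto simp: semigroup_of_def)
  hence "insert v T \<subseteq> ords (forms_on f (max k l))"
    using ords_forms_on_mono[where f = f, OF assms(1), of k "max k l"] ords_forms_on_mono[where f = f, OF assms(1), of l "max k l"] by auto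
  thus ?case by blast
qed auto

text \<open>Monomials of degree at least five in three series of order at least \<open>k\<close> have order at least
  \<open>5 k\<close>, and there are 35 monomials of smaller degree.\<close>

lemma semigroup_of_sparse:
  assumes "fps_nth (f 0) 0 \<noteq> 0" "\<And>i. i < 3 \<Longrightarrow> fps_X ^ k dvd f (Suc i)"
  shows "card (semigroup_of f \<inter> {..<5 * k}) \<le> 35"
proof -
  define \<phi> where "\<phi> = (\<lambda>i. f (Suc i) / f 0)"
  have \<phi>: "fps_X ^ k dvd \<phi> i" if "i < 3" for i
    using assms that by (simp add: \<phi>_def fps_divide_unit)
  define mon where "mon = (\<lambda>(i, j, l). \<phi> 0 ^ i * \<phi> 1 ^ j * \<phi> 2 ^ l)"
  define E where "E = set [(i, j, l). i \<leftarrow> [0..<5], j \<leftarrow> [0..<5], l \<leftarrow> [0..<5], i + j + l < 5]"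
  have E: "(i, j, l) \<in> E \<longleftrightarrow> i + j + l < 5" for i j l by (auto simp: E_def)
  have "card E \<le> length [(i, j, l). i \<leftarrow> [0..<5], j \<leftarrow> [0..<5], l \<leftarrow> [0..<5], i + j + l < (5::nat)]"
    unfolding E_def by (rule card_length)
  also have "\<dots> = 35" by code_simp
  finally have cE: "card E \<le> 35" .
  have fE: "finite E" by (simp add: E_def)
  have coef: "\<exists>c. \<forall>n<5*k. fps_nth F n = (\<Sum>e\<in>E. c e * fps_nth (mon e) n)" if "F \<in> triple_algebra \<phi>" for F
    using that unfolding triple_algebra_def
  proof (induction rule: fpsv.span_induct_alt)
    case base
    show ?case by (intro exI[of _ "\<lambda>_. 0"]) simp
  next
    case (step a x G)
    then obtain c where c: "\<And>n. n < 5 * k \<Longrightarrow> fps_nth G n = (\<Sum>e\<in>E. c e * fps_nth (mon e) n)" by blast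
    obtain i j l where x: "x = mon (i, j, l)" using step by (auto simp: mon_def)
    show ?case
    proof (cases "(i, j, l) \<in> E")
      case True
      have "(\<Sum>e\<in>E. ((if e = (i, j, l) then a else 0) + c e) * fps_nth (mon e) n) =
        a * fps_nth x n + (\<Sum>e\<in>E. c e * fps_nth (mon e) n)" for n
        using True fE by (simp add: distrib_right sum.distrib if_distrib[of "\<lambda>z. z * _"] sum.delta x cong: if_cong)
      thus ?thesis using c by (intro exI[of _ "\<lambda>e. (if e = (i, j, l) then a else 0) + c e"]) simp
    next
      case False
      have "fps_X ^ (k * i + k * j + k * l) dvd x" unfolding x mon_def prod.case power_add power_mult
        using \<phi> by (intro mult_dvd_mono dvd_power_same) auto
      moreover have "5 * k \<le> k * i + k * j + k * l" using False E[of i j l]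
        by (metis add_mult_distrib2 mult.commute mult_le_mono1 not_less)
      ultimately have "fps_nth x n = 0" if "n < 5 * k" for n using that
        unfolding X_power_dvd_iff by auto
      thus ?thesis using c by (intro exI[of _ c]) simp
    qed
  qed
  define S where "S = semigroup_of f \<inter> {..<5 * k}"
  have eq: "semigroup_of f = ords (triple_algebra \<phi>)"
    using semigroup_of_eq_ords[of f, OF assms(1)] by (simp add: \<phi>_def)
  have "\<forall>v\<in>S. \<exists>F. F \<in> triple_algebra \<phi> \<and> fps_nth F v \<noteq> 0 \<and> (\<forall>j<v. fps_nth F j = 0)"
    unfolding S_def eq by (auto elim!: ordsE)
  from bchoice[OF this] obtain F where F0: "\<forall>v\<in>S. F v \<in> triple_algebra \<phi> \<and> fps_nth (F v) v \<noteq> 0 \<and> (\<forall>j<v. fps_nth (F v) j = 0)" ..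
  hence F: "\<And>v. v \<in> S \<Longrightarrow> F v \<in> triple_algebra \<phi>" "\<And>v. v \<in> S \<Longrightarrow> fps_nth (F v) v \<noteq> 0"
    "\<And>v j. v \<in> S \<Longrightarrow> j < v \<Longrightarrow> fps_nth (F v) j = 0" by simp_all
  have "\<forall>v\<in>S. \<exists>c. \<forall>n<5*k. fps_nth (F v) n = (\<Sum>e\<in>E. c e * fps_nth (mon e) n)"
    using coef F(1) by blast
  from bchoice[OF this] obtain c where
    "\<forall>v\<in>S. \<forall>n<5*k. fps_nth (F v) n = (\<Sum>e\<in>E. c v e * fps_nth (mon e) n)" ..
  hence c: "\<And>v n. v \<in> S \<Longrightarrow> n < 5 * k \<Longrightarrow> fps_nth (F v) n = (\<Sum>e\<in>E. c v e * fps_nth (mon e) n)" by simp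
  have "indep_on S {..<5 * k} (\<lambda>v n. fps_nth (F v) n)"
    by (rule indep_on_triangular) (use F in \<open>auto simp: S_def\<close>)
  have "indep_on S E c"
  proof (rule indep_onI)
    fix x v assume *: "\<And>e. e \<in> E \<Longrightarrow> (\<Sum>v\<in>S. x v * c v e) = 0" "v \<in> S"
    have "(\<Sum>v\<in>S. x v * fps_nth (F v) n) = 0" if "n \<in> {..<5 * k}" for n
    proof -
      have "(\<Sum>v\<in>S. x v * fps_nth (F v) n) = (\<Sum>v\<in>S. \<Sum>e\<in>E. x v * c v e * fps_nth (mon e) n)"
        using c that by (intro sum.cong) (auto simp: sum_distrib_left mult_ac)
      also have "\<dots> = (\<Sum>e\<in>E. (\<Sum>v\<in>S. x v * c v e) * fps_nth (mon e) n)"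
        by (subst sum.swap) (simp add: sum_distrib_right)
      finally show ?thesis using * by simp
    qed
    from indep_onD[OF \<open>indep_on S {..<5 * k} (\<lambda>v n. fps_nth (F v) n)\<close> this *(2)] show "x v = 0" .
  qed
  hence "card S \<le> card E" using fE by (intro indep_on_card_le) (auto simp: S_def)
  thus ?thesis using cE by (simp add: S_def)
qed

section \<open>Polynomials among power series\<close>

text \<open>A polynomial of degree at most \<open>D\<close> represents a binary form of degree \<open>D\<close>; a drop of the degree is a zero at
  infinity.\<close>

definition deg_le :: "nat \<Rightarrow> complex fps \<Rightarrow> bool"
  where "deg_le D F \<longleftrightarrow> (\<forall>j>D. fps_nth F j = 0)"

lemma deg_leD: "deg_le D F \<Longrightarrow> D < j \<Longrightarrow> fps_nth F j = 0" by (simp add: deg_le_def)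

text \<open>The second part is the multiplicativity of the leading coefficient, or of the value at infinity of a binary
  form.\<close>

lemma deg_le_mult:
  assumes "deg_le D F" "deg_le E G"
  shows "deg_le (D + E) (F * G)" "fps_nth (F * G) (D + E) = fps_nth F D * fps_nth G E"
proof -
  have *: "fps_nth F i * fps_nth G (j - i) = 0" if "D + E < j \<or> (j = D + E \<and> i \<noteq> D)" for i j
  proof (cases "D < i")
    case False
    hence "E < j - i" using that by auto
    then show ?thesis using assms(2) by (simp add: deg_leD)
  qed (use assms(1) in \<open>simp add: deg_leD\<close>)
  show "deg_le (D + E) (F * G)"
    unfolding deg_le_def fps_mult_nth by (intro allI impI sum.neutral ballI *) simp
  have "fps_nth (F * G) (D + E) = (\<Sum>i=0..D + E. if i = D then fps_nth F D * fps_nth G E else 0)"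
    unfolding fps_mult_nth using *[of "D + E"] by (intro sum.cong) auto
  thus "fps_nth (F * G) (D + E) = fps_nth F D * fps_nth G E" by simp
qed

lemma deg_le_power:
  assumes "deg_le D F"
  shows "deg_le (n * D) (F ^ n)" "fps_nth (F ^ n) (n * D) = fps_nth F D ^ n"
proof -
  have "deg_le (n * D) (F ^ n) \<and> fps_nth (F ^ n) (n * D) = fps_nth F D ^ n"
  proof (induction n)
    case (Suc n)
    then show ?case using deg_le_mult[OF assms, of "n * D" "F ^ n"] by simp
  qed (simp add: deg_le_def)
  thus "deg_le (n * D) (F ^ n)" "fps_nth (F ^ n) (n * D) = fps_nth F D ^ n" by auto
qed

lemma deg_le_X_power: "deg_le D (fps_X ^ v) \<longleftrightarrow> v \<le> D"
  by (auto simp: deg_le_def not_less[symmetric])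

lemma subspace_deg_le: "fpsv.subspace {F. deg_le D F}"
  by (rule fpsv.subspaceI) (auto simp: deg_le_def)

lemma deg_le_word_span:
  assumes "\<And>i. i < 4 \<Longrightarrow> deg_le d (f i)" "T \<subseteq> words n" "F \<in> word_span f T"
  shows "deg_le (n * d) F"
proof -
  have "deg_le (length w * d) (prod_list (map f w))" if "set w \<subseteq> {..<4}" for w
    using that
  proof (induction w)
    case (Cons i w)
    then show ?case using deg_le_mult(1)[OF assms(1)[of i] Cons.IH] by simp
  qed (simp add: deg_le_def)
  hence "word_span f T \<subseteq> {F. deg_le (n * d) F}" unfolding word_span_def
    using assms(2) by (intro fpsv.span_minimal subspace_deg_le) (auto simp: words_def)
  thus ?thesis using assms(3) by auto
qed

lemma monomial_extract:
  assumes "fpsv.subspace U" "F \<in> U" "finite T" "\<And>j. fps_nth F j \<noteq> 0 \<Longrightarrow> j \<in> T \<or> j = v"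
    "fps_nth F v \<noteq> 0" "\<And>j. j \<in> T \<Longrightarrow> fps_X ^ j \<in> U"
  shows "fps_X ^ v \<in> U"
proof -
  define G where "G = (\<Sum>j\<in>T - {v}. fps_const (fps_nth F j) * fps_X ^ j)"
  have G: "G \<in> U" unfolding G_def
    by (intro fpsv.subspace_sum[OF assms(1)] fpsv.subspace_scale[OF assms(1)]) (use assms(6) in auto)
  have "F - G = fps_const (fps_nth F v) * fps_X ^ v"
  proof (rule fps_ext)
    fix j
    have "fps_nth G j = (\<Sum>i\<in>T - {v}. if i = j then fps_nth F j else 0)"
      unfolding G_def by (simp add: fps_sum_nth fps_X_power_nth if_distrib[of "\<lambda>z. _ * z"] cong: if_cong)
        (intro sum.cong, auto)
    also have "\<dots> = (if j \<in> T - {v} then fps_nth F j else 0)" using assms(3) by (simp add: sum.delta)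
    finally show "fps_nth (F - G) j = fps_nth (fps_const (fps_nth F v) * fps_X ^ v) j"
      using assms(4)[of j] by (auto simp: fps_X_power_nth)
  qed
  hence "fps_X ^ v = fps_const (inverse (fps_nth F v)) * (F - G)"
    using assms(5) by (simp add: mult.assoc[symmetric])
  thus ?thesis using fpsv.subspace_scale[OF assms(1) fpsv.subspace_diff[OF assms(1,2) G]] by metis
qed

text \<open>Starting from order \<open>D\<close>, elements of smaller order are reduced by the monomials already found.\<close>

lemma monomials_of_ords:
  assumes "fpsv.subspace U" "\<And>F. F \<in> U \<Longrightarrow> deg_le D F" "{c..D} \<subseteq> ords U" "v \<in> {c..D}"
  shows "fps_X ^ v \<in> U"
  using assms(4)
proof (induction "D - v" arbitrary: v rule: less_induct)
  case less
  have "v \<in> ords U" using less.prems assms(3) by blast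
  then obtain F where F: "F \<in> U" "fps_nth F v \<noteq> 0" "\<And>j. j < v \<Longrightarrow> fps_nth F j = 0"
    by (rule ordsE) blast
  show ?case
  proof (rule monomial_extract[OF assms(1) F(1), of "{v<..D}"])
    fix j assume "fps_nth F j \<noteq> 0"
    thus "j \<in> {v<..D} \<or> j = v" using F(3)[of j] assms(2)[OF F(1)] deg_leD[of D F j]
      by (metis greaterThanAtMost_iff linorder_neqE_nat not_less)
  next
    fix j assume "j \<in> {v<..D}"
    thus "fps_X ^ j \<in> U" using less by (intro less.hyps) auto
  qed (use F in auto)
qed

section \<open>The cuspidal part of the forms\<close>

definition cusp_words :: "nat \<Rightarrow> nat list set"
  where "cusp_words e = {u. set u \<subseteq> {1, 2, 3} \<and> length u = e}"

text \<open>The restrictions of forms of degree \<open>e + n\<close> in the \<open>e\<close>-th power of the ideal of the point \<open>t = 0\<close>, when the rows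
  1, 2, 3 vanish there.\<close>

definition cusp_forms :: "(nat \<Rightarrow> complex fps) \<Rightarrow> nat \<Rightarrow> nat \<Rightarrow> complex fps set"
  where "cusp_forms f e n = word_span f {u @ w | u w. u \<in> cusp_words e \<and> w \<in> words n}"

lemma cusp_words_subset: "{u @ w | u w. u \<in> cusp_words e \<and> w \<in> words n} \<subseteq> words (e + n)"
  by (fastforce simp: cusp_words_def words_def)

lemma subspace_cusp_forms: "fpsv.subspace (cusp_forms f e n)"
  unfolding cusp_forms_def by (rule subspace_word_span)

lemma cusp_forms_subset: "cusp_forms f e n \<subseteq> forms_on f (e + n)"
  unfolding cusp_forms_def by (intro word_span_mono cusp_words_subset)

lemma cusp_forms_mult:
  "A \<in> word_span f (cusp_words e) \<Longrightarrow> B \<in> forms_on f n \<Longrightarrow> A * B \<in> cusp_forms f e n"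
  unfolding cusp_forms_def by (erule word_span_mult) auto

lemma cusp_words_mult:
  "A \<in> word_span f (cusp_words e) \<Longrightarrow> B \<in> word_span f (cusp_words e') \<Longrightarrow> A * B \<in> word_span f (cusp_words (e + e'))"
  by (erule word_span_mult) (auto simp: cusp_words_def)

lemma row_in_cusp_words: "i \<in> {1, 2, 3} \<Longrightarrow> f i \<in> word_span f (cusp_words 1)"
  using word_in_span[of "[i]" "cusp_words 1" f] by (simp add: cusp_words_def)

lemma row_power_in_cusp_words: "i \<in> {1, 2, 3} \<Longrightarrow> f i ^ n \<in> word_span f (cusp_words n)"
proof (induction n)
  case 0
  show ?case using word_in_span[of "[]" "cusp_words 0" f] by (simp add: cusp_words_def)
next
  case (Suc n)
  then show ?case using cusp_words_mult[OF row_in_cusp_words[of i f] Suc.IH] by simp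
qed

locale cusp_rows =
  fixes m :: nat and f :: "nat \<Rightarrow> complex fps"
  assumes m: "m \<ge> 2"
    and row0: "fps_nth (f 0) 0 \<noteq> 0"
    and row1: "f 1 \<noteq> 0" "subdegree (f 1) = 2 * m"
    and row2: "f 2 \<noteq> 0" "subdegree (f 2) = 2 * m + 2"
    and row3: "f 3 \<noteq> 0" "subdegree (f 3) = 2 * m + 4"
begin

lemma dvd_rows: "fps_X ^ (2 * m) dvd f 1" "fps_X ^ (2 * m + 2) dvd f 2" "fps_X ^ (2 * m + 4) dvd f 3"
  unfolding X_power_dvd_iff using row1 row2 row3 by (auto intro: nth_less_subdegree_zero)

text \<open>Modulo order \<open>2 m e + 4\<close>, a product of \<open>e\<close> of the series \<open>f\<^sub>1, f\<^sub>2, f\<^sub>3\<close> is \<open>f\<^sub>1\<^sup>e\<close>, or \<open>f\<^sub>1\<^sup>e\<^sup>-\<^sup>1 f\<^sub>2\<close>, or zero.  An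
  additional factor \<open>f 1\<close> avoids the exponent \<open>e - 1\<close>.\<close>

lemma cusp_word_expansion:
  assumes "set u \<subseteq> {1, 2, 3}"
  shows "\<exists>\<alpha> \<beta>. fps_X ^ (2 * m * (length u + 1) + 4) dvd
    f 1 * prod_list (map f u) - f 1 ^ length u * (fps_const \<alpha> * f 1 + fps_const \<beta> * f 2)"
  using assms
proof (induction u)
  case Nil
  show ?case by (intro exI[of _ 1] exI[of _ 0]) simp
next
  case (Cons i u)
  define e where "e = length u"
  define A where "A = prod_list (map f u)"
  obtain \<alpha> \<beta> where *: "fps_X ^ (2 * m * (e + 1) + 4) dvd
    f 1 * A - f 1 ^ e * (fps_const \<alpha> * f 1 + fps_const \<beta> * f 2)" using Cons by (auto simp: e_def A_def)
  define Y where "Y = f 1 * A - f 1 ^ e * (fps_const \<alpha> * f 1 + fps_const \<beta> * f 2)"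
  have Y: "fps_X ^ (2 * m * (e + 1) + 4) dvd Y" using * by (simp add: Y_def)
  have A: "f 1 * A = f 1 ^ e * (fps_const \<alpha> * f 1 + fps_const \<beta> * f 2) + Y" by (simp add: Y_def)
  have exp: "2 * m * (length (i # u) + 1) + 4 = 2 * m * (e + 1) + 4 + 2 * m" by (simp add: e_def)
  have pow: "fps_X ^ (2 * m * e) dvd f 1 ^ e" using dvd_power_same[OF dvd_rows(1), of e] by (simp add: power_mult)
  consider "i = 1" | "i = 2" | "i = 3" using Cons.prems by auto
  then show ?case
  proof cases
    case 1
    have "f 1 * prod_list (map f (i # u)) - f 1 ^ length (i # u) * (fps_const \<alpha> * f 1 + fps_const \<beta> * f 2) = Y * f 1"
      by (simp add: 1 Y_def A_def e_def algebra_simps)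
    thus ?thesis unfolding exp power_add[of _ _ "2 * m"] using mult_dvd_mono[OF Y dvd_rows(1)] by metis
  next
    case 2
    have "f 1 * prod_list (map f (i # u)) - f 1 ^ length (i # u) * (fps_const 0 * f 1 + fps_const \<alpha> * f 2) =
      f 2 * (f 1 * A) - f 1 ^ length (i # u) * (fps_const \<alpha> * f 2)"
      by (simp add: 2 A_def)
    also have "\<dots> = f 2 * Y + fps_const \<beta> * (f 1 ^ e * (f 2 * f 2))"
      unfolding A by (simp add: e_def algebra_simps)
    finally have eq: "f 1 * prod_list (map f (i # u)) - f 1 ^ length (i # u) * (fps_const 0 * f 1 + fps_const \<alpha> * f 2) =
      f 2 * Y + fps_const \<beta> * (f 1 ^ e * (f 2 * f 2))" .
    have 1: "fps_X ^ (2 * m + 2 + (2 * m * (e + 1) + 4)) dvd f 2 * Y"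
      unfolding power_add[of _ "2 * m + 2"] by (rule mult_dvd_mono[OF dvd_rows(2) Y])
    have 2: "fps_X ^ (2 * m * e + ((2 * m + 2) + (2 * m + 2))) dvd f 1 ^ e * (f 2 * f 2)"
      unfolding power_add[of _ "2 * m * e"] power_add[of _ "2 * m + 2" "2 * m + 2"]
      by (intro mult_dvd_mono pow dvd_rows)
    have "fps_X ^ (2 * m * (e + 1) + 4 + 2 * m) dvd f 2 * Y + fps_const \<beta> * (f 1 ^ e * (f 2 * f 2))"
      by (rule dvd_add[OF power_le_dvd[OF 1] dvd_mult[OF power_le_dvd[OF 2]]]) simp_all
    thus ?thesis unfolding exp eq[symmetric] by blast
  next
    case 3
    have eq: "f 1 * prod_list (map f (i # u)) - f 1 ^ length (i # u) * (fps_const 0 * f 1 + fps_const 0 * f 2) =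
      f 3 * (f 1 * A)" by (simp add: 3 A_def)
    have "fps_X ^ (2 * m) dvd f 2" using dvd_rows(2) by (rule power_le_dvd) simp
    hence "fps_X ^ (2 * m * e + 2 * m) dvd f 1 ^ e * (fps_const \<alpha> * f 1 + fps_const \<beta> * f 2)"
      unfolding power_add by (intro mult_dvd_mono pow dvd_add dvd_mult dvd_rows)
    moreover have "fps_X ^ (2 * m * e + 2 * m) dvd Y" using Y by (rule power_le_dvd) simp
    ultimately have "fps_X ^ (2 * m * e + 2 * m) dvd f 1 * A" unfolding A by (rule dvd_add)
    hence "fps_X ^ (2 * m + 4 + (2 * m * e + 2 * m)) dvd f 3 * (f 1 * A)"
      unfolding power_add[of _ "2 * m + 4"] by (rule mult_dvd_mono[OF dvd_rows(3)])
    moreover have "2 * m + 4 + (2 * m * e + 2 * m) = 2 * m * (e + 1) + 4 + 2 * m" by simp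
    ultimately show ?thesis unfolding exp eq[symmetric] by metis
  qed
qed

lemma word_expansion:
  assumes "set w \<subseteq> {..<4}"
  shows "\<exists>\<gamma>. fps_X ^ (2 * m) dvd prod_list (map f w) - fps_const \<gamma> * f 0 ^ length w"
  using assms
proof (induction w)
  case Nil
  show ?case by (intro exI[of _ 1]) simp
next
  case (Cons i w)
  then obtain \<gamma> where *: "fps_X ^ (2 * m) dvd prod_list (map f w) - fps_const \<gamma> * f 0 ^ length w" by auto
  have "i = 0 \<or> i = 1 \<or> i = 2 \<or> i = 3" using Cons.prems by auto
  then consider "i = 0" | "fps_X ^ (2 * m) dvd f i"
    using dvd_rows by (metis le_add1 power_le_dvd)
  then show ?case
  proof cases
    case 1
    have "prod_list (map f (i # w)) - fps_const \<gamma> * f 0 ^ length (i # w) =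
      f 0 * (prod_list (map f w) - fps_const \<gamma> * f 0 ^ length w)" by (simp add: 1 algebra_simps)
    thus ?thesis using dvd_mult[OF *, of "f 0"] by metis
  next
    case 2
    show ?thesis by (intro exI[of _ 0]) (simp add: 2 dvd_mult2)
  qed
qed

lemma cusp_form_expansion:
  assumes "F \<in> cusp_forms f e n"
  shows "\<exists>\<alpha> \<beta>. fps_X ^ (2 * m * (e + 1) + 4) dvd
    f 1 * F - f 0 ^ n * (f 1 ^ e * (fps_const \<alpha> * f 1 + fps_const \<beta> * f 2))"
  using assms unfolding cusp_forms_def word_span_def
proof (induction rule: fpsv.span_induct_alt)
  case base
  show ?case by (intro exI[of _ 0]) simp
next
  case (step c x G)
  let ?N = "2 * m * (e + 1) + 4"
  obtain \<alpha> \<beta> where G: "fps_X ^ ?N dvd f 1 * G - f 0 ^ n * (f 1 ^ e * (fps_const \<alpha> * f 1 + fps_const \<beta> * f 2))"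
    using step by blast
  obtain u w where uw: "set u \<subseteq> {1, 2, 3}" "length u = e" "set w \<subseteq> {..<4}" "length w = n"
    "x = prod_list (map f u) * prod_list (map f w)"
    using step(1) by (auto simp: cusp_words_def words_def)
  obtain \<alpha>' \<beta>' where A: "fps_X ^ ?N dvd f 1 * prod_list (map f u) - f 1 ^ e * (fps_const \<alpha>' * f 1 + fps_const \<beta>' * f 2)"
    using cusp_word_expansion[OF uw(1)] uw(2) by blast
  obtain \<gamma> where B: "fps_X ^ (2 * m) dvd prod_list (map f w) - fps_const \<gamma> * f 0 ^ n"
    using word_expansion[OF uw(3)] uw(4) by blast
  define E where "E = f 1 ^ e * (fps_const \<alpha>' * f 1 + fps_const \<beta>' * f 2)"
  define A' where "A' = f 1 * prod_list (map f u) - E"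
  define B' where "B' = prod_list (map f w) - fps_const \<gamma> * f 0 ^ n"
  have "fps_X ^ (2 * m) dvd f 2" using dvd_rows(2) by (rule power_le_dvd) simp
  moreover have "fps_X ^ (2 * m * e) dvd f 1 ^ e"
    using dvd_power_same[OF dvd_rows(1), of e] by (simp add: power_mult)
  ultimately have E: "fps_X ^ (2 * m * e + 2 * m) dvd E" unfolding E_def power_add
    by (intro mult_dvd_mono dvd_add dvd_mult dvd_rows(1))
  have "fps_X ^ ((2 * m * e + 2 * m) + 2 * m) dvd E * B'" unfolding power_add[of _ "2 * m * e + 2 * m"]
    using B E by (intro mult_dvd_mono) (auto simp: B'_def)
  hence EB: "fps_X ^ ?N dvd E * B'" by (rule power_le_dvd) (use m in simp)
  have AW: "fps_X ^ ?N dvd A' * prod_list (map f w)" using A by (simp add: A'_def E_def)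
  have eq1: "f 1 * x - fps_const \<gamma> * f 0 ^ n * E = A' * prod_list (map f w) + E * B'"
    by (simp add: uw(5) A'_def B'_def algebra_simps)
  have "f 1 * (fps_const c * x + G) - f 0 ^ n * (f 1 ^ e * (fps_const (c * \<gamma> * \<alpha>' + \<alpha>) * f 1 + fps_const (c * \<gamma> * \<beta>' + \<beta>) * f 2)) =
    fps_const c * (f 1 * x - fps_const \<gamma> * f 0 ^ n * E) + (f 1 * G - f 0 ^ n * (f 1 ^ e * (fps_const \<alpha> * f 1 + fps_const \<beta> * f 2)))"
    unfolding E_def fps_const_add[symmetric] fps_const_mult[symmetric] by (simp only: algebra_simps)
  moreover have "fps_X ^ ?N dvd fps_const c * (f 1 * x - fps_const \<gamma> * f 0 ^ n * E) +
      (f 1 * G - f 0 ^ n * (f 1 ^ e * (fps_const \<alpha> * f 1 + fps_const \<beta> * f 2)))"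
    unfolding eq1 by (intro dvd_add dvd_mult AW EB G)
  ultimately show ?case by metis
qed

text \<open>Dividing by \<open>f\<^sub>1\<^sup>e\<close> means blowing up the cusp.  The ring of the blow-up is generated by series of orders 2, 4 and
  larger ones, whence the values 1 and 3 do not occur.\<close>

lemma ords_cusp_forms:
  "ords (cusp_forms f e n) \<subseteq> {2 * m * e, 2 * m * e + 2} \<union> {2 * m * e + 4..}"
proof
  fix v assume "v \<in> ords (cusp_forms f e n)"
  then obtain F where F: "F \<in> cusp_forms f e n" "F \<noteq> 0" "v = subdegree F" by (auto simp: ords_def)
  let ?N = "2 * m * (e + 1) + 4"
  obtain \<alpha> \<beta> where *: "fps_X ^ ?N dvd f 1 * F - f 0 ^ n * (f 1 ^ e * (fps_const \<alpha> * f 1 + fps_const \<beta> * f 2))"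
    using cusp_form_expansion[OF F(1)] by blast
  define H where "H = f 0 ^ n * (f 1 ^ e * (fps_const \<alpha> * f 1 + fps_const \<beta> * f 2))"
  have eq: "fps_nth (f 1 * F) j = fps_nth H j" if "j < ?N" for j
    using * that unfolding X_power_dvd_iff H_def by auto
  have f0: "f 0 \<noteq> 0" "subdegree (f 0) = 0" using row0 by auto
  have sub1: "subdegree (f 1 * F) = 2 * m + v" "f 1 * F \<noteq> 0" using F row1 by auto
  have L0: "subdegree (fps_const \<alpha> * f 1 + fps_const \<beta> * f 2) = 2 * m" "fps_const \<alpha> * f 1 + fps_const \<beta> * f 2 \<noteq> 0" if "\<alpha> \<noteq> 0"
  proof -
    have o: "fps_nth (f 1) (2 * m) \<noteq> 0"
      using nth_subdegree_nonzero[OF row1(1)] unfolding row1(2) .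
    have z: "fps_nth (f 2) (2 * m) = 0" by (rule nth_less_subdegree_zero) (simp add: row2(2))
    have n: "fps_nth (fps_const \<alpha> * f 1 + fps_const \<beta> * f 2) (2 * m) \<noteq> 0"
      unfolding fps_add_nth fps_mult_left_const_nth z using o that by simp
    show "fps_const \<alpha> * f 1 + fps_const \<beta> * f 2 \<noteq> 0"
    proof
      assume z: "fps_const \<alpha> * f 1 + fps_const \<beta> * f 2 = 0"
      show False using n unfolding z by simp
    qed
    show "subdegree (fps_const \<alpha> * f 1 + fps_const \<beta> * f 2) = 2 * m"
    proof (rule subdegreeI[OF n])
      fix j assume "j < 2 * m"
      hence "j < subdegree (f 1)" "j < subdegree (f 2)" unfolding row1(2) row2(2) by simp_all
      hence "fps_nth (f 1) j = 0" "fps_nth (f 2) j = 0" by (blast intro: nth_less_subdegree_zero)+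
      thus "fps_nth (fps_const \<alpha> * f 1 + fps_const \<beta> * f 2) j = 0" by simp
    qed
  qed
  consider "\<alpha> \<noteq> 0" | "\<alpha> = 0" "\<beta> \<noteq> 0" | "\<alpha> = 0" "\<beta> = 0" by blast
  thus "v \<in> {2 * m * e, 2 * m * e + 2} \<union> {2 * m * e + 4..}"
  proof cases
    case 1
    have H: "subdegree H = 2 * m * (e + 1)" "H \<noteq> 0"
      unfolding H_def using L0[OF 1] f0 row1 by auto
    have "subdegree (f 1 * F) = 2 * m * (e + 1)"
    proof (rule subdegreeI)
      show "fps_nth (f 1 * F) (2 * m * (e + 1)) \<noteq> 0"
        using eq[of "2 * m * (e + 1)"] nth_subdegree_nonzero[OF H(2)] unfolding H(1) by simp
      fix j assume j: "j < 2 * m * (e + 1)"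
      hence "fps_nth H j = 0" using H(1) by (intro nth_less_subdegree_zero) simp
      thus "fps_nth (f 1 * F) j = 0" using eq[of j] j by simp
    qed
    thus ?thesis using sub1 by simp
  next
    case 2
    have H: "subdegree H = 2 * m * (e + 1) + 2" "H \<noteq> 0"
      unfolding H_def using 2 f0 row1 row2 by auto
    have "subdegree (f 1 * F) = 2 * m * (e + 1) + 2"
    proof (rule subdegreeI)
      show "fps_nth (f 1 * F) (2 * m * (e + 1) + 2) \<noteq> 0"
        using eq[of "2 * m * (e + 1) + 2"] nth_subdegree_nonzero[OF H(2)] unfolding H(1) by simp
      fix j assume j: "j < 2 * m * (e + 1) + 2"
      hence "fps_nth H j = 0" using H(1) by (intro nth_less_subdegree_zero) simp
      thus "fps_nth (f 1 * F) j = 0" using eq[of j] j by simp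
    qed
    thus ?thesis using sub1 by simp
  next
    case 3
    have "?N \<le> subdegree (f 1 * F)"
      using eq sub1(2) 3 by (intro subdegree_geI) (auto simp: H_def)
    thus ?thesis using sub1 by simp
  qed
qed

text \<open>The orders which are possible at all must then really occur, and all monomials from order \<open>2 m e + 4\<close> on
  are obtained.\<close>

lemma monomials_in_cusp_forms:
  assumes "\<And>i. i < 4 \<Longrightarrow> deg_le d (f i)"
    "card ({2 * m * e, 2 * m * e + 2} \<union> {2 * m * e + 4..(e + n) * d}) \<le> card (ords (cusp_forms f e n) \<inter> {..<(e + n) * d + 1})"
    "2 * m * e + 4 \<le> v" "v \<le> (e + n) * d"
  shows "fps_X ^ v \<in> forms_on f (e + n)"
proof -
  let ?D = "(e + n) * d"
  have deg: "deg_le ?D F" if "F \<in> cusp_forms f e n" for F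
    using deg_le_word_span[OF assms(1) cusp_words_subset that[unfolded cusp_forms_def]] .
  have "v \<le> ?D" if v: "v \<in> ords (cusp_forms f e n)" for v
  proof -
    obtain F where "F \<in> cusp_forms f e n" "fps_nth F v \<noteq> 0" using v by (rule ordsE)
    thus ?thesis using deg_leD[OF deg] by (meson not_less)
  qed
  hence "ords (cusp_forms f e n) \<inter> {..<?D + 1} \<subseteq> {2 * m * e, 2 * m * e + 2} \<union> {2 * m * e + 4..?D}"
    using ords_cusp_forms[of e n] by auto
  hence "ords (cusp_forms f e n) \<inter> {..<?D + 1} = {2 * m * e, 2 * m * e + 2} \<union> {2 * m * e + 4..?D}"
    using assms(2) by (intro card_seteq) auto
  hence "{2 * m * e + 4..?D} \<subseteq> ords (cusp_forms f e n)" by blast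
  from monomials_of_ords[OF subspace_cusp_forms deg this, of v]
  show ?thesis using assms(3,4) cusp_forms_subset[of f e n] by auto
qed

end

section \<open>A curve with many monomials\<close>

definition odd_exponent :: "nat \<Rightarrow> nat"
  where "odd_exponent d = (if odd d then d else d - 1)"

text \<open>A curve which is smooth away from \<open>t = 0\<close>.  The rows 2 and 3 have ratio \<open>t\<^sup>2\<close>, so that only the points \<open>t\<close> and \<open>- t\<close>
  have to be separated.  This is done by row 0, whose odd part is a single monomial.  The two
  highest terms of row 1 provide smoothness at infinity, and its second term makes the blow-up of the cusp
  as little singular as possible.\<close>

definition model_curve :: "nat \<Rightarrow> nat \<Rightarrow> nat \<Rightarrow> complex fps"
  where "model_curve m d i = (if i = 0 then 1 + fps_X ^ odd_exponent d
    else if i = 1 then fps_X ^ (2 * m) + fps_X ^ (2 * m + 1) + fps_X ^ (d - 1) + fps_X ^ d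
    else if i = 2 then fps_X ^ (2 * m + 2) else if i = 3 then fps_X ^ (2 * m + 4) else 0)"

locale model =
  fixes m d o' :: nat and f :: "nat \<Rightarrow> complex fps"
  assumes size_bounds: "m \<ge> 2" "d \<ge> 2 * m + 6"
  assumes o'_def: "o' = odd_exponent d"
  assumes f_def: "f = model_curve m d"
begin

lemma model_rows:
  "f 0 = 1 + fps_X ^ o'" "f 1 = fps_X ^ (2 * m) + fps_X ^ (2 * m + 1) + fps_X ^ (d - 1) + fps_X ^ d"
  "f (Suc 0) = fps_X ^ (2 * m) + fps_X ^ (2 * m + 1) + fps_X ^ (d - 1) + fps_X ^ d"
  "f 2 = fps_X ^ (2 * m + 2)" "f 3 = fps_X ^ (2 * m + 4)"
  by (simp_all add: f_def o'_def model_curve_def)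

lemma model_exp: "odd o'" "o' \<le> d" "d \<le> o' + 1"
  using size_bounds by (auto simp: o'_def odd_exponent_def)

lemma model_subdegrees: "subdegree (f 1) = 2 * m" "subdegree (f 2) = 2 * m + 2" "subdegree (f 3) = 2 * m + 4"
proof -
  show "subdegree (f 1) = 2 * m"
    by (rule subdegreeI) (use size_bounds in \<open>auto simp: model_rows fps_X_power_nth\<close>)
qed (simp_all add: model_rows subdegree_power)

lemma model_cusp_rows: "cusp_rows m f"
proof
  show "fps_nth (f 0) 0 \<noteq> 0" using model_exp(1) by (auto simp: model_rows fps_X_power_nth elim: oddE)
  show "f 1 \<noteq> 0" using model_subdegrees(1) size_bounds by auto
qed (use size_bounds model_subdegrees in \<open>auto simp: model_rows\<close>)

lemma model_deg_le: "deg_le d (f i)"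
  using size_bounds model_exp by (auto simp: f_def model_curve_def o'_def[symmetric] deg_le_def fps_X_power_nth)

abbreviation exps :: "nat \<Rightarrow> nat set"
  where "exps k \<equiv> {v. fps_X ^ v \<in> forms_on f k}"

lemma exps_add: "u \<in> exps k \<Longrightarrow> v \<in> exps l \<Longrightarrow> u + v \<in> exps (k + l)"
  using forms_on_mult[of "fps_X ^ u" f k "fps_X ^ v" l] by (simp add: power_add)

lemma exps_even: "j \<le> k \<Longrightarrow> (2 * m + 2) * k + 2 * j \<in> exps k"
proof -
  assume j: "j \<le> k"
  have "f 2 ^ (k - j) * f 3 ^ j \<in> forms_on f (k - j + j)"
    by (intro forms_on_mult row_power_in_forms_on) auto
  moreover have "f 2 ^ (k - j) * f 3 ^ j = fps_X ^ ((2 * m + 2) * (k - j) + (2 * m + 4) * j)"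
    by (simp only: model_rows power_add power_mult)
  moreover have "(2 * m + 2) * (k - j) + (2 * m + 4) * j = (2 * m + 2) * k + 2 * j"
  proof -
    obtain l where "k = j + l" using j le_Suc_ex by blast
    thus ?thesis by (simp add: algebra_simps)
  qed
  ultimately show ?thesis using j by simp
qed

lemma exps_even_interval: "even v \<Longrightarrow> (2 * m + 2) * k \<le> v \<Longrightarrow> v \<le> (2 * m + 4) * k \<Longrightarrow> v \<in> exps k"
proof -
  assume v: "even v" "(2 * m + 2) * k \<le> v" "v \<le> (2 * m + 4) * k"
  define j where "j = (v - (2 * m + 2) * k) div 2"
  have "even (v - (2 * m + 2) * k)" using v by simp
  hence "v = (2 * m + 2) * k + 2 * j" using v(2) by (simp add: j_def)
  moreover have "j \<le> k" using v(3) calculation by (simp add: algebra_simps)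
  ultimately show ?thesis using exps_even by metis
qed

text \<open>Multiplication of a monomial by row 0 gives \<open>t\<^sup>v + t\<^sup>v\<^sup>+\<^sup>o\<close>, of which either term determines the other one.\<close>

lemma exps_row0:
  assumes "v \<in> exps k"
  shows "v \<in> exps (k + 1) \<longleftrightarrow> v + o' \<in> exps (k + 1)"
proof -
  have *: "fps_X ^ v + fps_X ^ (v + o') \<in> forms_on f (k + 1)"
    using forms_on_mult[of "fps_X ^ v" f k "f 0" 1] assms row_in_forms_on[of 0 f]
    by (simp add: model_rows algebra_simps power_add)
  show ?thesis
    using fpsv.subspace_diff[OF subspace_word_span *, of "fps_X ^ v"]
      fpsv.subspace_diff[OF subspace_word_span *, of "fps_X ^ (v + o')"] by auto
qed

lemma exps_row1:
  assumes "v \<in> exps k" "v + 2 * m \<in> exps (k + 1)" "v + 2 * m + 1 \<in> exps (k + 1)" "v + d - 1 \<in> exps (k + 1)"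
  shows "v + d \<in> exps (k + 1)"
proof -
  have "fps_X ^ v * f 1 \<in> forms_on f (k + 1)"
    using forms_on_mult[of "fps_X ^ v" f k "f 1" 1] assms row_in_forms_on[of 1 f] by simp
  moreover have "fps_X ^ (v + 2 * m) + fps_X ^ (v + 2 * m + 1) + fps_X ^ (v + d - 1) \<in> forms_on f (k + 1)"
    using assms by (intro fpsv.subspace_add[OF subspace_word_span]) auto
  ultimately have "fps_X ^ v * f 1 - (fps_X ^ (v + 2 * m) + fps_X ^ (v + 2 * m + 1) + fps_X ^ (v + d - 1))
      \<in> forms_on f (k + 1)" by (rule fpsv.subspace_diff[OF subspace_word_span])
  moreover have "v + d - 1 = v + (d - 1)" using size_bounds by simp
  ultimately show ?thesis unfolding model_rows by (simp add: algebra_simps power_add)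
qed

text \<open>Products of the rows 2 and 3 give the even exponents of an interval; row 0 shifts them by an odd number.\<close>

lemma exps_base: "\<exists>k L U. k \<ge> 1 \<and> L + 2 * d \<le> U \<and> {L..U} \<subseteq> exps k"
proof -
  \<comment> \<open>The interval of even exponents has length \<open>2 K\<close>; the shift by row 0 takes \<open>2 m + 2 + o'\<close> away from it.\<close>
  define K where "K = 2 * d + m + 1"
  define L where "L = (2 * m + 2) * (K + 1) + o'"
  define U where "U = (2 * m + 4) * K"
  have len: "L + 2 * d \<le> U" using model_exp by (simp add: L_def U_def K_def algebra_simps)
  have "{L..U} \<subseteq> exps (K + 1)"
  proof
    fix v assume v: "v \<in> {L..U}"
    show "v \<in> exps (K + 1)"
    proof (cases "even v")
      case True
      thus ?thesis using v by (intro exps_even_interval) (auto simp: L_def U_def)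
    next
      case False
      have le: "(2 * m + 2) * (K + 1) + o' \<le> v" "v \<le> (2 * m + 4) * K" using v by (auto simp: L_def U_def)
      have "even (v - o')" using False model_exp le by simp
      have 1: "v - o' \<in> exps (K + 1)" by (rule exps_even_interval) (use le \<open>even (v - o')\<close> in auto)
      have 2: "v - o' \<in> exps K" by (rule exps_even_interval) (use le \<open>even (v - o')\<close> in auto)
      have "v - o' + o' \<in> exps (K + 1)" using exps_row0[OF 2] 1 by blast
      thus ?thesis using le by simp
    qed
  qed
  thus ?thesis using len by (metis le_add2)
qed

text \<open>Row 2 shifts the interval, row 0 then extends it upwards and, going back, downwards to the old lower
  end; row 1 supplies the last exponent.\<close>

lemma exps_step:
  assumes "{L..U} \<subseteq> exps k" "L + 2 * d \<le> U"
  shows "{L..U + d} \<subseteq> exps (k + 1)"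
proof -
  have 1: "v \<in> exps (k + 1)" if "L + (2 * m + 2) \<le> v" "v \<le> U + (2 * m + 2)" for v
  proof -
    have "v - (2 * m + 2) \<in> {L..U}" using that by auto
    hence "v - (2 * m + 2) \<in> exps k" using assms by blast
    moreover have "2 * m + 2 \<in> exps 1" using exps_even[of 0 1] by simp
    ultimately have "v - (2 * m + 2) + (2 * m + 2) \<in> exps (k + 1)" by (rule exps_add)
    moreover have "v - (2 * m + 2) + (2 * m + 2) = v" using that by simp
    ultimately show ?thesis by (simp only:)
  qed
  have 2: "v \<in> exps (k + 1)" if "L + (2 * m + 2) \<le> v" "v \<le> U + o'" for v
  proof (cases "v \<le> U + (2 * m + 2)")
    case False
    hence le: "L + (2 * m + 2) \<le> v - o'" "v - o' \<le> U" "o' \<le> v" using assms(2) model_exp that by linarith+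
    have "v - o' \<in> {L..U}" using le by auto
    hence "v - o' \<in> exps k" using assms by blast
    from exps_row0[OF this] 1[OF le(1)] le(2) have "v - o' + o' \<in> exps (k + 1)" by simp
    thus ?thesis using le by simp
  qed (use 1 that in auto)
  have 3: "v \<in> exps (k + 1)" if "L \<le> v" "v \<le> U + o'" for v
  proof (cases "L + (2 * m + 2) \<le> v")
    case False
    have "v \<in> {L..U}" using False that assms(2) size_bounds by auto
    hence "v \<in> exps k" using assms(1) by blast
    moreover have "v + o' \<in> exps (k + 1)" using False that model_exp size_bounds assms(2) by (intro 2) linarith+
    ultimately show ?thesis using exps_row0 by blast
  qed (use 2 that in auto)
  show ?thesis
  proof
    fix v assume v: "v \<in> {L..U + d}"
    show "v \<in> exps (k + 1)"
    proof (cases "v \<le> U + o'")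
      case False
      hence v': "v = U + d" using v model_exp by auto
      have "U \<in> {L..U}" using assms(2) by auto
      hence "U \<in> exps k" using assms(1) by blast
      moreover have "U + 2 * m \<in> exps (k + 1)" "U + 2 * m + 1 \<in> exps (k + 1)" "U + d - 1 \<in> exps (k + 1)"
        using model_exp size_bounds assms(2) by (intro 3; linarith)+
      ultimately show ?thesis unfolding v' by (rule exps_row1)
    qed (use 3 v in auto)
  qed
qed

lemma exps_growing: "\<exists>k L U. k \<ge> 1 \<and> (\<forall>n. {L..U + n * d} \<subseteq> exps (k + n))"
proof -
  obtain k L U where k: "k \<ge> 1" "L + 2 * d \<le> U" "{L..U} \<subseteq> exps k" using exps_base by blast
  have "{L..U + n * d} \<subseteq> exps (k + n)" for n
  proof (induction n)
    case (Suc n)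
    have "{L..U + n * d + d} \<subseteq> exps (k + n + 1)" by (rule exps_step[OF Suc]) (use k in simp)
    thus ?case by (simp add: algebra_simps)
  qed (use k in simp)
  thus ?thesis using k by blast
qed

text \<open>One combination of the rows has degree exactly \<open>d - 1\<close>, another one degree \<open>d\<close>: the curve is smooth at
  infinity.\<close>

lemma model_degree_pred: "\<exists>g \<in> forms_on f 1. deg_le (d - 1) g \<and> fps_nth g (d - 1) \<noteq> 0"
proof (cases "odd d")
  case True
  hence o: "o' = d" by (simp add: o'_def odd_exponent_def)
  have "f 1 - f 0 \<in> forms_on f 1"
    by (intro fpsv.subspace_diff[OF subspace_word_span] row_in_forms_on) auto
  moreover have "deg_le (d - 1) (f 1 - f 0)" "fps_nth (f 1 - f 0) (d - 1) \<noteq> 0"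
    using size_bounds unfolding model_rows o deg_le_def by (auto simp: fps_X_power_nth)
  ultimately show ?thesis by blast
next
  case False
  hence o: "o' = d - 1" by (simp add: o'_def odd_exponent_def)
  have "deg_le (d - 1) (f 0)" "fps_nth (f 0) (d - 1) \<noteq> 0"
    using size_bounds unfolding model_rows o deg_le_def by (auto simp: fps_X_power_nth)
  thus ?thesis using row_in_forms_on[of 0 f] by auto
qed

text \<open>A fixed number of exponents at the upper end is still missing from \<open>exps_growing\<close>.  These are the degrees of
  products of powers of row 1, which has degree \<open>d\<close>, and of a combination of degree \<open>d - 1\<close>; the lower
  terms of these products are known by induction.\<close>

lemma model_monomials: "\<exists>L N. \<forall>n\<ge>N. {L..n * d} \<subseteq> exps n"
proof -
  obtain k L U where k: "k \<ge> 1" "\<And>n. {L..U + n * d} \<subseteq> exps (k + n)" using exps_growing by blast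
  obtain g where g: "g \<in> forms_on f 1" "deg_le (d - 1) g" "fps_nth g (d - 1) \<noteq> 0"
    using model_degree_pred by blast
  define N where "N = k + k * d + L"
  have "{L..n * d} \<subseteq> exps n" if n: "n \<ge> N" for n
  proof -
    have kn: "k + (n - k) = n" using n by (simp add: N_def)
    have "v \<in> exps n" if "L \<le> v" "v \<le> n * d" for v
      using that
    proof (induction v rule: less_induct)
      case (less v)
      show ?case
      proof (cases "v \<le> U + (n - k) * d")
        case True
        thus ?thesis using less.prems k(2)[of "n - k"] kn by auto
      next
        case False
        define b where "b = n * d - v"
        have "n * d = k * d + (n - k) * d" using kn by (metis add_mult_distrib)
        hence b: "b \<le> k * d" using False by (simp add: b_def)
        hence bn: "b + L \<le> n" using n by (simp add: N_def)
        \<comment> \<open>This element has degree exactly \<open>v\<close>, and order at least \<open>L\<close> since \<open>n - b \<ge> L\<close>.\<close>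
        define F where "F = f 1 ^ (n - b) * g ^ b"
        have "F \<in> forms_on f (n - b + b * 1)" unfolding F_def
          by (intro forms_on_mult row_power_in_forms_on power_in_forms_on g(1)) auto
        hence F: "F \<in> forms_on f n" using bn by simp
        have deg: "(n - b) * d + b * (d - 1) = v"
        proof -
          have "b * (d - 1) + b = b * d" using size_bounds by (cases d) auto
          moreover have "(n - b) * d + b * d = n * d" using bn by (metis add_mult_distrib le_add_diff_inverse2 add_leD1)
          ultimately show ?thesis using less.prems by (simp add: b_def)
        qed
        have d1: "deg_le v F"
          using deg_le_mult(1)[OF deg_le_power(1)[OF model_deg_le[of 1], of "n - b"] deg_le_power(1)[OF g(2), of b]]
          unfolding F_def deg .
        have "fps_nth (f 1) d = 1" using size_bounds unfolding model_rows by (auto simp: fps_X_power_nth)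
        hence d2: "fps_nth F v \<noteq> 0"
          using deg_le_mult(2)[OF deg_le_power(1)[OF model_deg_le[of 1], of "n - b"] deg_le_power(1)[OF g(2), of b]]
          unfolding F_def deg deg_le_power(2)[OF model_deg_le[of 1]] deg_le_power(2)[OF g(2)] using g(3) by simp
        have "fps_X ^ (2 * m * (n - b)) dvd f 1 ^ (n - b)"
          using dvd_power_same[OF cusp_rows.dvd_rows(1)[OF model_cusp_rows], of "n - b"] by (simp add: power_mult)
        hence "fps_X ^ (2 * m * (n - b)) dvd F" unfolding F_def by (rule dvd_mult2)
        moreover have "L \<le> 2 * m * (n - b)"
        proof -
          have "n - b \<le> 2 * m * (n - b)" using size_bounds by simp
          thus ?thesis using bn by linarith
        qed
        ultimately have d3: "fps_nth F j = 0" if "j < L" for j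
          using that unfolding X_power_dvd_iff by (meson less_le_trans)
        have "fps_X ^ v \<in> forms_on f n"
        proof (rule monomial_extract[OF subspace_word_span F, of "{L..<v}"])
          fix j assume "fps_nth F j \<noteq> 0"
          thus "j \<in> {L..<v} \<or> j = v" using d3[of j] deg_leD[OF d1, of j]
            by (metis atLeastLessThan_iff linorder_neqE_nat not_less)
        next
          fix j assume "j \<in> {L..<v}"
          thus "fps_X ^ j \<in> forms_on f n" using less.IH[of j] less.prems by auto
        qed (use d2 in auto)
        thus ?thesis by simp
      qed
    qed
    thus ?thesis by auto
  qed
  thus ?thesis by blast
qed

lemma cusp_word_even:
  assumes "s \<le> 2 * e"
  shows "\<exists>A \<in> word_span f (cusp_words e). A \<noteq> 0 \<and> subdegree A = 2 * m * e + 2 * s"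
proof -
  define i3 where "i3 = s - e"
  define i2 where "i2 = (if s \<le> e then s else 2 * e - s)"
  define i1 where "i1 = e - i2 - i3"
  have i: "i1 + i2 + i3 = e" "i2 + 2 * i3 = s" using assms by (auto simp: i1_def i2_def i3_def)
  interpret cusp_rows m f by (rule model_cusp_rows)
  define A where "A = f 1 ^ i1 * f 2 ^ i2 * f 3 ^ i3"
  have "A \<in> word_span f (cusp_words e)"
    unfolding A_def i(1)[symmetric] by (intro cusp_words_mult row_power_in_cusp_words) auto
  moreover have nz: "A \<noteq> 0" unfolding A_def by (intro no_zero_divisors power_not_zero row1 row2 row3)
  moreover have "subdegree A = i1 * (2 * m) + i2 * (2 * m + 2) + i3 * (2 * m + 4)"
    using row1 row2 row3 unfolding A_def by simp
  moreover have "\<dots> = 2 * m * e + 2 * s" unfolding i[symmetric] by (simp add: algebra_simps)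
  ultimately show ?thesis by auto
qed

text \<open>The odd orders come from \<open>f\<^sub>1 f\<^sub>3 - f\<^sub>2\<^sup>2\<close>, which has order \<open>4 m + 5\<close>.\<close>

lemma cusp_word_odd:
  assumes "s \<le> 2 * e"
  shows "\<exists>A \<in> word_span f (cusp_words (e + 2)). A \<noteq> 0 \<and> subdegree A = 2 * m * (e + 2) + 5 + 2 * s"
proof -
  obtain A where A: "A \<in> word_span f (cusp_words e)" "A \<noteq> 0" "subdegree A = 2 * m * e + 2 * s"
    using cusp_word_even[OF assms] by blast
  define Q where "Q = f 1 * f 3 - f 2 ^ 2"
  have "Q \<in> word_span f (cusp_words 2)"
    unfolding Q_def using cusp_words_mult[OF row_in_cusp_words[of 1 f] row_in_cusp_words[of 3 f]]
      row_power_in_cusp_words[of 2 f 2]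
    by (intro fpsv.subspace_diff[OF subspace_word_span]) (auto simp: numeral_2_eq_2)
  hence "A * Q \<in> word_span f (cusp_words (e + 2))" using A by (intro cusp_words_mult)
  moreover have Q: "Q = fps_X ^ (4 * m + 5) + fps_X ^ (2 * m + 4 + (d - 1)) + fps_X ^ (2 * m + 4 + d)"
  proof -
    have 1: "fps_X ^ (2 * m) * fps_X ^ (2 * m + 4) = (fps_X ^ (2 * m + 2) :: complex fps) ^ 2"
      unfolding power_add[symmetric] power_mult[symmetric] by (rule arg_cong[of _ _ "power fps_X"]) simp
    have 2: "fps_X ^ (2 * m + 1) * fps_X ^ (2 * m + 4) = (fps_X ^ (4 * m + 5) :: complex fps)"
      unfolding power_add[symmetric] by (rule arg_cong[of _ _ "power fps_X"]) simp
    have 3: "fps_X ^ k * fps_X ^ (2 * m + 4) = (fps_X ^ (2 * m + 4 + k) :: complex fps)" for k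
      unfolding power_add[symmetric] by (rule arg_cong[of _ _ "power fps_X"]) simp
    have 4: "A + B + C + D - A = B + C + D" for A B C D :: "complex fps" by simp
    show ?thesis unfolding Q_def model_rows distrib_right 1 2 3[of "d - 1"] 3[of d] by (rule 4)
  qed
  have sQ: "subdegree Q = 4 * m + 5"
    by (rule subdegreeI) (use size_bounds in \<open>auto simp: Q fps_X_power_nth\<close>)
  hence "Q \<noteq> 0" by auto
  moreover have "subdegree (A * Q) = 2 * m * (e + 2) + 5 + 2 * s"
    using A \<open>Q \<noteq> 0\<close> by (simp add: sQ algebra_simps)
  ultimately show ?thesis using A by (intro bexI[of _ "A * Q"]) auto
qed

text \<open>The model curve attains the bound of \<open>ords_cusp_forms\<close>: the small orders come from products of \<open>e\<close> rows, the large
  ones from \<open>model_monomials\<close>.\<close>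

lemma model_ords:
  "\<exists>e N. e \<ge> 1 \<and> (\<forall>n\<ge>N. {2 * m * e, 2 * m * e + 2} \<union> {2 * m * e + 4..(e + n) * d} \<subseteq> ords (cusp_forms f e n))"
proof -
  obtain L N where LN: "\<And>n. n \<ge> N \<Longrightarrow> {L..n * d} \<subseteq> exps n" using model_monomials by blast
  \<comment> \<open>Products of \<open>e\<close> rows must reach all orders up to \<open>(2 m + 2) e + L\<close>, where the monomials begin.\<close>
  define e where "e = L + 2"
  define A where "A = (2 * m + 2) * e + L"
  interpret cusp_rows m f by (rule model_cusp_rows)
  have sub0: "f 0 \<noteq> 0" "subdegree (f 0) = 0" using row0 by auto
  have "{2 * m * e, 2 * m * e + 2} \<union> {2 * m * e + 4..(e + n) * d} \<subseteq> ords (cusp_forms f e n)"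
    if n: "n \<ge> N + e * d + L + 2 * e" for n
  proof -
    have nd: "n \<le> n * d" using size_bounds by simp
    have exps_n: "{L..n * d} \<subseteq> exps n" using n by (intro LN) simp
    have high: "fps_X ^ v \<in> cusp_forms f e n" if "A \<le> v" "v \<le> (e + n) * d" for v
      using that
    proof (induction v rule: less_induct)
      case (less v)
      show ?case
      proof (cases "v \<le> (2 * m + 2) * e + n * d")
        case True
        have "v - (2 * m + 2) * e \<in> {L..n * d}"
          using True less.prems unfolding A_def atLeastAtMost_iff by linarith
        hence "v - (2 * m + 2) * e \<in> exps n" using exps_n by blast
        hence "f 2 ^ e * fps_X ^ (v - (2 * m + 2) * e) \<in> cusp_forms f e n"
          by (intro cusp_forms_mult row_power_in_cusp_words) auto
        moreover have "(2 * m + 2) * e + (v - (2 * m + 2) * e) = v" using less.prems(1) by (simp add: A_def)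
        hence "f 2 ^ e * fps_X ^ (v - (2 * m + 2) * e) = fps_X ^ v"
          unfolding model_rows power_mult[symmetric] power_add[symmetric] by (simp only:)
        ultimately show ?thesis by simp
      next
        case False
        define u where "u = v - e * d"
        have u: "v = u + e * d" "u \<le> n * d" "L + 2 * e \<le> u"
        proof -
          have "L + 2 * e + e * d \<le> v" using False n nd by linarith
          moreover have "v \<le> e * d + n * d" using less.prems(2) by (simp only: add_mult_distrib)
          ultimately show "v = u + e * d" "u \<le> n * d" "L + 2 * e \<le> u" unfolding u_def by linarith+
        qed
        hence "u \<in> {L..n * d}" by auto
        hence "u \<in> exps n" using exps_n by blast
        define F where "F = f 1 ^ e * fps_X ^ u"
        have F: "F \<in> cusp_forms f e n" unfolding F_def using \<open>u \<in> exps n\<close>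
          by (intro cusp_forms_mult row_power_in_cusp_words) auto
        have dX: "deg_le u (fps_X ^ u)" by (simp add: deg_le_X_power)
        have d1: "deg_le v F" using deg_le_mult(1)[OF deg_le_power(1)[OF model_deg_le[of 1], of e] dX]
          unfolding F_def u by (simp add: add.commute)
        have "fps_nth (f 1) d = 1" using size_bounds unfolding model_rows by (auto simp: fps_X_power_nth)
        hence d2: "fps_nth F v \<noteq> 0"
          using deg_le_mult(2)[OF deg_le_power(1)[OF model_deg_le[of 1], of e] dX]
          unfolding F_def u deg_le_power(2)[OF model_deg_le[of 1]] by (simp add: add.commute)
        have "fps_X ^ (2 * m * e) dvd f 1 ^ e"
          using dvd_power_same[OF dvd_rows(1), of e] by (simp add: power_mult)
        hence "fps_X ^ (2 * m * e + u) dvd F" unfolding F_def power_add by (intro mult_dvd_mono) auto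
        moreover have "A \<le> 2 * m * e + u" using u(3) by (simp add: A_def algebra_simps)
        ultimately have d3: "fps_nth F j = 0" if "j < A" for j
          using that unfolding X_power_dvd_iff by (meson less_le_trans)
        show ?thesis
        proof (rule monomial_extract[OF subspace_cusp_forms F, of "{A..<v}"])
          fix j assume "fps_nth F j \<noteq> 0"
          thus "j \<in> {A..<v} \<or> j = v" using d3[of j] deg_leD[OF d1, of j]
            by (metis atLeastLessThan_iff linorder_neqE_nat not_less)
        next
          fix j assume "j \<in> {A..<v}"
          thus "fps_X ^ j \<in> cusp_forms f e n" using less.IH[of j] less.prems by auto
        qed (use d2 in auto)
      qed
    qed
    have low: "subdegree G \<in> ords (cusp_forms f e n)" if "G \<in> word_span f (cusp_words e)" "G \<noteq> 0" for G
    proof -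
      have "G * f 0 ^ n \<in> cusp_forms f e n" using that by (intro cusp_forms_mult row_power_in_forms_on) auto
      moreover have "G * f 0 ^ n \<noteq> 0" "subdegree (G * f 0 ^ n) = subdegree G" using that sub0 by auto
      ultimately show ?thesis unfolding ords_def by (intro image_eqI[of _ _ "G * f 0 ^ n"]) auto
    qed
    have even: "2 * m * e + 2 * s \<in> ords (cusp_forms f e n)" if "s \<le> 2 * e" for s
      using cusp_word_even[OF that] low by metis
    have odd: "2 * m * e + 5 + 2 * s \<in> ords (cusp_forms f e n)" if "s \<le> 2 * L" for s
      using cusp_word_odd[OF that] low unfolding e_def by metis
    have "v \<in> ords (cusp_forms f e n)" if "2 * m * e + 4 \<le> v" "v \<le> (e + n) * d" for v
    proof (cases "A \<le> v")
      case True
      show ?thesis by (rule ordsI[OF high[OF True that(2)]]) (auto simp: fps_X_power_nth)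
    next
      case False
      define t where "t = v - 2 * m * e"
      have t: "v = 2 * m * e + t" "4 \<le> t" "t < 2 * e + L" using that False by (auto simp: t_def A_def algebra_simps)
      show ?thesis
      proof (cases "even t")
        case True
        then obtain s where "t = 2 * s" by blast
        thus ?thesis using even[of s] t by (simp add: e_def)
      next
        case False
        hence "t \<noteq> 4" by auto
        hence "even (t - 5)" "5 \<le> t" using False t by auto
        then obtain s where "t - 5 = 2 * s" by blast
        hence s: "t = 5 + 2 * s" using \<open>5 \<le> t\<close> by simp
        thus ?thesis using odd[of s] t by (simp add: e_def add.assoc)
      qed
    qed
    thus ?thesis using even[of 0] even[of 1] by (auto simp: e_def)
  qed
  moreover have "e \<ge> 1" by (simp add: e_def)
  ultimately show ?thesis by blast
qed

lemma model_semigroup: "\<exists>L. {L..} \<subseteq> semigroup_of f"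
proof -
  obtain L N where LN: "\<And>n. n \<ge> N \<Longrightarrow> {L..n * d} \<subseteq> exps n" using model_monomials by blast
  have "v \<in> semigroup_of f" if "v \<ge> L" for v
  proof -
    have "v \<le> v * d" using size_bounds by (cases d) auto
    hence "v \<le> (N + v) * d" unfolding add_mult_distrib by (rule trans_le_add2)
    hence "fps_X ^ v \<in> forms_on f (N + v)" using LN[of "N + v"] that by auto
    hence "v \<in> ords (forms_on f (N + v))" by (rule ordsI) (auto simp: fps_X_power_nth)
    thus ?thesis by (auto simp: semigroup_of_def)
  qed
  thus ?thesis by auto
qed

end

section \<open>The generic value semigroup\<close>

definition coeff_rows :: "(nat \<times> nat \<Rightarrow> complex) \<Rightarrow> nat \<Rightarrow> complex fps"
  where "coeff_rows a i = Abs_fps (\<lambda>j. a (i, j))"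

text \<open>The orders of vanishing at \<open>t = 0\<close> of the rows in normal form.\<close>

definition pord :: "nat \<Rightarrow> nat \<Rightarrow> nat"
  where "pord m i = (if i = 0 then 0 else 2 * m + 2 * (i - 1))"

definition cusp_index :: "nat \<Rightarrow> (nat \<times> nat) set"
  where "cusp_index m = {(i, j). i < 4 \<and> pord m i \<le> j}"

definition pivots :: "nat \<Rightarrow> (nat \<times> nat \<Rightarrow> complex) \<Rightarrow> complex"
  where "pivots m a = (\<Prod>i<4. a (i, pord m i))"

definition cusp_coeffs :: "nat \<Rightarrow> (nat \<times> nat \<Rightarrow> complex) set"
  where "cusp_coeffs m = {a \<in> coord_space (cusp_index m). pivots m a \<noteq> 0}"

lemma pord_simps: "pord m 0 = 0" "pord m 1 = 2 * m" "pord m (Suc 0) = 2 * m" "pord m 2 = 2 * m + 2" "pord m 3 = 2 * m + 4"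
  by (auto simp: pord_def)

lemma all_less_4: "(\<forall>i<4. P i) \<longleftrightarrow> P 0 \<and> P 1 \<and> P 2 \<and> P (3 :: nat)"
  by (auto simp: numeral_eq_Suc less_Suc_eq)

lemma pivots_nonzero: "pivots m a \<noteq> 0 \<longleftrightarrow> (\<forall>i<4. a (i, pord m i) \<noteq> 0)"
  by (auto simp: pivots_def)

lemma poly_fun_pivots: "pivots m \<in> poly_fun"
  unfolding pivots_def[abs_def] by (intro poly_fun_prod poly_fun.coord)

lemma subdegree_rows:
  assumes "a \<in> cusp_coeffs m" "i < 4"
  shows "coeff_rows a i \<noteq> 0" "subdegree (coeff_rows a i) = pord m i"
proof -
  have n: "fps_nth (coeff_rows a i) (pord m i) \<noteq> 0" using assms by (auto simp: cusp_coeffs_def pivots_nonzero coeff_rows_def)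
  thus "coeff_rows a i \<noteq> 0" by auto
  show "subdegree (coeff_rows a i) = pord m i"
    by (rule subdegreeI[OF n]) (use assms in \<open>auto simp: coeff_rows_def cusp_coeffs_def coord_space_def cusp_index_def\<close>)
qed

lemma cusp_coeffs_rows:
  assumes "a \<in> cusp_coeffs m" "m \<ge> 2" shows "cusp_rows m (coeff_rows a)"
proof -
  note s = subdegree_rows[OF assms(1), of 0] subdegree_rows[OF assms(1), of 1]
    subdegree_rows[OF assms(1), of 2] subdegree_rows[OF assms(1), of 3]
  have "fps_nth (coeff_rows a 0) 0 \<noteq> 0"
    using nth_subdegree_nonzero[OF s(1)] s(2) by (simp add: pord_simps)
  thus ?thesis using s assms(2) by unfold_locales (simp_all add: pord_simps)
qed

lemma poly_fun_coeff_rows: "(\<lambda>a. fps_nth (coeff_rows a i) j) \<in> poly_fun"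
  by (auto simp: coeff_rows_def intro: poly_fun.coord)

definition value_count :: "(nat \<times> nat \<Rightarrow> complex) \<Rightarrow> nat \<Rightarrow> nat"
  where "value_count a n = card (semigroup_of (coeff_rows a) \<inter> {..<n})"

text \<open>Finitely many values are attained by forms of one degree \<open>k\<close>.\<close>

lemma value_count_semicontinuous:
  assumes "fps_nth (coeff_rows a0 0) 0 \<noteq> 0"
  shows "\<exists>p \<in> poly_fun. p a0 \<noteq> 0 \<and> (\<forall>a. p a \<noteq> 0 \<longrightarrow> value_count a0 n \<le> value_count a n)"
proof -
  obtain k where k: "semigroup_of (coeff_rows a0) \<inter> {..<n} \<subseteq> ords (forms_on (coeff_rows a0) k)"
    using finite_part_of_semigroup_of[where f = "coeff_rows a0", OF assms] by blast
  obtain p where p: "p \<in> poly_fun" "p a0 \<noteq> 0" "\<And>a. p a \<noteq> 0 \<Longrightarrow>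
    card (ords (forms_on (coeff_rows a0) k) \<inter> {..<n}) \<le> card (ords (forms_on (coeff_rows a) k) \<inter> {..<n})"
    using ords_semicontinuous[where f = coeff_rows, OF poly_fun_coeff_rows finite_words] by metis
  have "value_count a0 n \<le> value_count a n" if "p a \<noteq> 0" for a
  proof -
    have "value_count a0 n \<le> card (ords (forms_on (coeff_rows a0) k) \<inter> {..<n})"
      unfolding value_count_def using k by (intro card_mono) auto
    also have "\<dots> \<le> card (ords (forms_on (coeff_rows a) k) \<inter> {..<n})" by (rule p(3)[OF that])
    also have "\<dots> \<le> value_count a n" unfolding value_count_def
      by (intro card_mono) (auto simp: semigroup_of_def)
    finally show ?thesis .
  qed
  thus ?thesis using p by blast
qed

lemma value_counts_semicontinuous:
  assumes "fps_nth (coeff_rows a0 0) 0 \<noteq> 0"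
  shows "\<exists>p \<in> poly_fun. p a0 \<noteq> 0 \<and> (\<forall>a. p a \<noteq> 0 \<longrightarrow> (\<forall>n\<le>N. value_count a0 n \<le> value_count a n))"
proof -
  have "\<forall>n. \<exists>p. p \<in> poly_fun \<and> p a0 \<noteq> 0 \<and> (\<forall>a. p a \<noteq> 0 \<longrightarrow> value_count a0 n \<le> value_count a n)"
    using value_count_semicontinuous[OF assms] by blast
  from choice[OF this] obtain p where
    p: "\<forall>n. p n \<in> poly_fun \<and> p n a0 \<noteq> 0 \<and> (\<forall>a. p n a \<noteq> 0 \<longrightarrow> value_count a0 n \<le> value_count a n)" ..
  show ?thesis
    by (intro bexI[of _ "\<lambda>a. \<Prod>n\<le>N. p n a"]) (use p in \<open>auto intro!: poly_fun_prod\<close>)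
qed

definition model_coeffs :: "nat \<Rightarrow> nat \<Rightarrow> nat \<times> nat \<Rightarrow> complex"
  where "model_coeffs m d = (\<lambda>(i, j). fps_nth (model_curve m d i) j)"

lemma coeff_rows_model_coeffs: "coeff_rows (model_coeffs m d) = model_curve m d"
  by (auto simp: coeff_rows_def model_coeffs_def fun_eq_iff fps_eq_iff)

lemma model_coeffs_in:
  assumes "m \<ge> 2" "d \<ge> 2 * m + 6"
  shows "model_coeffs m d \<in> cusp_coeffs m" "model_coeffs m d \<in> coord_space (param_index d)"
proof -
  interpret model m d "odd_exponent d" "model_curve m d" by unfold_locales (use assms in auto)
  interpret cusp_rows m "model_curve m d" by (rule model_cusp_rows)
  have z: "model_curve m d i = 0" if "i \<ge> 4" for i using that by (simp add: model_curve_def)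
  have low: "fps_nth (model_curve m d i) j = 0" if "i < 4" "j < pord m i" for i j
  proof -
    have "\<forall>i<4. \<forall>j<pord m i. fps_nth (model_curve m d i) j = 0"
      unfolding all_less_4 pord_simps using dvd_rows unfolding X_power_dvd_iff by simp
    thus ?thesis using that by blast
  qed
  have "\<forall>i<4. fps_nth (model_curve m d i) (pord m i) \<noteq> 0"
    unfolding all_less_4 pord_simps
    using row0 nth_subdegree_nonzero[OF row1(1)] nth_subdegree_nonzero[OF row2(1)] nth_subdegree_nonzero[OF row3(1)]
    unfolding row1(2) row2(2) row3(2) by simp
  hence "pivots m (model_coeffs m d) \<noteq> 0" by (simp add: pivots_nonzero model_coeffs_def)
  moreover have "model_coeffs m d (i, j) = 0" if "(i, j) \<notin> cusp_index m" for i j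
    using that z[of i] low[of i j] by (cases "i < 4") (auto simp: model_coeffs_def cusp_index_def)
  ultimately show "model_coeffs m d \<in> cusp_coeffs m" by (auto simp: cusp_coeffs_def coord_space_def)
  show "model_coeffs m d \<in> coord_space (param_index d)"
    using z deg_leD[OF model_deg_le] by (auto simp: coord_space_def param_index_def model_coeffs_def not_less)
qed

text \<open>For each \<open>n\<close> separately a maximum is attained, and it is attained on a nonempty open set; finitely many such sets
  meet.\<close>

lemma max_value_count_exists:
  assumes "m \<ge> 2"
  shows "\<exists>a0 \<in> cusp_coeffs m. \<forall>n\<le>N. \<forall>a \<in> cusp_coeffs m. value_count a n \<le> value_count a0 n"
proof -
  have ne: "model_coeffs m (2 * m + 6) \<in> cusp_coeffs m" using assms by (intro model_coeffs_in) auto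
  have "\<exists>b. b \<in> cusp_coeffs m \<and> (\<forall>a. a \<in> cusp_coeffs m \<longrightarrow> value_count a n \<le> value_count b n)" for n
  proof (rule Lattices_Big.ex_has_greatest_nat[of "\<lambda>a. a \<in> cusp_coeffs m" _ "\<lambda>a. value_count a n" "Suc n", OF ne])
    show "\<forall>a. a \<in> cusp_coeffs m \<longrightarrow> value_count a n < Suc n"
    proof (intro allI impI)
      fix a
      have "value_count a n \<le> card {..<n}" unfolding value_count_def by (intro card_mono) auto
      thus "value_count a n < Suc n" by simp
    qed
  qed
  hence "\<forall>n. \<exists>b. b \<in> cusp_coeffs m \<and> (\<forall>a. a \<in> cusp_coeffs m \<longrightarrow> value_count a n \<le> value_count b n)" by blast
  from choice[OF this] obtain b where b: "\<forall>n. b n \<in> cusp_coeffs m \<and> (\<forall>a. a \<in> cusp_coeffs m \<longrightarrow> value_count a n \<le> value_count (b n) n)" ..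
  have r0: "fps_nth (coeff_rows (b n) 0) 0 \<noteq> 0" for n
    using cusp_rows.row0[OF cusp_coeffs_rows[OF _ assms]] b by blast
  have "\<forall>n. \<exists>p. p \<in> poly_fun \<and> p (b n) \<noteq> 0 \<and> (\<forall>a. p a \<noteq> 0 \<longrightarrow> value_count (b n) n \<le> value_count a n)"
    using value_count_semicontinuous[OF r0] by blast
  from choice[OF this] obtain p where
    p: "\<forall>n. p n \<in> poly_fun \<and> p n (b n) \<noteq> 0 \<and> (\<forall>a. p n a \<noteq> 0 \<longrightarrow> value_count (b n) n \<le> value_count a n)" ..
  define P where "P = (\<lambda>n. if n \<le> N then p n else pivots m)"
  have "\<exists>v\<in>coord_space (cusp_index m). \<forall>n\<in>{..N + 1}. P n v \<noteq> 0"
  proof (rule coord_space_irreducible_finite)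
    fix n
    show "P n \<in> poly_fun" using p poly_fun_pivots by (simp add: P_def)
    have "b n \<in> coord_space (cusp_index m)" "pivots m (b n) \<noteq> 0" using b by (auto simp: cusp_coeffs_def)
    thus "\<exists>v\<in>coord_space (cusp_index m). P n v \<noteq> 0" using p by (auto simp: P_def)
  qed (use ne in \<open>auto simp: cusp_coeffs_def\<close>)
  then obtain v where v: "v \<in> coord_space (cusp_index m)" "\<forall>n\<in>{..N + 1}. P n v \<noteq> 0" by blast
  have "pivots m v \<noteq> 0" using v(2) by (auto simp: P_def dest: bspec[of _ _ "N + 1"])
  hence "v \<in> cusp_coeffs m" using v by (simp add: cusp_coeffs_def)
  moreover have "value_count a n \<le> value_count v n" if "n \<le> N" "a \<in> cusp_coeffs m" for n a
  proof -
    have "p n v \<noteq> 0" using v(2) that by (auto simp: P_def dest: bspec[of _ _ n])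
    thus ?thesis using p b that le_trans by meson
  qed
  ultimately show ?thesis by blast
qed

text \<open>If \<open>x\<close> is a gap, then one of \<open>i\<close> and \<open>x - i\<close> is a gap for every \<open>i \<le> x\<close>.\<close>

lemma few_gaps_imp_contains:
  assumes "card (S \<inter> {..<N}) \<ge> N - L" "\<And>u v. u \<in> S \<Longrightarrow> v \<in> S \<Longrightarrow> u + v \<in> S" "x < N" "2 * L \<le> x"
  shows "(x :: nat) \<in> S"
proof (rule ccontr)
  assume x: "x \<notin> S"
  define G where "G = {..<N} - S"
  have "card G = N - card (S \<inter> {..<N})" unfolding G_def by (simp add: card_Diff_subset_Int Int_commute)
  hence G: "card G \<le> L" using assms(1) by linarith
  have "{..x} \<subseteq> G \<union> (\<lambda>i. x - i) ` G"
  proof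
    fix i assume i: "i \<in> {..x}"
    have "i \<notin> S \<or> x - i \<notin> S" using assms(2)[of i "x - i"] x i by auto
    thus "i \<in> G \<union> (\<lambda>i. x - i) ` G"
      using i assms(3) by (auto simp: G_def image_iff intro!: bexI[of _ "x - i"])
  qed
  hence "card {..x} \<le> card (G \<union> (\<lambda>i. x - i) ` G)" by (intro card_mono) (auto simp: G_def)
  also have "\<dots> \<le> card G + card ((\<lambda>i. x - i) ` G)" by (rule card_Un_le)
  also have "\<dots> \<le> 2 * L" using G card_image_le[of G "\<lambda>i. x - i"] by (simp add: G_def)
  finally show False using assms(4) by simp
qed

lemma few_gaps_imp_conductor:
  assumes S: "card (S \<inter> {..<4 * L + 1}) \<ge> 4 * L + 1 - L" "\<And>u v. u \<in> S \<Longrightarrow> v \<in> S \<Longrightarrow> u + v \<in> S" and "L \<ge> 1"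
  shows "{2 * L..} \<subseteq> (S :: nat set)"
proof
  fix x assume "x \<in> {2 * L..}"
  thus "x \<in> S"
  proof (induction x rule: less_induct)
    case (less x)
    have 0: "y \<in> S" if "2 * L \<le> y" "y < 4 * L + 1" for y
      using few_gaps_imp_contains[OF S that(2,1)] .
    show ?case
    proof (cases "x < 4 * L + 1")
      case False
      have "2 * L \<in> S" by (rule 0) auto
      moreover have "x - 2 * L \<in> S" using False less.prems assms(3) by (intro less.IH) auto
      ultimately have "2 * L + (x - 2 * L) \<in> S" by (rule S(2))
      thus ?thesis using False by simp
    qed (use 0 less.prems in auto)
  qed
qed

lemma sets_eq_of_counts:
  assumes "\<And>n. n \<le> N \<Longrightarrow> card (S \<inter> {..<n}) = card (T \<inter> {..<n})" "{N..} \<subseteq> S" "{N..} \<subseteq> (T :: nat set)"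
  shows "S = T"
proof (rule set_eqI)
  fix x
  have step: "card (S \<inter> {..<Suc x}) = card (S \<inter> {..<x}) + (if x \<in> S then 1 else 0)" for S :: "nat set"
  proof -
    have "S \<inter> {..<Suc x} = (if x \<in> S then insert x (S \<inter> {..<x}) else S \<inter> {..<x})"
      by (auto simp: less_Suc_eq)
    thus ?thesis by simp
  qed
  show "x \<in> S \<longleftrightarrow> x \<in> T"
  proof (cases "x < N")
    case True
    thus ?thesis using step[of S] step[of T] assms(1)[of x] assms(1)[of "Suc x"] by (auto split: if_splits)
  qed (use assms(2,3) in auto)
qed

text \<open>Only the terms of degree less than \<open>N\<close> of the rows contribute to the values less than \<open>N\<close>.\<close>

lemma semigroup_of_truncate:
  assumes "\<And>i j. i < 4 \<Longrightarrow> j < N \<Longrightarrow> fps_nth (f i) j = fps_nth (g i) j" "n \<le> N"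
  shows "semigroup_of f \<inter> {..<n} \<subseteq> semigroup_of g"
proof
  fix v assume v: "v \<in> semigroup_of f \<inter> {..<n}"
  then obtain k where "v \<in> ords (forms_on f k)" by (auto simp: semigroup_of_def)
  then obtain F where F: "F \<in> forms_on f k" "fps_nth F v \<noteq> 0" "\<And>j. j < v \<Longrightarrow> fps_nth F j = 0"
    by (rule ordsE) blast
  obtain c where c: "F = (\<Sum>w\<in>words k. fps_const (c w) * prod_list (map f w))"
    using span_image_finite[OF finite_words F(1)[unfolded word_span_def]] by blast
  define G where "G = (\<Sum>w\<in>words k. fps_const (c w) * prod_list (map g w))"
  have "fps_nth (prod_list (map f w)) j = fps_nth (prod_list (map g w)) j" if "set w \<subseteq> {..<4}" "j < N" for w j
    using that
  proof (induction w arbitrary: j)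
    case (Cons i w)
    have "fps_nth (f i * prod_list (map f w)) j = fps_nth (g i * prod_list (map g w)) j"
      unfolding fps_mult_nth using Cons assms(1)[of i] by (intro sum.cong) auto
    thus ?case by simp
  qed simp
  hence "fps_nth F j = fps_nth G j" if "j < N" for j
    using that unfolding c G_def fps_sum_nth by (intro sum.cong) (auto simp: words_def)
  moreover have "G \<in> forms_on g k" unfolding G_def word_span_def
    by (intro fpsv.span_sum fpsv.span_scale fpsv.span_base) auto
  ultimately have "v \<in> ords (forms_on g k)" using F v assms(2) by (intro ordsI[of G]) auto
  thus "v \<in> semigroup_of g" by (auto simp: semigroup_of_def)
qed

lemma value_count_truncate:
  assumes "\<And>i j. i < 4 \<Longrightarrow> j < N \<Longrightarrow> fps_nth (coeff_rows a i) j = fps_nth (coeff_rows b i) j" "n \<le> N"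
  shows "value_count a n = value_count b n"
proof -
  have "semigroup_of (coeff_rows a) \<inter> {..<n} = semigroup_of (coeff_rows b) \<inter> {..<n}"
    using semigroup_of_truncate[of N "coeff_rows a" "coeff_rows b" n] semigroup_of_truncate[of N "coeff_rows b" "coeff_rows a" n] assms by auto
  thus ?thesis by (simp add: value_count_def)
qed

text \<open>Triples of power series as families of four rows, the first of which is the constant 1.\<close>

definition triple_coeffs :: "(nat \<times> nat \<Rightarrow> complex) \<Rightarrow> nat \<times> nat \<Rightarrow> complex"
  where "triple_coeffs c = (\<lambda>(i, j). if i = 0 then (if j = 0 then 1 else 0) else if i < 4 then c (i - 1, j) else 0)"

lemma poly_fun_triple_coeffs: "(\<lambda>c. triple_coeffs c i) \<in> poly_fun"
  by (cases i; cases "fst i = 0"; cases "snd i = 0"; cases "fst i < 4")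
    (auto simp: triple_coeffs_def intro: poly_fun.intros)

lemma coeff_rows_triple_coeffs:
  "coeff_rows (triple_coeffs (coeffs_of \<phi>)) 0 = 1"
  "i < 3 \<Longrightarrow> coeff_rows (triple_coeffs (coeffs_of \<phi>)) (Suc i) = \<phi> i"
  by (auto simp: coeff_rows_def triple_coeffs_def coeffs_of_def fps_eq_iff)

lemma triple_coeffs_in:
  assumes "\<phi> \<in> profile_triples m"
  shows "triple_coeffs (coeffs_of \<phi>) \<in> cusp_coeffs m"
proof -
  have z: "fps_nth (\<phi> i) j = 0" if "i < 3" "j < 2 * m + 2 * i" for i j
    using assms that by (auto simp: profile_triples_def intro: nth_less_subdegree_zero)
  have nz: "fps_nth (\<phi> i) (2 * m + 2 * i) \<noteq> 0" if "i < 3" for i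
    using assms that nth_subdegree_nonzero[of "\<phi> i"] by (auto simp: profile_triples_def)
  have "\<forall>i<4. triple_coeffs (coeffs_of \<phi>) (i, pord m i) \<noteq> 0"
    using nz[of 0] nz[of 1] nz[of 2] unfolding all_less_4 pord_simps by (simp add: triple_coeffs_def coeffs_of_def)
  moreover have "triple_coeffs (coeffs_of \<phi>) (i, j) = 0" if "\<not> (i < 4 \<and> pord m i \<le> j)" for i j
    using that z[of "i - 1" j] by (cases "i = 0") (auto simp: triple_coeffs_def coeffs_of_def pord_def)
  ultimately show ?thesis by (auto simp: cusp_coeffs_def pivots_nonzero coord_space_def cusp_index_def)
qed

lemma value_semigroup_cong:
  assumes "\<And>i. i < 3 \<Longrightarrow> \<phi> i = \<psi> i" shows "value_semigroup \<phi> = value_semigroup \<psi>"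
  by (simp add: value_semigroup_def subst3_def assms)

lemma value_semigroup_triple:
  assumes "\<phi> \<in> profile_triples m" "m \<ge> 2"
  shows "value_semigroup \<phi> = semigroup_of (coeff_rows (triple_coeffs (coeffs_of \<phi>)))"
proof -
  let ?f = "coeff_rows (triple_coeffs (coeffs_of \<phi>))"
  have "\<phi> i = ?f (Suc i) / ?f 0 - fps_const (fps_nth (?f (Suc i) / ?f 0) 0)" if "i < 3" for i
  proof -
    have "fps_nth (\<phi> i) 0 = 0" using assms that by (auto simp: profile_triples_def intro: nth_less_subdegree_zero)
    thus ?thesis using that by (simp add: coeff_rows_triple_coeffs)
  qed
  hence "value_semigroup \<phi> =
    value_semigroup (\<lambda>i. ?f (Suc i) / ?f 0 - fps_const (fps_nth (?f (Suc i) / ?f 0) 0))"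
    by (rule value_semigroup_cong)
  also have "\<dots> = semigroup_of ?f"
    by (rule value_semigroup_quotients) (simp add: coeff_rows_triple_coeffs)
  finally show ?thesis .
qed

lemma profile_of_cusp_coeffs:
  assumes "a \<in> cusp_coeffs m" "m \<ge> 2"
  shows "\<exists>\<phi> \<in> profile_triples m. value_semigroup \<phi> = semigroup_of (coeff_rows a)"
proof -
  define \<phi> where "\<phi> = (\<lambda>i. if i < 3 then coeff_rows a (Suc i) / coeff_rows a 0 else 0)"
  interpret cusp_rows m "coeff_rows a" by (rule cusp_coeffs_rows[OF assms])
  have s: "coeff_rows a (Suc i) \<noteq> 0 \<and> subdegree (coeff_rows a (Suc i)) = 2 * m + 2 * i" if "i < 3" for i
    using subdegree_rows[OF assms(1), of "Suc i"] that by (simp add: pord_def)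
  have inv: "inverse (coeff_rows a 0) \<noteq> 0" "subdegree (inverse (coeff_rows a 0)) = 0" using row0 by auto
  have \<phi>: "\<phi> i \<noteq> 0 \<and> subdegree (\<phi> i) = 2 * m + 2 * i" if "i < 3" for i
    using s[OF that] that inv row0 by (simp add: \<phi>_def fps_divide_unit)
  hence "\<phi> \<in> profile_triples m" by (auto simp: profile_triples_def \<phi>_def)
  moreover have "value_semigroup \<phi> =
    value_semigroup (\<lambda>i. coeff_rows a (Suc i) / coeff_rows a 0 - fps_const (fps_nth (coeff_rows a (Suc i) / coeff_rows a 0) 0))"
  proof (rule value_semigroup_cong)
    fix i :: nat assume i: "i < 3"
    have "fps_nth (\<phi> i) 0 = 0" using \<phi>[OF i] assms(2) by (intro nth_less_subdegree_zero) auto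
    thus "\<phi> i = coeff_rows a (Suc i) / coeff_rows a 0 - fps_const (fps_nth (coeff_rows a (Suc i) / coeff_rows a 0) 0)"
      using i by (simp add: \<phi>_def)
  qed
  ultimately show ?thesis using value_semigroup_quotients[where f = "coeff_rows a", OF row0] by auto
qed

text \<open>Two nonempty open subsets of the irreducible set of all triples meet.\<close>

lemma generic_value_semigroup_unique:
  assumes "generic_value_semigroup m S" "generic_value_semigroup m T"
  shows "S = T"
proof -
  obtain p \<phi> where p: "p \<in> poly_fun" "\<phi> \<in> profile_triples m" "p (coeffs_of \<phi>) \<noteq> 0"
    "\<And>\<phi>. \<phi> \<in> profile_triples m \<Longrightarrow> p (coeffs_of \<phi>) \<noteq> 0 \<Longrightarrow> value_semigroup \<phi> = S"
    using assms(1) by (auto simp: generic_value_semigroup_def)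
  obtain q \<psi> where q: "q \<in> poly_fun" "\<psi> \<in> profile_triples m" "q (coeffs_of \<psi>) \<noteq> 0"
    "\<And>\<phi>. \<phi> \<in> profile_triples m \<Longrightarrow> q (coeffs_of \<phi>) \<noteq> 0 \<Longrightarrow> value_semigroup \<phi> = T"
    using assms(2) by (auto simp: generic_value_semigroup_def)
  define I where "I = {(i, j). i < 3 \<and> 2 * m + 2 * i \<le> j}"
  define r where "r = (\<lambda>c :: nat \<times> nat \<Rightarrow> complex. \<Prod>i<3. c (i, 2 * m + 2 * i))"
  have r: "r \<in> poly_fun" unfolding r_def by (intro poly_fun_prod poly_fun.coord)
  have in_I: "coeffs_of \<phi> \<in> coord_space I" "r (coeffs_of \<phi>) \<noteq> 0" if "\<phi> \<in> profile_triples m" for \<phi>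
  proof -
    have *: "\<phi> i \<noteq> 0" "subdegree (\<phi> i) = 2 * m + 2 * i" if "i < 3" for i
      using \<open>\<phi> \<in> profile_triples m\<close> that by (auto simp: profile_triples_def)
    have **: "\<phi> i = 0" if "i \<ge> 3" for i using \<open>\<phi> \<in> profile_triples m\<close> that by (auto simp: profile_triples_def)
    have "coeffs_of \<phi> (i, j) = 0" if "(i, j) \<notin> I" for i j
    proof (cases "i < 3")
      case True
      hence "j < 2 * m + 2 * i" using that unfolding I_def mem_Collect_eq prod.case by linarith
      hence "j < subdegree (\<phi> i)" unfolding *(2)[OF True] .
      thus ?thesis unfolding coeffs_of_def prod.case by (rule nth_less_subdegree_zero)
    qed (simp add: coeffs_of_def **)
    thus "coeffs_of \<phi> \<in> coord_space I" by (auto simp: coord_space_def)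
    have "fps_nth (\<phi> i) (2 * m + 2 * i) \<noteq> 0" if "i < 3" for i
      using nth_subdegree_nonzero[OF *(1)[OF that]] unfolding *(2)[OF that] .
    thus "r (coeffs_of \<phi>) \<noteq> 0" by (simp add: r_def coeffs_of_def)
  qed
  have "\<exists>c\<in>coord_space I. \<forall>f\<in>{p, q, r}. f c \<noteq> 0"
    using p(1,3) q(1,3) r in_I[OF p(2)] in_I[OF q(2)]
    by (intro coord_space_irreducible_finite[of _ I "\<lambda>f. f"]) auto
  then obtain c where c: "c \<in> coord_space I" "p c \<noteq> 0" "q c \<noteq> 0" "r c \<noteq> 0" by auto
  define \<omega> where "\<omega> = (\<lambda>i. Abs_fps (\<lambda>j. c (i, j)))"
  have "coeffs_of \<omega> = c" by (auto simp: coeffs_of_def \<omega>_def)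
  moreover have "\<omega> \<in> profile_triples m"
  proof -
    have "\<omega> i \<noteq> 0 \<and> subdegree (\<omega> i) = 2 * m + 2 * i" if i: "i < 3" for i
    proof
      have n: "fps_nth (\<omega> i) (2 * m + 2 * i) \<noteq> 0" using c(4) i by (auto simp: r_def \<omega>_def)
      thus "\<omega> i \<noteq> 0" by auto
      show "subdegree (\<omega> i) = 2 * m + 2 * i"
        by (rule subdegreeI[OF n]) (use c(1) in \<open>auto simp: \<omega>_def coord_space_def I_def\<close>)
    qed
    moreover have "\<omega> i = 0" if "i \<ge> 3" for i
      using c(1) that by (auto simp: \<omega>_def coord_space_def I_def fps_eq_iff)
    ultimately show ?thesis by (auto simp: profile_triples_def)
  qed
  ultimately show ?thesis using p(4)[of \<omega>] q(4)[of \<omega>] c by simp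
qed

text \<open>Let \<open>a0\<close> have as many values below \<open>n\<close> as possible, for all \<open>n \<le> N\<close>.  Then it has at most as many gaps as the
  model curve, which bounds its conductor; if \<open>N\<close> is large, the numbers of values below \<open>n \<le> N\<close> determine the
  semigroup.  By semicontinuity they are the same for a general triple, and also for a general curve
  of large degree, because \<open>a0\<close> can be truncated.\<close>

theorem S_gen_generic:
  assumes "m \<ge> 2"
  shows "\<exists>N. finite (UNIV - S_gen m) \<and> (\<forall>d\<ge>N. \<exists>p \<in> poly_fun. (\<exists>a \<in> cusp_coeffs m \<inter> coord_space (param_index d). p a \<noteq> 0) \<and>
    (\<forall>a \<in> cusp_coeffs m. p a \<noteq> 0 \<longrightarrow> semigroup_of (coeff_rows a) = S_gen m))"
proof -
  interpret M: model m "2 * m + 6" "odd_exponent (2 * m + 6)" "model_curve m (2 * m + 6)"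
    by unfold_locales (use assms in auto)
  obtain L0 where L0: "{L0..} \<subseteq> semigroup_of (model_curve m (2 * m + 6))" using M.model_semigroup by blast
  define L where "L = Suc L0"
  \<comment> \<open>At most \<open>L\<close> gaps lie below \<open>N\<close>, so all numbers from \<open>2 L\<close> to \<open>4 L\<close> are values;
    adding \<open>2 L\<close> to them repeatedly gives everything beyond.\<close>
  define N where "N = 4 * L + 1"
  obtain a0 where a0: "a0 \<in> cusp_coeffs m" "\<And>n a. n \<le> N \<Longrightarrow> a \<in> cusp_coeffs m \<Longrightarrow> value_count a n \<le> value_count a0 n"
    using max_value_count_exists[OF assms, of N] by blast
  define S where "S = semigroup_of (coeff_rows a0)"
  have "N - L \<le> card {L..<N}" by simp
  also have "\<dots> \<le> value_count (model_coeffs m (2 * m + 6)) N"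
    unfolding value_count_def coeff_rows_model_coeffs using L0 by (intro card_mono) (auto simp: L_def)
  also have "\<dots> \<le> value_count a0 N" using model_coeffs_in assms by (intro a0(2)) auto
  finally have big: "N - L \<le> value_count a0 N" .
  have cond: "{N..} \<subseteq> semigroup_of (coeff_rows a)" if "N - L \<le> value_count a N" for a
  proof -
    have "{2 * L..} \<subseteq> semigroup_of (coeff_rows a)"
      using that semigroup_of_add by (intro few_gaps_imp_conductor) (auto simp: value_count_def N_def L_def)
    thus ?thesis by (auto simp: N_def)
  qed
  have det: "semigroup_of (coeff_rows a) = S" if "a \<in> cusp_coeffs m" "\<And>n. n \<le> N \<Longrightarrow> value_count a0 n \<le> value_count a n" for a
  proof -
    have "value_count a n = value_count a0 n" if "n \<le> N" for n
      using a0(2)[OF that] \<open>a \<in> cusp_coeffs m\<close> \<open>\<And>n. n \<le> N \<Longrightarrow> value_count a0 n \<le> value_count a n\<close>[OF that] by (simp add: le_antisym)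
    thus ?thesis unfolding S_def using cond[of a] cond[of a0] big
      by (intro sets_eq_of_counts[of N]) (auto simp: value_count_def)
  qed
  have gen: "generic_value_semigroup m S"
  proof -
    obtain \<phi>0 where \<phi>0: "\<phi>0 \<in> profile_triples m" "value_semigroup \<phi>0 = S"
      using profile_of_cusp_coeffs[OF a0(1) assms] by (auto simp: S_def)
    define b where "b = triple_coeffs (coeffs_of \<phi>0)"
    have rb: "value_count b n = value_count a0 n" for n
      using value_semigroup_triple[OF \<phi>0(1) assms] \<phi>0(2) by (simp add: value_count_def b_def S_def)
    have "fps_nth (coeff_rows b 0) 0 \<noteq> 0" by (simp add: b_def coeff_rows_triple_coeffs)
    then obtain p where p: "p \<in> poly_fun" "p b \<noteq> 0" "\<And>a n. p a \<noteq> 0 \<Longrightarrow> n \<le> N \<Longrightarrow> value_count b n \<le> value_count a n"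
      using value_counts_semicontinuous[of b N] by blast
    show ?thesis unfolding generic_value_semigroup_def
    proof (intro bexI[of _ "\<lambda>c. p (triple_coeffs c)"] conjI ballI impI)
      show "(\<lambda>c. p (triple_coeffs c)) \<in> poly_fun" by (rule poly_fun_subst[OF p(1) poly_fun_triple_coeffs])
      show "\<exists>\<phi>\<in>profile_triples m. p (triple_coeffs (coeffs_of \<phi>)) \<noteq> 0" using \<phi>0 p(2) by (auto simp: b_def)
      fix \<phi> assume \<phi>: "\<phi> \<in> profile_triples m" "p (triple_coeffs (coeffs_of \<phi>)) \<noteq> 0"
      show "value_semigroup \<phi> = S" unfolding value_semigroup_triple[OF \<phi>(1) assms]
        by (rule det[OF triple_coeffs_in[OF \<phi>(1)]]) (use p(3)[OF \<phi>(2)] rb in auto)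
    qed
  qed
  have SG: "S_gen m = S" unfolding S_gen_def
    by (rule the_equality[where P = "generic_value_semigroup m", OF gen]) (rule generic_value_semigroup_unique[OF _ gen])
  have "UNIV - S \<subseteq> {..<N}" using cond[OF big] by (auto simp: S_def not_less[symmetric])
  hence fin: "finite (UNIV - S_gen m)" unfolding SG by (rule finite_subset) auto
  have "\<exists>p \<in> poly_fun. (\<exists>a \<in> cusp_coeffs m \<inter> coord_space (param_index d). p a \<noteq> 0) \<and>
    (\<forall>a \<in> cusp_coeffs m. p a \<noteq> 0 \<longrightarrow> semigroup_of (coeff_rows a) = S_gen m)" if d: "d \<ge> N + 2 * m + 4" for d
  proof -
    define b where "b = (\<lambda>(i, j). if j \<le> d then a0 (i, j) else 0)"
    have b1: "b \<in> cusp_coeffs m"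
    proof -
      have "pord m i \<le> d" if "i < 4" for i using d that by (auto simp: pord_def)
      thus ?thesis using a0(1) by (auto simp: cusp_coeffs_def coord_space_def b_def pivots_nonzero)
    qed
    have b2: "b \<in> coord_space (param_index d)"
      using a0(1) by (auto simp: cusp_coeffs_def coord_space_def b_def param_index_def cusp_index_def)
    have rb: "value_count b n = value_count a0 n" if "n \<le> N" for n
      by (rule value_count_truncate[of N]) (use d that in \<open>auto simp: coeff_rows_def b_def\<close>)
    obtain p where p: "p \<in> poly_fun" "p b \<noteq> 0" "\<And>a n. p a \<noteq> 0 \<Longrightarrow> n \<le> N \<Longrightarrow> value_count b n \<le> value_count a n"
      using value_counts_semicontinuous[OF cusp_rows.row0[OF cusp_coeffs_rows[OF b1 assms]], of N] by blast
    have "semigroup_of (coeff_rows a) = S_gen m" if "a \<in> cusp_coeffs m" "p a \<noteq> 0" for a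
      unfolding SG by (rule det[OF that(1)]) (use p(3)[OF that(2)] rb in auto)
    thus ?thesis using p(1,2) b1 b2 by blast
  qed
  thus ?thesis using fin by blast
qed

text \<open>At most 35 of the numbers below \<open>10 m\<close> are values.\<close>

lemma S_gen_gaps:
  assumes "m \<ge> 2" shows "card (UNIV - S_gen m) \<ge> 10 * m - 35"
proof -
  obtain N where N: "finite (UNIV - S_gen m)" "\<And>d. d \<ge> N \<Longrightarrow> \<exists>p \<in> poly_fun. (\<exists>a \<in> cusp_coeffs m \<inter> coord_space (param_index d). p a \<noteq> 0) \<and>
    (\<forall>a \<in> cusp_coeffs m. p a \<noteq> 0 \<longrightarrow> semigroup_of (coeff_rows a) = S_gen m)"
    using S_gen_generic[OF assms] by blast
  have "\<exists>a \<in> cusp_coeffs m. semigroup_of (coeff_rows a) = S_gen m"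
    using N(2)[OF order_refl]
  proof (elim bexE conjE)
    fix p a
    assume "a \<in> cusp_coeffs m \<inter> coord_space (param_index N)" "p a \<noteq> 0"
      "\<forall>a \<in> cusp_coeffs m. p a \<noteq> 0 \<longrightarrow> semigroup_of (coeff_rows a) = S_gen m"
    thus ?thesis by (intro bexI[of _ a]) simp_all
  qed
  then obtain a where a: "a \<in> cusp_coeffs m" "semigroup_of (coeff_rows a) = S_gen m" ..
  interpret cusp_rows m "coeff_rows a" by (rule cusp_coeffs_rows[OF a(1) assms])
  have "fps_X ^ (2 * m) dvd coeff_rows a (Suc i)" if "i < 3" for i
  proof -
    have 2: "fps_X ^ (2 * m) dvd coeff_rows a 2" by (rule power_le_dvd[OF dvd_rows(2)]) simp
    have 3: "fps_X ^ (2 * m) dvd coeff_rows a 3" by (rule power_le_dvd[OF dvd_rows(3)]) simp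
    have "Suc i = 1 \<or> Suc i = 2 \<or> Suc i = 3" using that by auto
    thus ?thesis using dvd_rows(1) 2 3 by metis
  qed
  hence "card (S_gen m \<inter> {..<5 * (2 * m)}) \<le> 35"
    using semigroup_of_sparse[where f = "coeff_rows a" and k = "2 * m", OF row0] a(2) by simp
  hence le: "10 * m - 35 \<le> card {..<10 * m} - card (S_gen m \<inter> {..<10 * m})" by simp
  also have "\<dots> = card ({..<10 * m} - S_gen m)" by (simp add: card_Diff_subset_Int Int_commute)
  also have "\<dots> \<le> card (UNIV - S_gen m)" by (intro card_mono N(1)) auto
  finally show ?thesis .
qed

section \<open>Monomials on a generic curve\<close>

text \<open>From order \<open>c\<close> on, there is no condition on the restrictions of forms of degree \<open>n\<close>.\<close>

definition many_monomials :: "nat \<Rightarrow> nat \<Rightarrow> (nat \<Rightarrow> complex fps) \<Rightarrow> nat \<Rightarrow> bool"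
  where "many_monomials d c f n \<longleftrightarrow> (\<forall>v. c \<le> v \<and> v \<le> n * d \<longrightarrow> fps_X ^ v \<in> forms_on f n)"

text \<open>Products of monomials give the exponents from \<open>2 c\<close> on.  For smaller \<open>v\<close>, multiplying \<open>t\<^sup>v\<close> by a power of the
  unit \<open>f 0\<close> still gives an element of order \<open>v\<close>, which can be reduced by the larger monomials.\<close>

lemma many_monomials_add:
  assumes "fps_nth (f 0) 0 \<noteq> 0" "\<And>i. i < 4 \<Longrightarrow> deg_le d (f i)"
    "many_monomials d c f n" "many_monomials d c f l" "2 * c \<le> n * d" "2 * c \<le> l * d"
  shows "many_monomials d c f (n + l)"
  unfolding many_monomials_def
proof (intro allI impI)
  fix v assume v: "c \<le> v \<and> v \<le> (n + l) * d"
  have high: "fps_X ^ v \<in> forms_on f (n + l)" if "2 * c \<le> v" "v \<le> (n + l) * d" "c \<le> l * d" for v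
  proof -
    define u where "u = (if v \<le> n * d + c then v - c else n * d)"
    have u: "c \<le> u" "u \<le> n * d" "c \<le> v - u" "v - u \<le> l * d" "u \<le> v"
      using that assms(5) by (auto simp: u_def add_mult_distrib)
    have "fps_X ^ u * fps_X ^ (v - u) \<in> forms_on f (n + l)"
      using assms(3,4) u by (intro forms_on_mult) (auto simp: many_monomials_def)
    thus ?thesis using u by (simp add: power_add[symmetric])
  qed
  have low: "v \<in> ords (forms_on f (n + l))" if "c \<le> v" "v \<le> n * d" for v
  proof -
    have "f 0 ^ l * fps_X ^ v \<in> forms_on f (l + n)"
      using assms(3) that by (intro forms_on_mult row_power_in_forms_on) (auto simp: many_monomials_def)
    moreover have "f 0 ^ l * fps_X ^ v \<noteq> 0" "subdegree (f 0 ^ l * fps_X ^ v) = v"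
      using assms(1) fps_unit_mult_ord[of "f 0" "fps_X ^ v" l] by auto
    ultimately show ?thesis unfolding ords_def
      by (intro image_eqI[of _ _ "f 0 ^ l * fps_X ^ v"]) (auto simp: add.commute)
  qed
  show "fps_X ^ v \<in> forms_on f (n + l)"
  proof (rule monomials_of_ords[OF subspace_word_span])
    show "deg_le ((n + l) * d) F" if "F \<in> forms_on f (n + l)" for F
      using deg_le_word_span[OF assms(2) _ that] by simp
    show "{c..(n + l) * d} \<subseteq> ords (forms_on f (n + l))"
    proof
      fix u assume u: "u \<in> {c..(n + l) * d}"
      show "u \<in> ords (forms_on f (n + l))"
      proof (cases "2 * c \<le> u")
        case True
        show ?thesis by (rule ordsI[OF high]) (use True u assms(6) in \<open>auto simp: fps_X_power_nth\<close>)
      qed (use low u assms(5) in auto)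
    qed
  qed (use v in auto)
qed

lemma many_monomials_multiple:
  assumes "fps_nth (f 0) 0 \<noteq> 0" "\<And>i. i < 4 \<Longrightarrow> deg_le d (f i)" "many_monomials d c f n" "2 * c \<le> n * d" "k \<ge> 1"
  shows "many_monomials d c f (k * n)"
  using assms(5)
proof (induction k rule: dec_induct)
  case (step k)
  have "2 * c \<le> (k * n) * d" using assms(4) step.hyps by (metis mult.assoc mult_le_mono1 nat_mult_1 le_trans)
  from many_monomials_add[OF assms(1-3) step.IH assms(4) this] show ?case by (simp add: add.commute)
qed (use assms in simp)

text \<open>Two consecutive degrees generate all large degrees.\<close>

lemma many_monomials_eventually:
  assumes "fps_nth (f 0) 0 \<noteq> 0" "\<And>i. i < 4 \<Longrightarrow> deg_le d (f i)"
    "many_monomials d c f t" "many_monomials d c f (t + 1)" "2 * c \<le> t * d" "t \<ge> 1" "n \<ge> t * t"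
  shows "many_monomials d c f n"
proof -
  \<comment> \<open>Write \<open>n\<close> as \<open>a t + b (t + 1)\<close>.\<close>
  define b where "b = n mod t"
  define a where "a = n div t - b"
  have "b < t" using assms(6) by (simp add: b_def)
  moreover have "t \<le> n div t" using assms(6,7) by (simp add: less_eq_div_iff_mult_less_eq)
  ultimately have "n div t = a + b" "a \<ge> 1" by (auto simp: a_def)
  hence n: "n = a * t + b * (t + 1)" using div_mult_mod_eq[of n t] unfolding b_def[symmetric]
    by (simp add: algebra_simps)
  have A: "many_monomials d c f (a * t)" by (rule many_monomials_multiple) (use assms \<open>a \<ge> 1\<close> in auto)
  show ?thesis
  proof (cases "b = 0")
    case False
    have B: "many_monomials d c f (b * (t + 1))" by (rule many_monomials_multiple) (use assms False in auto)
    have le: "t \<le> a * t" "t \<le> b * (t + 1)" using \<open>a \<ge> 1\<close> False by (cases a; cases b; simp)+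
    show ?thesis unfolding n
      by (rule many_monomials_add[OF assms(1,2) A B])
        (use assms(5) mult_le_mono1[OF le(1), of d] mult_le_mono1[OF le(2), of d] in linarith)+
  qed (use A n in simp)
qed

text \<open>The model curve has the largest possible space \<open>cusp_forms\<close>; by semicontinuity this holds for a general curve,
  in two consecutive degrees and therefore in all large degrees.\<close>

theorem generic_many_monomials:
  assumes "m \<ge> 2" "d \<ge> 2 * m + 6"
  shows "\<exists>c T. \<exists>p \<in> poly_fun. (\<exists>a \<in> cusp_coeffs m \<inter> coord_space (param_index d). p a \<noteq> 0) \<and>
    (\<forall>a \<in> cusp_coeffs m \<inter> coord_space (param_index d). p a \<noteq> 0 \<longrightarrow> (\<forall>n\<ge>T. many_monomials d c (coeff_rows a) n))"
proof -
  interpret M: model m d "odd_exponent d" "model_curve m d" by unfold_locales (use assms in auto)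
  obtain e N where e: "e \<ge> 1" and N: "\<And>n. n \<ge> N \<Longrightarrow>
    {2 * m * e, 2 * m * e + 2} \<union> {2 * m * e + 4..(e + n) * d} \<subseteq> ords (cusp_forms (model_curve m d) e n)"
    using M.model_ords by blast
  define c where "c = 2 * m * e + 4"
  define X where "X = (\<lambda>n. {2 * m * e, 2 * m * e + 2} \<union> {2 * m * e + 4..(e + n) * d})"
  let ?b = "model_coeffs m d"
  have gen: "\<exists>p\<in>poly_fun. p ?b \<noteq> 0 \<and> (\<forall>a \<in> cusp_coeffs m \<inter> coord_space (param_index d). p a \<noteq> 0 \<longrightarrow>
      many_monomials d c (coeff_rows a) (e + n))" if n: "n \<ge> N" for n
  proof -
    have fin: "finite {u @ w | u w. u \<in> cusp_words e \<and> w \<in> words n}"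
      using finite_subset[OF cusp_words_subset finite_words] .
    obtain p where p: "p \<in> poly_fun" "p ?b \<noteq> 0" "\<And>a. p a \<noteq> 0 \<Longrightarrow>
      card (ords (cusp_forms (coeff_rows ?b) e n) \<inter> {..<(e + n) * d + 1}) \<le>
      card (ords (cusp_forms (coeff_rows a) e n) \<inter> {..<(e + n) * d + 1})"
      using ords_semicontinuous[where f = coeff_rows, OF poly_fun_coeff_rows fin, of ?b "(e + n) * d + 1"]
      unfolding cusp_forms_def by blast
    have "2 * m * e + 2 < (e + n) * d + 1"
    proof -
      have "e * (2 * m + 6) \<le> e * d" using assms(2) by simp
      thus ?thesis using e by (simp add: algebra_simps)
    qed
    hence "X n \<subseteq> ords (cusp_forms (coeff_rows ?b) e n) \<inter> {..<(e + n) * d + 1}"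
      using N[OF n] unfolding coeff_rows_model_coeffs X_def by auto
    hence card: "card (X n) \<le> card (ords (cusp_forms (coeff_rows ?b) e n) \<inter> {..<(e + n) * d + 1})"
      by (intro card_mono) auto
    have "many_monomials d c (coeff_rows a) (e + n)" if a: "a \<in> cusp_coeffs m \<inter> coord_space (param_index d)" "p a \<noteq> 0" for a
    proof -
      interpret cusp_rows m "coeff_rows a" by (rule cusp_coeffs_rows) (use a assms in auto)
      have deg: "deg_le d (coeff_rows a i)" for i
        using a(1) by (auto simp: deg_le_def coeff_rows_def coord_space_def param_index_def)
      show ?thesis unfolding many_monomials_def c_def
        using monomials_in_cusp_forms[OF deg le_trans[OF card[unfolded X_def] p(3)[OF a(2)]]] by blast
    qed
    thus ?thesis using p(1,2) by blast
  qed
  \<comment> \<open>The summand \<open>2 c\<close> ensures that the interval of exponents is long enough for \<open>many_monomials_add\<close>.\<close>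
  define n where "n = N + 2 * c"
  obtain p where p: "p\<in>poly_fun" "p ?b \<noteq> 0" "\<And>a. a \<in> cusp_coeffs m \<inter> coord_space (param_index d) \<Longrightarrow> p a \<noteq> 0 \<Longrightarrow>
      many_monomials d c (coeff_rows a) (e + n)" using gen[of n] by (auto simp: n_def)
  obtain q where q: "q\<in>poly_fun" "q ?b \<noteq> 0" "\<And>a. a \<in> cusp_coeffs m \<inter> coord_space (param_index d) \<Longrightarrow> q a \<noteq> 0 \<Longrightarrow>
      many_monomials d c (coeff_rows a) (e + (n + 1))" using gen[of "n + 1"] by (auto simp: n_def)
  have "many_monomials d c (coeff_rows a) k"
    if a: "a \<in> cusp_coeffs m \<inter> coord_space (param_index d)" "p a * q a \<noteq> 0" and k: "k \<ge> (e + n) * (e + n)" for a k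
  proof (rule many_monomials_eventually[OF _ _ _ _ _ _ k])
    show "fps_nth (coeff_rows a 0) 0 \<noteq> 0" using cusp_rows.row0[OF cusp_coeffs_rows] a assms by blast
    show "deg_le d (coeff_rows a i)" for i
      using a(1) by (auto simp: deg_le_def coeff_rows_def coord_space_def param_index_def)
    show "many_monomials d c (coeff_rows a) (e + n)" using p(3)[OF a(1)] a(2) by simp
    show "many_monomials d c (coeff_rows a) (e + n + 1)" using q(3)[OF a(1)] a(2) by simp
    have "2 * c \<le> e + n" by (simp add: n_def)
    also have "\<dots> \<le> (e + n) * d" using assms(2) by simp
    finally show "2 * c \<le> (e + n) * d" .
  qed (use e in simp)
  moreover have "?b \<in> cusp_coeffs m \<inter> coord_space (param_index d)" using model_coeffs_in[OF assms] by blast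
  ultimately show ?thesis using p(1,2) q(1,2)
    by (intro exI[of _ c] exI[of _ "(e + n) * (e + n)"] bexI[of _ "\<lambda>a. p a * q a"] poly_fun.mult) auto
qed

section \<open>Binary forms\<close>

text \<open>The value at \<open>x\<close> of the binary form of degree \<open>D\<close> whose dehomogenization is \<open>F\<close>.\<close>

definition bin_eval :: "nat \<Rightarrow> complex fps \<Rightarrow> (nat \<Rightarrow> complex) \<Rightarrow> complex"
  where "bin_eval D F x = (\<Sum>j\<le>D. fps_nth F j * x 0 ^ (D - j) * x 1 ^ j)"

definition vec2 :: "complex \<Rightarrow> complex \<Rightarrow> nat \<Rightarrow> complex"
  where "vec2 s t = (\<lambda>i. if i = 0 then s else if i = 1 then t else 0)"

lemma vec2_simps [simp]: "vec2 s t 0 = s" "vec2 s t 1 = t" "vec2 s t (Suc 0) = t" "vec2 s t \<in> coord_space {..<2}"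
  by (auto simp: vec2_def coord_space_def)

lemma vec2_nonzero: "vec2 s t \<noteq> 0 \<longleftrightarrow> s \<noteq> 0 \<or> t \<noteq> 0"
  by (auto simp: vec2_def fun_eq_iff)

lemma vec2_eta: "x \<in> coord_space {..<2} \<Longrightarrow> vec2 (x 0) (x 1) = x"
  by (auto simp: vec2_def coord_space_def fun_eq_iff)

lemma bin_eval_mult:
  assumes "deg_le D F" "deg_le E G"
  shows "bin_eval (D + E) (F * G) x = bin_eval D F x * bin_eval E G x"
proof (cases "x 0 = 0")
  case True
  have *: "bin_eval D F x = fps_nth F D * x 1 ^ D" for D F
  proof -
    have "bin_eval D F x = (\<Sum>j\<le>D. if j = D then fps_nth F D * x 1 ^ D else 0)"
      unfolding bin_eval_def using True by (intro sum.cong) (auto simp: power_0_left)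
    thus ?thesis by simp
  qed
  show ?thesis unfolding * deg_le_mult(2)[OF assms] by (simp add: power_add)
next
  case False
  define P where "P = (\<lambda>F D. \<Sum>j\<le>D. monom (fps_nth F j :: complex) j)"
  have coeff: "coeff (P F D) j = fps_nth F j" if "deg_le D F" for F D j
    using that by (auto simp: P_def coeff_sum deg_le_def)
  have "P (F * G) (D + E) = P F D * P G E"
    by (rule poly_eqI) (simp add: coeff coeff_mult fps_mult_nth assms deg_le_mult(1) atLeast0AtMost)
  moreover have "bin_eval D F x = x 0 ^ D * poly (P F D) (x 1 / x 0)" for F D
    unfolding bin_eval_def P_def poly_sum poly_monom sum_distrib_left
    using False by (intro sum.cong) (auto simp: power_divide power_diff)
  ultimately show ?thesis by (simp add: power_add)
qed

lemma bin_eval_X_power: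
  assumes "v \<le> D" shows "bin_eval D (fps_X ^ v) x = x 0 ^ (D - v) * x 1 ^ v"
proof -
  have "bin_eval D (fps_X ^ v) x = (\<Sum>j\<le>D. if j = v then x 0 ^ (D - v) * x 1 ^ v else 0)"
    unfolding bin_eval_def by (intro sum.cong) (auto simp: fps_X_power_nth)
  thus ?thesis using assms by simp
qed

lemma bin_eval_sum:
  "bin_eval D (\<Sum>w\<in>T. fps_const (c w) * F w) x = (\<Sum>w\<in>T. c w * bin_eval D (F w) x)"
  unfolding bin_eval_def fps_sum_nth sum_distrib_left sum_distrib_right
  by (subst sum.swap) (simp add: mult_ac)

lemma bin_eval_eq_0_imp:
  assumes "deg_le D F" "\<And>t. bin_eval D F (vec2 1 t) = 0"
  shows "F = 0"
proof -
  define P where "P = (\<Sum>j\<le>D. monom (fps_nth F j) j)"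
  have "poly P t = 0" for t using assms(2)[of t] by (simp add: P_def poly_sum poly_monom bin_eval_def)
  hence "P = 0" using poly_all_0_iff_0 by blast
  hence *: "coeff P j = 0" for j by simp
  have "fps_nth F j = 0" if "j \<le> D" for j using *[of j] that by (simp add: P_def coeff_sum)
  thus ?thesis using assms(1) by (metis deg_leD fps_ext fps_zero_nth not_less)
qed

lemma fps_const_of_sum: "fps_const (\<Sum>w\<in>A. c w :: complex) = (\<Sum>w\<in>A. fps_const (c w))"
  by (induction A rule: infinite_finite_induct) (auto simp: fps_const_add[symmetric] simp del: fps_const_add)

lemma sum_fun_apply: "(\<Sum>i\<in>I. F i) a = (\<Sum>i\<in>I. F i a :: complex)"
  by (induction I rule: infinite_finite_induct) (auto simp: zero_fun_def)

text \<open>A basis given as a family, so that injectivity need not be checked separately.\<close>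

lemma cfun_dim_family:
  fixes e :: "'k \<Rightarrow> 'i \<Rightarrow> complex"
  assumes "finite I" "\<And>i. i \<in> I \<Longrightarrow> e i \<in> V" "V \<subseteq> cfun.span (e ` I)"
    "\<And>x i. (\<And>a. (\<Sum>i\<in>I. x i * e i a) = 0) \<Longrightarrow> i \<in> I \<Longrightarrow> x i = (0 :: complex)"
  shows "cfun.dim V = card I"
proof -
  have inj: "inj_on e I"
  proof (rule inj_onI, rule ccontr)
    fix i j assume ij: "i \<in> I" "j \<in> I" "e i = e j" "i \<noteq> j"
    have "(\<Sum>k\<in>I. (if k = i then 1 else if k = j then -1 else 0) * e k a) = 0" for a
    proof -
      have "(\<Sum>k\<in>I. (if k = i then 1 else if k = j then -1 else 0) * e k a) =
        (\<Sum>k\<in>I. (if k = i then e i a else 0) + (if k = j then - e j a else 0))"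
        using ij by (intro sum.cong) auto
      also have "\<dots> = e i a - e j a" using ij assms(1) by (simp add: sum.distrib)
      finally show ?thesis using ij by simp
    qed
    from assms(4)[of "\<lambda>k. if k = i then 1 else if k = j then -1 else 0", OF this ij(1)] show False by simp
  qed
  show ?thesis
  proof (rule cfun.dim_unique)
    show "e ` I \<subseteq> V" using assms(2) by auto
    show "V \<subseteq> cfun.span (e ` I)" by fact
    show "card (e ` I) = card I" using inj by (rule card_image)
    show "cfun.independent (e ` I)"
    proof
      assume "cfun.dependent (e ` I)"
      then obtain u where u: "\<exists>v\<in>e ` I. u v \<noteq> 0" "(\<Sum>v\<in>e ` I. smul (u v) v) = 0"
        using assms(1) by (subst (asm) cfun.dependent_finite) auto
      have "(\<Sum>i\<in>I. u (e i) * e i a) = (\<Sum>v\<in>e ` I. smul (u v) v) a" for a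
        by (simp add: sum.reindex[OF inj] smul_def sum_fun_apply)
      hence "(\<Sum>i\<in>I. u (e i) * e i a) = 0" for a using u(2) by simp
      from assms(4)[of "\<lambda>i. u (e i)", OF this] u(1) show False by auto
    qed
  qed
qed

text \<open>Subtract multiples of the chosen elements to raise the order, which is at most \<open>D\<close>.\<close>

lemma span_of_ords:
  assumes "fpsv.subspace U" "\<And>F. F \<in> U \<Longrightarrow> deg_le D F"
    "\<And>v. v \<in> ords U \<Longrightarrow> B v \<in> U \<and> fps_nth (B v) v \<noteq> 0 \<and> (\<forall>j<v. fps_nth (B v) j = 0)" "F \<in> U"
  shows "F \<in> fpsv.span (B ` ords U)"
  using assms(4)
proof (induction "Suc D - subdegree F" arbitrary: F rule: less_induct)
  case less
  show ?case
  proof (cases "F = 0")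
    case True
    thus ?thesis using fpsv.span_zero by simp
  next
    case False
    define v where "v = subdegree F"
    have v: "v \<in> ords U" using less.prems False by (auto simp: ords_def v_def)
    note B = assms(3)[OF v]
    have Fv: "fps_nth F v \<noteq> 0" using False by (simp add: v_def)
    have vD: "v \<le> D" using Fv assms(2)[OF less.prems] deg_leD not_less by blast
    define c where "c = fps_nth F v / fps_nth (B v) v"
    define G where "G = F - fps_const c * B v"
    have G: "G \<in> U" unfolding G_def using B less.prems
      by (intro fpsv.subspace_diff[OF assms(1)] fpsv.subspace_scale[OF assms(1)]) auto
    have Gj: "fps_nth G j = 0" if "j \<le> v" for j
      using that B nth_less_subdegree_zero[of j F] by (cases "j = v") (auto simp: G_def c_def v_def)
    have "G \<in> fpsv.span (B ` ords U)"
    proof (cases "G = 0")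
      case True
      thus ?thesis using fpsv.span_zero by simp
    next
      case False
      have "v < subdegree G" using Gj False by (metis leI nth_subdegree_nonzero)
      thus ?thesis using vD G by (intro less.hyps) (auto simp: v_def)
    qed
    moreover have "B v \<in> fpsv.span (B ` ords U)" using v by (intro fpsv.span_base) auto
    ultimately have "G + fps_const c * B v \<in> fpsv.span (B ` ords U)"
      by (intro fpsv.span_add fpsv.span_scale)
    thus ?thesis by (simp add: G_def)
  qed
qed

section \<open>Rational curves with one cusp\<close>

text \<open>The rows of \<open>h\<close> vanish at the point \<open>t = 0\<close> to the orders \<open>0, 2 m, 2 m + 2, 2 m + 4\<close>; the curve \<open>f\<close>
  arises from \<open>h\<close> by a unipotent change of coordinates.\<close>

locale cuspidal_curve =
  fixes m d c T :: nat and f h :: "nat \<times> nat \<Rightarrow> complex" and b :: "nat \<Rightarrow> nat \<Rightarrow> complex"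
  assumes m: "m \<ge> 3" and d: "d \<ge> 1"
    and f_coord: "f \<in> coord_space (param_index d)"
    and h_coord: "h \<in> coord_space (param_index d)" and h_cusp: "h \<in> cusp_coeffs m"
    and rows_f: "\<And>i. i < 4 \<Longrightarrow> coeff_rows f i = coeff_rows h i + (\<Sum>l<i. fps_const (b i l) * coeff_rows h l)"
    and monomials: "\<And>n. n \<ge> T \<Longrightarrow> many_monomials d c (coeff_rows h) n"
begin

abbreviation "ff \<equiv> coeff_rows f"
abbreviation "hh \<equiv> coeff_rows h"

sublocale cusp_rows m hh
  using h_cusp m by (intro cusp_coeffs_rows) auto

lemma rows_explicit:
  "ff 0 = hh 0" "ff 1 = hh 1 + fps_const (b 1 0) * hh 0"
  "ff 2 = hh 2 + (fps_const (b 2 0) * hh 0 + fps_const (b 2 1) * hh 1)"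
  "ff 3 = hh 3 + (fps_const (b 3 0) * hh 0 + fps_const (b 3 1) * hh 1 + fps_const (b 3 2) * hh 2)"
  using rows_f[of 0] rows_f[of 1] rows_f[of 2] rows_f[of 3]
  by (simp_all add: numeral_eq_Suc)

lemma deg_le_ff: "deg_le d (ff i)" and deg_le_hh: "deg_le d (hh i)"
  using f_coord h_coord by (auto simp: deg_le_def coeff_rows_def coord_space_def param_index_def)

lemma forms_on_eq: "forms_on ff k = forms_on hh k"
proof
  have lin: "F \<in> forms_on g 1 \<Longrightarrow> fps_const c * F \<in> forms_on g 1" for F c g
    by (rule fpsv.subspace_scale[OF subspace_word_span])
  have add: "F \<in> forms_on g 1 \<Longrightarrow> G \<in> forms_on g 1 \<Longrightarrow> F + G \<in> forms_on g 1" for F G g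
    by (rule fpsv.subspace_add[OF subspace_word_span])
  have diff: "F \<in> forms_on g 1 \<Longrightarrow> G \<in> forms_on g 1 \<Longrightarrow> F - G \<in> forms_on g 1" for F G g
    by (rule fpsv.subspace_diff[OF subspace_word_span])
  have r: "g 0 \<in> forms_on g 1" "g 1 \<in> forms_on g 1" "g 2 \<in> forms_on g 1" "g 3 \<in> forms_on g 1" for g
    using row_in_forms_on[of 0 g] row_in_forms_on[of 1 g] row_in_forms_on[of 2 g] row_in_forms_on[of 3 g] by simp_all
  have "\<forall>i<4. ff i \<in> forms_on hh 1"
    unfolding all_less_4 rows_explicit by (intro conjI add lin r)
  thus "forms_on ff k \<subseteq> forms_on hh k" by (intro forms_on_subset) auto
  have h0: "hh 0 \<in> forms_on ff 1" using r(1)[of ff] by (simp add: rows_explicit)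
  have "hh 1 = ff 1 - fps_const (b 1 0) * hh 0" unfolding rows_explicit by simp
  hence h1: "hh 1 \<in> forms_on ff 1" using diff[OF r(2)[of ff] lin[OF h0, of "b 1 0"]] by simp
  have "hh 2 = ff 2 - (fps_const (b 2 0) * hh 0 + fps_const (b 2 1) * hh 1)" by (simp add: rows_explicit)
  hence h2: "hh 2 \<in> forms_on ff 1"
    using diff[OF r(3)[of ff] add[OF lin[OF h0, of "b 2 0"] lin[OF h1, of "b 2 1"]]] by simp
  have "hh 3 = ff 3 - (fps_const (b 3 0) * hh 0 + fps_const (b 3 1) * hh 1 + fps_const (b 3 2) * hh 2)"
    by (simp add: rows_explicit)
  hence h3: "hh 3 \<in> forms_on ff 1"
    using diff[OF r(4)[of ff] add[OF add[OF lin[OF h0, of "b 3 0"] lin[OF h1, of "b 3 1"]] lin[OF h2, of "b 3 2"]]] by simp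
  have "\<forall>i<4. hh i \<in> forms_on ff 1" unfolding all_less_4 using h0 h1 h2 h3 by simp
  thus "forms_on hh k \<subseteq> forms_on ff k" by (intro forms_on_subset) auto
qed

lemma semigroup_eq: "semigroup_of ff = semigroup_of hh"
  by (simp add: semigroup_of_def forms_on_eq)

lemma X_power_in_forms: "n \<ge> T \<Longrightarrow> c \<le> v \<Longrightarrow> v \<le> n * d \<Longrightarrow> fps_X ^ v \<in> forms_on ff n"
  using monomials[of n] unfolding forms_on_eq many_monomials_def by blast

lemma deg_le_forms: "F \<in> forms_on ff n \<Longrightarrow> deg_le (n * d) F"
  by (rule deg_le_word_span[OF deg_le_ff order_refl])

lemma param_eq_bin_eval: "param d f x i = bin_eval d (ff i) x"
  by (simp add: param_def bin_eval_def coeff_rows_def)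

lemma param_coord_space: "param d f x \<in> coord_space {..<4}"
  using f_coord by (auto simp: coord_space_def param_def param_index_def)

lemma bin_eval_word:
  "bin_eval (length w * d) (prod_list (map ff w)) x = prod_list (map (param d f x) w)
    \<and> deg_le (length w * d) (prod_list (map ff w))"
proof (induction w)
  case Nil
  show ?case by (simp add: bin_eval_def deg_le_def)
next
  case (Cons i w)
  thus ?case using bin_eval_mult[OF deg_le_ff, of "length w * d" "prod_list (map ff w)" i x]
      deg_le_mult(1)[OF deg_le_ff, of "length w * d" "prod_list (map ff w)" i]
    by (simp add: param_eq_bin_eval)
qed

lemma form_of_hom_poly:
  assumes "p \<in> hom_poly n"
  shows "\<exists>F \<in> forms_on ff n. \<forall>x. p (param d f x) = bin_eval (n * d) F x"
proof -
  obtain A a where A: "finite A" "\<And>w. w \<in> A \<Longrightarrow> set w \<subseteq> {..<4} \<and> length w = n"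
    "\<And>v. v \<in> coord_space {..<4} \<Longrightarrow> p v = (\<Sum>w\<in>A. a w * prod_list (map v w))"
    using hom_poly_words[OF assms, of "{..<4}"] by metis
  define F where "F = (\<Sum>w\<in>A. fps_const (a w) * prod_list (map ff w))"
  have "F \<in> forms_on ff n" unfolding F_def word_span_def using A(2)
    by (intro fpsv.span_sum fpsv.span_scale fpsv.span_base) (auto simp: words_def)
  moreover have "p (param d f x) = bin_eval (n * d) F x" for x
    unfolding A(3)[OF param_coord_space] F_def bin_eval_sum
  proof (intro sum.cong refl)
    fix w assume "w \<in> A"
    thus "a w * prod_list (map (param d f x) w) = a w * bin_eval (n * d) (prod_list (map ff w)) x"
      using A(2)[of w] bin_eval_word[of w x] by auto
  qed
  ultimately show ?thesis by blast
qed

text \<open>A form on space is restricted to the curve by substituting the rows; words correspond to words.\<close>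

lemma hom_poly_of_form:
  assumes "F \<in> forms_on ff n"
  shows "\<exists>p \<in> hom_poly n. \<forall>x. p (param d f x) = bin_eval (n * d) F x"
proof -
  obtain a where a: "F = (\<Sum>w\<in>words n. fps_const (a w) * prod_list (map ff w))"
    using span_image_finite[OF finite_words assms[unfolded word_span_def]] by blast
  define p where "p = (\<lambda>v :: nat \<Rightarrow> complex. \<Sum>w\<in>words n. a w * prod_list (map v w))"
  have "p \<in> hom_poly n" unfolding p_def
    by (intro hom_poly_sum) (auto simp: words_def intro: hom_poly_word)
  moreover have "p (param d f x) = bin_eval (n * d) F x" for x
    unfolding a p_def bin_eval_sum
  proof (intro sum.cong refl)
    fix w assume "w \<in> words n"
    thus "a w * prod_list (map (param d f x) w) = a w * bin_eval (n * d) (prod_list (map ff w)) x"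
      using bin_eval_word[of w x] by (auto simp: words_def)
  qed
  ultimately show ?thesis by blast
qed

lemma monomial_form:
  assumes "n \<ge> T" "c \<le> v" "v \<le> n * d"
  shows "\<exists>p \<in> hom_poly n. \<forall>x. p (param d f x) = x 0 ^ (n * d - v) * x 1 ^ v"
  using hom_poly_of_form[OF X_power_in_forms[OF assms]] bin_eval_X_power[OF assms(3)] by simp

lemma param_at_cusp: "param d f (vec2 s 0) = smul (s ^ d) (param d f (vec2 1 0))"
proof (rule ext)
  fix i
  have "bin_eval d F (vec2 s 0) = s ^ d * fps_nth F 0" for F s
  proof -
    have "bin_eval d F (vec2 s 0) = (\<Sum>j\<le>d. if j = 0 then s ^ d * fps_nth F 0 else 0)"
      unfolding bin_eval_def by (intro sum.cong) auto
    thus ?thesis by simp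
  qed
  thus "param d f (vec2 s 0) i = smul (s ^ d) (param d f (vec2 1 0)) i"
    by (simp add: param_eq_bin_eval smul_def)
qed

lemma cusp_coord_nonzero: "f (0, 0) \<noteq> 0" using row0 rows_explicit(1) by (simp add: coeff_rows_def fps_eq_iff)

lemma param_cusp_0: "param d f (vec2 1 0) 0 = f (0, 0)"
proof -
  have "param d f (vec2 1 0) 0 = (\<Sum>j\<le>d. if j = 0 then f (0, 0) else 0)"
    unfolding param_def by (intro sum.cong) auto
  thus ?thesis by simp
qed

text \<open>A common zero of the rows would be a zero of all restrictions of forms, hence of the pure power of \<open>t\<close>.\<close>

lemma param_nonzero:
  assumes "x \<in> coord_space {..<2}" "x \<noteq> 0"
  shows "param d f x \<noteq> 0"
proof
  assume z: "param d f x = 0"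
  define n where "n = T + c + 1"
  have "n \<le> n * d" using d by (cases d) auto
  hence "n \<ge> T" "c \<le> n * d" by (auto simp: n_def)
  then obtain p where p: "p \<in> hom_poly n" "p (param d f x) = x 1 ^ (n * d)"
    using monomial_form[of n "n * d"] by auto
  have "p 0 = p (smul 0 0)" by (simp add: smul_def zero_fun_def)
  also have "\<dots> = 0" using hom_polyD[OF p(1), of 0 0] by (simp add: n_def)
  finally have "x 1 = 0" using p(2) z by simp
  hence x: "x = vec2 (x 0) 0" using vec2_eta[OF assms(1)] by simp
  hence "x 0 \<noteq> 0" using assms(2) vec2_nonzero[of "x 0" 0] by metis
  moreover have "param d f x = smul (x 0 ^ d) (param d f (vec2 1 0))"
    using param_at_cusp[of "x 0"] unfolding x[symmetric] .
  ultimately have "param d f x 0 \<noteq> 0" using param_cusp_0 cusp_coord_nonzero by (simp add: smul_def)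
  thus False using z by simp
qed

text \<open>The orders of the rows of \<open>h\<close> are different.\<close>

lemma combination_nonzero:
  assumes "l \<in> coord_space {..<4}" "l \<noteq> 0"
  shows "(\<Sum>i<4. fps_const (l i) * ff i) \<noteq> 0"
proof
  assume z: "(\<Sum>i<4. fps_const (l i) * ff i) = 0"
  define k0 where "k0 = l 0 + l 1 * b 1 0 + l 2 * b 2 0 + l 3 * b 3 0"
  define k1 where "k1 = l 1 + l 2 * b 2 1 + l 3 * b 3 1"
  define k2 where "k2 = l 2 + l 3 * b 3 2"
  have "(\<Sum>i<4. fps_const (l i) * ff i) = fps_const (l 0) * ff 0 + fps_const (l 1) * ff 1 + fps_const (l 2) * ff 2 + fps_const (l 3) * ff 3"
    by (simp add: numeral_eq_Suc)
  also have "\<dots> = fps_const k0 * hh 0 + fps_const k1 * hh 1 + fps_const k2 * hh 2 + fps_const (l 3) * hh 3"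
    unfolding rows_explicit k0_def k1_def k2_def fps_const_add[symmetric] fps_const_mult[symmetric]
    by (simp only: algebra_simps)
  finally have E: "fps_const k0 * hh 0 + fps_const k1 * hh 1 + fps_const k2 * hh 2 + fps_const (l 3) * hh 3 = 0"
    using z by simp
  have low: "fps_nth (hh i) j = 0" if "i < 4" "j < pord m i" for i j
    using h_cusp that by (auto simp: cusp_coeffs_def coord_space_def cusp_index_def coeff_rows_def)
  have piv: "fps_nth (hh i) (pord m i) \<noteq> 0" if "i < 4" for i
    using h_cusp that by (auto simp: cusp_coeffs_def pivots_nonzero coeff_rows_def)
  have N: "k0 * fps_nth (hh 0) j + k1 * fps_nth (hh 1) j + k2 * fps_nth (hh 2) j + l 3 * fps_nth (hh 3) j = 0" for j
    using arg_cong[OF E, of "\<lambda>F. fps_nth F j"] by simp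
  have "k0 = 0" using N[of 0] low[of 1 0] low[of 2 0] low[of 3 0] piv[of 0] m by (simp add: pord_simps)
  moreover from this have "k1 = 0" using N[of "2 * m"] low[of 2 "2 * m"] low[of 3 "2 * m"] piv[of 1] by (simp add: pord_simps)
  moreover from calculation have "k2 = 0" using N[of "2 * m + 2"] low[of 3 "2 * m + 2"] piv[of 2] by (simp add: pord_simps)
  moreover from calculation have "l 3 = 0" using N[of "2 * m + 4"] piv[of 3] by (simp add: pord_simps)
  ultimately have "\<forall>i<4. l i = 0" unfolding all_less_4 by (simp add: k0_def k1_def k2_def)
  thus False using assms by (auto simp: coord_space_def fun_eq_iff not_less) (metis not_less)
qed

lemma nondegenerate: "nondegenerate_morphism d f"
  unfolding nondegenerate_morphism_def
proof (intro conjI ballI impI f_coord param_nonzero)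
  fix l :: "nat \<Rightarrow> complex" assume l: "l \<in> coord_space {..<4}" "l \<noteq> 0"
  have ev: "bin_eval d (\<Sum>i<4. fps_const (l i) * ff i) x = (\<Sum>i<4. l i * param d f x i)" for x
    unfolding bin_eval_sum param_eq_bin_eval ..
  have "deg_le d (\<Sum>i<4. fps_const (l i) * ff i)"
    using deg_le_ff by (auto simp: deg_le_def fps_sum_nth)
  then obtain t where "bin_eval d (\<Sum>i<4. fps_const (l i) * ff i) (vec2 1 t) \<noteq> 0"
    using bin_eval_eq_0_imp combination_nonzero[OF l] by blast
  thus "\<exists>x\<in>coord_space {..<2}. (\<Sum>i<4. l i * param d f x i) \<noteq> 0"
    unfolding ev using vec2_simps(4) by blast
qed

lemma cone_eq: "\<Union>(image_curve d f) = {smul r (param d f x) | r x. r \<noteq> 0 \<and> x \<in> coord_space {..<2} \<and> x \<noteq> 0}"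
  by (auto simp: image_curve_def proj_pt_def)

text \<open>A form of degree \<open>n\<close> vanishes on the cone iff its restriction is the zero polynomial; the dimension of a space
  of power series is the number of its orders.\<close>

lemma hilbert_function_eq: "hilbert_function (image_curve d f) n = card (ords (forms_on ff n))"
proof -
  let ?C = "\<Union>(image_curve d f)"
  let ?U = "forms_on ff n"
  define res where "res = (\<lambda>p v. if v \<in> ?C then p v else (0 :: complex))"
  have fin: "finite (ords ?U)"
  proof (rule finite_subset)
    show "ords ?U \<subseteq> {..n * d}"
    proof
      fix v assume "v \<in> ords ?U"
      then obtain F where "F \<in> ?U" "fps_nth F v \<noteq> 0" by (rule ordsE)
      thus "v \<in> {..n * d}" using deg_le_forms deg_leD not_less by blast
    qed
  qed auto
  have "\<forall>v\<in>ords ?U. \<exists>F. F \<in> ?U \<and> fps_nth F v \<noteq> 0 \<and> (\<forall>j<v. fps_nth F j = 0)"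
    by (auto elim!: ordsE)
  from bchoice[OF this] obtain B where B: "\<forall>v\<in>ords ?U. B v \<in> ?U \<and> fps_nth (B v) v \<noteq> 0 \<and> (\<forall>j<v. fps_nth (B v) j = 0)" ..
  have "\<forall>v\<in>ords ?U. \<exists>p. p \<in> hom_poly n \<and> (\<forall>x. p (param d f x) = bin_eval (n * d) (B v) x)"
    using B hom_poly_of_form by blast
  from bchoice[OF this] obtain q where q: "\<forall>v\<in>ords ?U. q v \<in> hom_poly n \<and> (\<forall>x. q v (param d f x) = bin_eval (n * d) (B v) x)" ..
  have "cfun.dim {res p | p. p \<in> hom_poly n} = card (ords ?U)"
  proof (rule cfun_dim_family[OF fin, of "\<lambda>v. res (q v)"])
    show "res (q v) \<in> {res p |p. p \<in> hom_poly n}" if "v \<in> ords ?U" for v using q that by blast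
    show "{res p |p. p \<in> hom_poly n} \<subseteq> cfun.span ((\<lambda>v. res (q v)) ` ords ?U)"
    proof clarify
      fix p :: "(nat \<Rightarrow> complex) \<Rightarrow> complex" assume p: "p \<in> hom_poly n"
      obtain F where F: "F \<in> ?U" "\<And>x. p (param d f x) = bin_eval (n * d) F x"
        using form_of_hom_poly[OF p] by blast
      have "F \<in> fpsv.span (B ` ords ?U)"
        by (rule span_of_ords[OF subspace_word_span deg_le_forms _ F(1)]) (use B in auto)
      then obtain a where a: "F = (\<Sum>v\<in>ords ?U. fps_const (a v) * B v)"
        using span_image_finite[OF fin] by blast
      have "res p = (\<Sum>v\<in>ords ?U. smul (a v) (res (q v)))"
      proof (rule ext)
        fix y
        show "res p y = (\<Sum>v\<in>ords ?U. smul (a v) (res (q v))) y"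
        proof (cases "y \<in> ?C")
          case True
          then obtain r x where y: "y = smul r (param d f x)" unfolding cone_eq by blast
          have "p y = r ^ n * (\<Sum>v\<in>ords ?U. a v * bin_eval (n * d) (B v) x)"
            unfolding y hom_polyD[OF p] F(2) a bin_eval_sum ..
          also have "\<dots> = (\<Sum>v\<in>ords ?U. a v * q v y)"
            unfolding sum_distrib_left
          proof (intro sum.cong refl)
            fix v assume "v \<in> ords ?U"
            hence "q v y = r ^ n * bin_eval (n * d) (B v) x" unfolding y using q hom_polyD by metis
            thus "r ^ n * (a v * bin_eval (n * d) (B v) x) = a v * q v y" by simp
          qed
          finally show ?thesis using True by (simp add: res_def sum_fun_apply smul_def)
        next
          case False
          thus ?thesis by (simp add: res_def sum_fun_apply smul_def)
        qed
      qed
      thus "res p \<in> cfun.span ((\<lambda>v. res (q v)) ` ords ?U)"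
        by (simp only:) (intro cfun.span_sum cfun.span_scale cfun.span_base, auto)
    qed
    fix a v assume a: "\<And>y. (\<Sum>v\<in>ords ?U. a v * res (q v) y) = 0" and v: "v \<in> ords ?U"
    define F where "F = (\<Sum>v\<in>ords ?U. fps_const (a v) * B v)"
    have "bin_eval (n * d) F (vec2 1 t) = 0" for t
    proof -
      let ?y = "param d f (vec2 1 t)"
      have "smul 1 ?y = ?y" by (simp add: smul_def)
      moreover have "smul 1 ?y \<in> ?C" unfolding cone_eq using vec2_simps(4) vec2_nonzero[of 1 t]
        by (intro CollectI exI[of _ 1] exI[of _ "vec2 1 t"]) auto
      ultimately have y: "?y \<in> ?C" by simp
      have "bin_eval (n * d) F (vec2 1 t) = (\<Sum>v\<in>ords ?U. a v * res (q v) ?y)"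
        unfolding F_def bin_eval_sum using q y by (intro sum.cong) (auto simp: res_def)
      thus ?thesis using a by simp
    qed
    moreover have "F \<in> ?U" unfolding F_def
      by (intro fpsv.subspace_sum[OF subspace_word_span] fpsv.subspace_scale[OF subspace_word_span]) (use B in auto)
    ultimately have "F = 0" using bin_eval_eq_0_imp[OF deg_le_forms] by blast
    have tri: "indep_on (ords ?U) {..<n * d + 1} (\<lambda>v j. fps_nth (B v) j)"
    proof (rule indep_on_triangular[OF fin])
      show "ords ?U \<subseteq> {..<n * d + 1}"
      proof
        fix v assume "v \<in> ords ?U"
        hence "B v \<in> ?U" "fps_nth (B v) v \<noteq> 0" using B by auto
        thus "v \<in> {..<n * d + 1}" using deg_leD[OF deg_le_forms, of "B v" n v] by (simp add: less_Suc_eq_le) (meson not_less)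
      qed
    qed (use B in auto)
    have "(\<Sum>v\<in>ords ?U. a v * fps_nth (B v) j) = 0" for j
      using arg_cong[OF \<open>F = 0\<close>, of "\<lambda>F. fps_nth F j"] by (simp add: F_def fps_sum_nth)
    from indep_onD[OF tri this v] show "a v = 0" .
  qed
  thus ?thesis by (simp add: hilbert_function_def res_def)
qed

text \<open>Large values are orders of monomials, and the finitely many small ones are attained in a bounded degree.\<close>

lemma ords_forms_eventually:
  "\<exists>N. \<forall>n\<ge>N. ords (forms_on ff n) = semigroup_of ff \<inter> {..n * d}"
proof -
  have u: "fps_nth (ff 0) 0 \<noteq> 0" using row0 by (simp add: rows_explicit)
  obtain k where k: "semigroup_of ff \<inter> {..<c} \<subseteq> ords (forms_on ff k)"
    using finite_part_of_semigroup_of[where f = ff, OF u, of "semigroup_of ff \<inter> {..<c}"] by auto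
  have "ords (forms_on ff n) = semigroup_of ff \<inter> {..n * d}" if n: "n \<ge> T + k" for n
  proof (intro subset_antisym subsetI)
    fix v assume v: "v \<in> ords (forms_on ff n)"
    then obtain F where "F \<in> forms_on ff n" "fps_nth F v \<noteq> 0" by (rule ordsE)
    hence "v \<le> n * d" using deg_le_forms deg_leD not_less by blast
    thus "v \<in> semigroup_of ff \<inter> {..n * d}" using v by (auto simp: semigroup_of_def)
  next
    fix v assume v: "v \<in> semigroup_of ff \<inter> {..n * d}"
    show "v \<in> ords (forms_on ff n)"
    proof (cases "v < c")
      case True
      hence "v \<in> ords (forms_on ff k)" using k v by auto
      thus ?thesis using ords_forms_on_mono[where f = ff, OF u, of k n] n by auto
    next
      case False
      show ?thesis
        by (rule ordsI[OF X_power_in_forms[of n v]]) (use n v False in \<open>auto simp: fps_X_power_nth\<close>)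
    qed
  qed
  thus ?thesis by blast
qed

text \<open>The orders of restrictions of forms of degree \<open>n\<close> are the elements of the semigroup up to \<open>n d\<close>.\<close>

lemma arith_genus:
  assumes "finite (UNIV - semigroup_of ff)"
  shows "has_arith_genus (image_curve d f) (card (UNIV - semigroup_of ff))"
  unfolding has_arith_genus_def
proof (intro exI[of _ "int d"])
  let ?S = "semigroup_of ff"
  let ?G = "UNIV - ?S"
  obtain N where N: "\<And>n. n \<ge> N \<Longrightarrow> ords (forms_on ff n) = ?S \<inter> {..n * d}"
    using ords_forms_eventually by blast
  obtain M where M: "?G \<subseteq> {..M}" using assms by (auto simp: finite_nat_set_iff_bounded_le)
  have "int (hilbert_function (image_curve d f) n) = int d * int n + 1 - int (card ?G)" if n: "n \<ge> N + M" for n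
  proof -
    have "n \<le> n * d" using d by (cases d) auto
    hence "M \<le> n * d" using n by linarith
    hence "{..M} \<subseteq> {..n * d}" by simp
    with M have sub: "?G \<subseteq> {..n * d}" by (rule subset_trans)
    have "card {..n * d} = card (?S \<inter> {..n * d}) + card ?G"
    proof -
      have "{..n * d} = (?S \<inter> {..n * d}) \<union> ?G" using sub by auto
      moreover have "card ((?S \<inter> {..n * d}) \<union> ?G) = card (?S \<inter> {..n * d}) + card ?G"
        using assms by (intro card_Un_disjoint) auto
      ultimately show ?thesis by simp
    qed
    moreover have "hilbert_function (image_curve d f) n = card (?S \<inter> {..n * d})"
      unfolding hilbert_function_eq using N[of n] n by simp
    ultimately have "Suc (n * d) = hilbert_function (image_curve d f) n + card ?G" by simp
    hence "int (Suc (n * d)) = int (hilbert_function (image_curve d f) n + card ?G)" by (rule arg_cong)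
    thus ?thesis by (simp add: mult.commute)
  qed
  thus "\<forall>\<^sub>F n in sequentially. int (hilbert_function (image_curve d f) n) = int d * int n + 1 - int (card ?G)"
    unfolding eventually_sequentially by blast
qed

end

section \<open>Directional derivatives of polynomial functions\<close>

text \<open>Polynomial functions may depend on infinitely many variables, so this is proved by induction on their
  construction.\<close>

lemma poly_fun_chain_rule:
  assumes "p \<in> poly_fun" "\<And>i. ((\<lambda>z. \<gamma> z i) has_field_derivative w i) (at 0)" "\<gamma> 0 = v"
  shows "((\<lambda>z. p (\<gamma> z)) has_field_derivative deriv (\<lambda>z. p (v + smul z w)) 0) (at (0 :: complex))"
proof -
  have "\<exists>D. \<forall>\<gamma>. (\<forall>i. ((\<lambda>z. \<gamma> z i) has_field_derivative w i) (at 0)) \<longrightarrow> \<gamma> 0 = v \<longrightarrow>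
      ((\<lambda>z. p (\<gamma> z)) has_field_derivative D) (at 0)"
    using assms(1)
  proof induction
    case (const c)
    show ?case by (intro exI[of _ 0]) auto
  next
    case (coord i)
    show ?case by (intro exI[of _ "w i"]) auto
  next
    case (add p q)
    then obtain D E where
      "\<forall>\<gamma>. (\<forall>i. ((\<lambda>z. \<gamma> z i) has_field_derivative w i) (at 0)) \<longrightarrow> \<gamma> 0 = v \<longrightarrow> ((\<lambda>z. p (\<gamma> z)) has_field_derivative D) (at 0)"
      "\<forall>\<gamma>. (\<forall>i. ((\<lambda>z. \<gamma> z i) has_field_derivative w i) (at 0)) \<longrightarrow> \<gamma> 0 = v \<longrightarrow> ((\<lambda>z. q (\<gamma> z)) has_field_derivative E) (at 0)"
      by blast
    thus ?case by (intro exI[of _ "D + E"]) (auto intro: DERIV_add)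
  next
    case (mult p q)
    then obtain D E where
      "\<forall>\<gamma>. (\<forall>i. ((\<lambda>z. \<gamma> z i) has_field_derivative w i) (at 0)) \<longrightarrow> \<gamma> 0 = v \<longrightarrow> ((\<lambda>z. p (\<gamma> z)) has_field_derivative D) (at 0)"
      "\<forall>\<gamma>. (\<forall>i. ((\<lambda>z. \<gamma> z i) has_field_derivative w i) (at 0)) \<longrightarrow> \<gamma> 0 = v \<longrightarrow> ((\<lambda>z. q (\<gamma> z)) has_field_derivative E) (at 0)"
      by blast
    hence "((\<lambda>z. p (\<gamma> z) * q (\<gamma> z)) has_field_derivative D * q v + E * p v) (at 0)"
      if "\<forall>i. ((\<lambda>z. \<gamma> z i) has_field_derivative w i) (at 0)" "\<gamma> 0 = v" for \<gamma>
      using that DERIV_mult[of "\<lambda>z. p (\<gamma> z)" D 0 UNIV "\<lambda>z. q (\<gamma> z)" E] by simp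
    thus ?case by blast
  qed
  then obtain D where D: "\<And>\<gamma>. (\<And>i. ((\<lambda>z. \<gamma> z i) has_field_derivative w i) (at 0)) \<Longrightarrow> \<gamma> 0 = v \<Longrightarrow>
      ((\<lambda>z. p (\<gamma> z)) has_field_derivative D) (at 0)" by blast
  have "((\<lambda>z. p (v + smul z w)) has_field_derivative D) (at 0)"
    by (rule D) (auto simp: smul_def fun_eq_iff intro!: derivative_eq_intros)
  hence "deriv (\<lambda>z. p (v + smul z w)) 0 = D" by (rule DERIV_imp_deriv)
  thus ?thesis using D[OF assms(2,3)] by simp
qed

definition dir_deriv :: "(('i \<Rightarrow> complex) \<Rightarrow> complex) \<Rightarrow> ('i \<Rightarrow> complex) \<Rightarrow> ('i \<Rightarrow> complex) \<Rightarrow> complex"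
  where "dir_deriv p v w = deriv (\<lambda>z. p (v + smul z w)) 0"

lemma has_dir_deriv:
  "p \<in> poly_fun \<Longrightarrow> ((\<lambda>z. p (v + smul z w)) has_field_derivative dir_deriv p v w) (at 0)"
  unfolding dir_deriv_def
  by (rule poly_fun_chain_rule) (auto simp: smul_def fun_eq_iff intro!: derivative_eq_intros)

lemma dir_deriv_eqI:
  "((\<lambda>z. p (v + smul z w)) has_field_derivative D) (at 0) \<Longrightarrow> dir_deriv p v w = D"
  unfolding dir_deriv_def by (rule DERIV_imp_deriv)

lemma dir_deriv_curve:
  assumes "p \<in> poly_fun" "\<And>i. ((\<lambda>z. \<gamma> z i) has_field_derivative w i) (at 0)"
    "((\<lambda>z. p (\<gamma> z)) has_field_derivative D) (at 0)"
  shows "dir_deriv p (\<gamma> 0) w = D"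
  using poly_fun_chain_rule[OF assms(1,2) refl] assms(3) unfolding dir_deriv_def by (rule DERIV_unique)

section \<open>Tangent spaces and the singular point\<close>

text \<open>The partial derivatives of the forms parameterizing the curve.\<close>

definition param_s :: "nat \<Rightarrow> (nat \<times> nat \<Rightarrow> complex) \<Rightarrow> (nat \<Rightarrow> complex) \<Rightarrow> nat \<Rightarrow> complex"
  where "param_s d a x = (\<lambda>i. \<Sum>j\<le>d. a (i, j) * (of_nat (d - j) * x 0 ^ (d - j - 1)) * x 1 ^ j)"

definition param_t :: "nat \<Rightarrow> (nat \<times> nat \<Rightarrow> complex) \<Rightarrow> (nat \<Rightarrow> complex) \<Rightarrow> nat \<Rightarrow> complex"
  where "param_t d a x = (\<lambda>i. \<Sum>j\<le>d. a (i, j) * x 0 ^ (d - j) * (of_nat j * x 1 ^ (j - 1)))"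

lemma param_deriv:
  assumes "((\<lambda>z. u z) has_field_derivative u') (at 0)" "((\<lambda>z. v z) has_field_derivative v') (at 0)"
  shows "((\<lambda>z. param d a (vec2 (u z) (v z)) i) has_field_derivative
    (u' * param_s d a (vec2 (u 0) (v 0)) i + v' * param_t d a (vec2 (u 0) (v 0)) i)) (at 0)"
proof -
  have "((\<lambda>z. \<Sum>j\<le>d. a (i, j) * u z ^ (d - j) * v z ^ j) has_field_derivative
    (\<Sum>j\<le>d. a (i, j) * (of_nat (d - j) * u 0 ^ (d - j - 1) * u') * v 0 ^ j +
      a (i, j) * u 0 ^ (d - j) * (of_nat j * v 0 ^ (j - 1) * v'))) (at 0)"
    by (intro DERIV_sum) (auto intro!: derivative_eq_intros assms simp: mult_ac)
  also have "(\<Sum>j\<le>d. a (i, j) * (of_nat (d - j) * u 0 ^ (d - j - 1) * u') * v 0 ^ j +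
      a (i, j) * u 0 ^ (d - j) * (of_nat j * v 0 ^ (j - 1) * v')) =
      u' * param_s d a (vec2 (u 0) (v 0)) i + v' * param_t d a (vec2 (u 0) (v 0)) i"
    by (simp add: param_s_def param_t_def sum.distrib sum_distrib_left mult_ac)
  finally show ?thesis by (simp add: param_def)
qed

lemma param_deriv_line:
  "((\<lambda>z. param d a (vec2 (s + z * \<alpha>) (t + z * \<beta>)) i) has_field_derivative
    (\<alpha> * param_s d a (vec2 s t) i + \<beta> * param_t d a (vec2 s t) i)) (at 0)"
proof -
  have "((\<lambda>z. s + z * \<alpha>) has_field_derivative \<alpha>) (at 0)" "((\<lambda>z. t + z * \<beta>) has_field_derivative \<beta>) (at 0)"
    by (auto intro!: derivative_eq_intros)
  from param_deriv[OF this, of d a i] show ?thesis by simp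
qed

lemma param_euler: "x 0 * param_s d a x i + x 1 * param_t d a x i = of_nat d * param d a x i"
proof -
  have "x 0 * param_s d a x i + x 1 * param_t d a x i =
    (\<Sum>j\<le>d. x 0 * (a (i, j) * (of_nat (d - j) * x 0 ^ (d - j - 1)) * x 1 ^ j) +
      x 1 * (a (i, j) * x 0 ^ (d - j) * (of_nat j * x 1 ^ (j - 1))))"
    by (simp add: param_s_def param_t_def sum.distrib sum_distrib_left)
  also have "\<dots> = (\<Sum>j\<le>d. of_nat d * (a (i, j) * x 0 ^ (d - j) * x 1 ^ j))"
  proof (intro sum.cong refl)
    fix j assume j: "j \<in> {..d}"
    have 1: "of_nat (d - j) * x 0 ^ (d - j - 1) * x 0 = of_nat (d - j) * x 0 ^ (d - j)"
      by (cases "d - j") auto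
    have 2: "of_nat j * x 1 ^ (j - 1) * x 1 = of_nat j * x 1 ^ j" by (cases j) auto
    have "x 0 * (a (i, j) * (of_nat (d - j) * x 0 ^ (d - j - 1)) * x 1 ^ j) +
        x 1 * (a (i, j) * x 0 ^ (d - j) * (of_nat j * x 1 ^ (j - 1))) =
      a (i, j) * (of_nat (d - j) * x 0 ^ (d - j - 1) * x 0) * x 1 ^ j +
      a (i, j) * x 0 ^ (d - j) * (of_nat j * x 1 ^ (j - 1) * x 1)" by (simp only: mult_ac)
    also have "\<dots> = (of_nat (d - j) + of_nat j) * (a (i, j) * x 0 ^ (d - j) * x 1 ^ j)"
      unfolding 1 2 by (simp add: algebra_simps)
    also have "of_nat (d - j) + of_nat j = (of_nat d :: complex)"
      using j by (simp flip: of_nat_add)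
    finally show "x 0 * (a (i, j) * (of_nat (d - j) * x 0 ^ (d - j - 1)) * x 1 ^ j) +
        x 1 * (a (i, j) * x 0 ^ (d - j) * (of_nat j * x 1 ^ (j - 1))) =
      of_nat d * (a (i, j) * x 0 ^ (d - j) * x 1 ^ j)" .
  qed
  finally show ?thesis by (simp add: param_def sum_distrib_left)
qed

lemma param_partial_scale:
  "param_s d a (vec2 (r * s) (r * t)) i = r ^ (d - 1) * param_s d a (vec2 s t) i"
  "param_t d a (vec2 (r * s) (r * t)) i = r ^ (d - 1) * param_t d a (vec2 s t) i"
proof -
  have *: "of_nat (d - j) * (r * s) ^ (d - j - 1) * (r * t) ^ j = r ^ (d - 1) * (of_nat (d - j) * s ^ (d - j - 1) * t ^ j)"
    if "j \<le> d" for j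
  proof (cases "j = d")
    case False
    hence "r ^ (d - j - 1) * r ^ j = r ^ (d - 1)" using that by (simp flip: power_add)
    thus ?thesis by (simp add: power_mult_distrib mult_ac)
  qed simp
  show "param_s d a (vec2 (r * s) (r * t)) i = r ^ (d - 1) * param_s d a (vec2 s t) i"
    unfolding param_s_def sum_distrib_left vec2_simps
    using * by (intro sum.cong refl) (simp add: mult.assoc mult.left_commute)
  have *: "(r * s) ^ (d - j) * (of_nat j * (r * t) ^ (j - 1)) = r ^ (d - 1) * (s ^ (d - j) * (of_nat j * t ^ (j - 1)))"
    if "j \<le> d" for j
  proof (cases "j = 0")
    case False
    hence "r ^ (d - j) * r ^ (j - 1) = r ^ (d - 1)" using that by (simp flip: power_add)
    thus ?thesis by (simp add: power_mult_distrib mult_ac)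
  qed simp
  show "param_t d a (vec2 (r * s) (r * t)) i = r ^ (d - 1) * param_t d a (vec2 s t) i"
    unfolding param_t_def sum_distrib_left vec2_simps
  proof (intro sum.cong refl)
    fix j assume "j \<in> {..d}"
    hence "a (i, j) * ((r * s) ^ (d - j) * (of_nat j * (r * t) ^ (j - 1))) =
      a (i, j) * (r ^ (d - 1) * (s ^ (d - j) * (of_nat j * t ^ (j - 1))))" by (subst *) auto
    thus "a (i, j) * (r * s) ^ (d - j) * (of_nat j * (r * t) ^ (j - 1)) =
      r ^ (d - 1) * (a (i, j) * s ^ (d - j) * (of_nat j * t ^ (j - 1)))" by (simp only: mult_ac)
  qed
qed

context cuspidal_curve
begin

abbreviation "C \<equiv> image_curve d f"

text \<open>Both homogeneous coordinates of the line, multiplied by the same power of \<open>t\<close>, extend to forms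
  on space: these recover the point of the line from its image.\<close>

lemma coordinate_forms:
  "\<exists>n U V W. n \<ge> 1 \<and> U \<in> hom_poly n \<and> V \<in> hom_poly n \<and> W \<in> hom_poly (n * d - 1) \<and>
    (\<forall>x. U (param d f x) = x 0 * x 1 ^ (n * d - 1)) \<and> (\<forall>x. V (param d f x) = x 1 ^ (n * d)) \<and>
    (\<forall>x. W (param d f x) = x 1 ^ ((n * d - 1) * d))"
proof -
  define n where "n = T + c + 2"
  have nd: "n \<le> n * d" using d by (cases d) auto
  define k where "k = n * d - 1"
  have k: "k \<ge> T" "c \<le> k" "k \<le> k * d" using nd d by (auto simp: k_def n_def)
  obtain U where U: "U \<in> hom_poly n" "\<forall>x. U (param d f x) = x 0 ^ (n * d - k) * x 1 ^ k"
    using monomial_form[of n k] k by (auto simp: k_def n_def)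
  obtain V where V: "V \<in> hom_poly n" "\<forall>x. V (param d f x) = x 0 ^ (n * d - n * d) * x 1 ^ (n * d)"
    using monomial_form[of n "n * d"] nd by (auto simp: n_def)
  obtain W where W: "W \<in> hom_poly k" "\<forall>x. W (param d f x) = x 0 ^ (k * d - k * d) * x 1 ^ (k * d)"
    using monomial_form[of k "k * d"] k by auto
  have "n * d - k = 1" using nd by (auto simp: k_def n_def)
  thus ?thesis using U V W unfolding k_def
    by (intro exI[of _ n] exI[of _ U] exI[of _ V] exI[of _ W]) (auto simp: n_def)
qed

lemma cone_mem: "r \<noteq> 0 \<Longrightarrow> x \<in> coord_space {..<2} \<Longrightarrow> x \<noteq> 0 \<Longrightarrow> smul r (param d f x) \<in> \<Union>C"
  unfolding cone_eq by blast

lemma param_cone: "x \<in> coord_space {..<2} \<Longrightarrow> x \<noteq> 0 \<Longrightarrow> param d f x \<in> \<Union>C"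
  using cone_mem[of 1 x] by (simp add: smul_def)

text \<open>The parameterization need not be restricted to nonzero vectors here, which makes
  differentiation along arbitrary lines possible.\<close>

lemma vanish_on_param:
  assumes "p \<in> hom_poly n" "\<forall>u\<in>\<Union>C. p u = 0"
  shows "p (smul r (param d f (vec2 s t))) = 0"
proof -
  have "p (param d f (vec2 s t)) = 0"
  proof (cases "s = 0 \<and> t = 0")
    case False
    thus ?thesis using assms(2) param_cone[of "vec2 s t"] vec2_nonzero[of s t] by auto
  next
    case True
    have "param d f (vec2 s t) i = 0" for i
      unfolding param_def using True d by (intro sum.neutral) (auto simp: power_0_left)
    hence eq: "param d f (vec2 s t) = smul 0 (param d f (vec2 1 0))" by (simp add: smul_def fun_eq_iff)
    have "p (param d f (vec2 s t)) = 0 ^ n * p (param d f (vec2 1 0))"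
      unfolding eq hom_polyD[OF assms(1)] ..
    moreover have "p (param d f (vec2 1 0)) = 0"
      using assms(2) param_cone[of "vec2 1 0"] vec2_nonzero[of 1 0] by auto
    ultimately show ?thesis by simp
  qed
  thus ?thesis using hom_polyD[OF assms(1)] by simp
qed

text \<open>A form vanishing on the curve vanishes along \<open>z \<mapsto> param d f (x + z y)\<close>.\<close>

lemma tangent_contains:
  assumes "r \<noteq> 0"
  shows "smul r (\<lambda>i. \<alpha> * param_s d f (vec2 s t) i + \<beta> * param_t d f (vec2 s t) i)
    \<in> cone_tangent_space C (smul r (param d f (vec2 s t)))" (is "?w \<in> _")
  unfolding cone_tangent_space_def
proof (intro CollectI conjI allI ballI impI)
  show "?w \<in> coord_space {..<4}"
    using f_coord by (auto simp: coord_space_def smul_def param_s_def param_t_def param_index_def)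
  fix n and p :: "(nat \<Rightarrow> complex) \<Rightarrow> complex"
  assume p: "p \<in> hom_poly n" "\<forall>u\<in>\<Union>C. p u = 0"
  define \<gamma> where "\<gamma> = (\<lambda>z. smul r (param d f (vec2 (s + z * \<alpha>) (t + z * \<beta>))))"
  have "((\<lambda>z. \<gamma> z i) has_field_derivative ?w i) (at 0)" for i
    unfolding \<gamma>_def smul_def by (rule DERIV_cmult[OF param_deriv_line])
  moreover have "((\<lambda>z. p (\<gamma> z)) has_field_derivative 0) (at 0)"
    unfolding \<gamma>_def vanish_on_param[OF p] by simp
  ultimately have "dir_deriv p (\<gamma> 0) ?w = 0"
    by (intro dir_deriv_curve[OF hom_poly_imp_poly_fun[OF p(1)]])
  thus "deriv (\<lambda>z. p (smul r (param d f (vec2 s t)) + smul z ?w)) 0 = 0"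
    by (simp add: dir_deriv_def \<gamma>_def)
qed

text \<open>The forms \<open>s t\<^sup>k\<close> and \<open>t\<^sup>k\<^sup>+\<^sup>1\<close> factor through the parameterization and are an immersion where \<open>t\<close> is not zero.\<close>

lemma param_immersion:
  assumes "t \<noteq> 0" "\<And>i. \<alpha> * param_s d f (vec2 s t) i + \<beta> * param_t d f (vec2 s t) i = 0"
  shows "\<alpha> = 0 \<and> \<beta> = 0"
proof -
  obtain n U V where UV: "n \<ge> 1" "U \<in> hom_poly n" "V \<in> hom_poly n"
    "\<And>x. U (param d f x) = x 0 * x 1 ^ (n * d - 1)" "\<And>x. V (param d f x) = x 1 ^ (n * d)"
    using coordinate_forms by blast
  define k where "k = n * d - 1"
  have k: "n * d = Suc k" using UV(1) d by (simp add: k_def)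
  define \<gamma> where "\<gamma> = (\<lambda>z. param d f (vec2 (s + z * \<alpha>) (t + z * \<beta>)))"
  have \<gamma>: "((\<lambda>z. \<gamma> z i) has_field_derivative (0 :: nat \<Rightarrow> complex) i) (at 0)" for i
    using param_deriv_line[of d f s \<alpha> t \<beta> i] unfolding \<gamma>_def zero_fun_def assms(2)[of i] .
  have 0: "dir_deriv p v 0 = 0" for p :: "(nat \<Rightarrow> complex) \<Rightarrow> complex" and v
    by (simp add: dir_deriv_def smul_def plus_fun_def)
  have "((\<lambda>z. V (\<gamma> z)) has_field_derivative of_nat (Suc k) * t ^ k * \<beta>) (at 0)"
  proof -
    have "((\<lambda>z. t + z * \<beta>) has_field_derivative \<beta>) (at 0)" by (auto intro!: derivative_eq_intros)
    from DERIV_power_Suc[OF this, of k] show ?thesis unfolding \<gamma>_def UV(5) k by (simp add: mult_ac)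
  qed
  from dir_deriv_curve[OF hom_poly_imp_poly_fun[OF UV(3)] \<gamma> this] have "of_nat (Suc k) * t ^ k * \<beta> = 0"
    unfolding 0 by simp
  hence \<beta>: "\<beta> = 0" using assms(1) of_nat_neq_0[of k, where 'a = complex] by (simp del: of_nat_Suc)
  have "((\<lambda>z. U (\<gamma> z)) has_field_derivative \<alpha> * t ^ k) (at 0)"
    unfolding \<gamma>_def UV(4) k \<beta> by (auto intro!: derivative_eq_intros)
  from dir_deriv_curve[OF hom_poly_imp_poly_fun[OF UV(2)] \<gamma> this] have "\<alpha> * t ^ k = 0"
    unfolding 0 by simp
  thus ?thesis using \<beta> assms(1) by simp
qed

text \<open>With \<open>U, V, W\<close> restricting to \<open>s t\<^sup>k, t\<^sup>k\<^sup>+\<^sup>1, t\<^sup>k\<^sup>d\<close>, the forms \<open>W y\<^sub>i - f\<^sub>i(U, V)\<close> vanish on the curve.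
  Their differentials express a tangent vector by the partial derivatives of the parameterization and the
  point itself, and the latter is also a combination of these by Euler's formula.\<close>

lemma tangent_subset:
  assumes "t \<noteq> 0" "r \<noteq> 0" "w \<in> cone_tangent_space C (smul r (param d f (vec2 s t)))"
  shows "\<exists>\<alpha> \<beta>. \<forall>i. w i = \<alpha> * param_s d f (vec2 s t) i + \<beta> * param_t d f (vec2 s t) i"
proof -
  obtain n U V W where UV: "n \<ge> 1" "U \<in> hom_poly n" "V \<in> hom_poly n" "W \<in> hom_poly (n * d - 1)"
    "\<And>x. U (param d f x) = x 0 * x 1 ^ (n * d - 1)" "\<And>x. V (param d f x) = x 1 ^ (n * d)"
    "\<And>x. W (param d f x) = x 1 ^ ((n * d - 1) * d)"
    using coordinate_forms by blast
  define k where "k = n * d - 1"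
  have k: "n * d = Suc k" using UV(1) d by (simp add: k_def)
  define v where "v = smul r (param d f (vec2 s t))"
  define \<mu> where "\<mu> = r ^ n * t ^ k"
  have Uv: "U v = \<mu> * s" and Vv: "V v = \<mu> * t" and Wv: "W v = r ^ k * t ^ (k * d)"
    unfolding v_def hom_polyD[OF UV(2)] hom_polyD[OF UV(3)] hom_polyD[OF UV(4)] UV(5,6,7) \<mu>_def
    by (simp_all add: k)
  \<comment> \<open>These forms vanish on the curve.\<close>
  define P where "P = (\<lambda>i y. W y * y i - param d f (vec2 (U y) (V y)) i)"
  have P_hom: "P i \<in> hom_poly (n * d)" for i
  proof -
    have 1: "(\<lambda>y. W y * y i) \<in> hom_poly (n * d)"
      using hom_poly_mult[OF UV(4) hom_poly_coord[of i]] k by (simp add: k_def[symmetric])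
    have 2: "(\<lambda>y. U y ^ (d - j) * V y ^ j) \<in> hom_poly (n * d)" if "j \<le> d" for j
      using hom_poly_mult[OF hom_poly_power[OF UV(2), of "d - j"] hom_poly_power[OF UV(3), of j]] that
      by (simp flip: add_mult_distrib2)
    have "(\<lambda>y. \<Sum>j\<in>{..d}. f (i, j) * (U y ^ (d - j) * V y ^ j)) \<in> hom_poly (n * d)"
      using 2 by (intro hom_poly_sum) auto
    hence 3: "(\<lambda>y. param d f (vec2 (U y) (V y)) i) \<in> hom_poly (n * d)" by (simp add: param_def mult.assoc)
    show ?thesis using 1 3 unfolding P_def hom_poly_def
      by (auto simp: right_diff_distrib intro: poly_fun_diff)
  qed
  have P_param: "P i (param d f x) = 0" for i x
  proof -
    have "param d f (vec2 (x 0 * x 1 ^ k) (x 1 ^ Suc k)) i = (x 1 ^ k) ^ d * param d f x i"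
      unfolding param_def sum_distrib_left
    proof (intro sum.cong refl)
      fix j assume "j \<in> {..d}"
      hence "(x 1 ^ k) ^ d = (x 1 ^ k) ^ (d - j) * (x 1 ^ k) ^ j" by (simp flip: power_add)
      thus "f (i, j) * vec2 (x 0 * x 1 ^ k) (x 1 ^ Suc k) 0 ^ (d - j) * vec2 (x 0 * x 1 ^ k) (x 1 ^ Suc k) 1 ^ j =
        (x 1 ^ k) ^ d * (f (i, j) * x 0 ^ (d - j) * x 1 ^ j)"
        by (simp add: power_mult_distrib mult_ac)
    qed
    thus ?thesis unfolding P_def UV(5,6,7) k by (simp add: power_mult)
  qed
  have P_van: "P i u = 0" if "u \<in> \<Union>C" for i u
    using that P_param hom_polyD[OF P_hom] unfolding cone_eq by auto
  define DU DV DW where "DU = dir_deriv U v w" and "DV = dir_deriv V v w" and "DW = dir_deriv W v w"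
  note deriv = has_dir_deriv[OF hom_poly_imp_poly_fun]
  have v0: "v + smul 0 w = v" by (simp add: smul_def plus_fun_def)
  have "dir_deriv (P i) v w = (DW * v i + W v * w i) -
      (DU * param_s d f (vec2 (U v) (V v)) i + DV * param_t d f (vec2 (U v) (V v)) i)" for i
  proof (rule dir_deriv_eqI)
    have 1: "((\<lambda>z. (v + smul z w) i) has_field_derivative w i) (at 0)"
      by (auto simp: smul_def intro!: derivative_eq_intros)
    have 2: "((\<lambda>z. W (v + smul z w) * (v + smul z w) i) has_field_derivative (DW * v i + W v * w i)) (at 0)"
      using DERIV_mult[OF deriv[OF UV(4), of v w] 1] unfolding v0 DW_def by (simp add: mult.commute)
    have 3: "((\<lambda>z. param d f (vec2 (U (v + smul z w)) (V (v + smul z w))) i) has_field_derivative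
      (DU * param_s d f (vec2 (U v) (V v)) i + DV * param_t d f (vec2 (U v) (V v)) i)) (at 0)"
      using param_deriv[OF deriv[OF UV(2), of v w] deriv[OF UV(3), of v w], of d f i] unfolding v0 DU_def DV_def .
    show "((\<lambda>z. P i (v + smul z w)) has_field_derivative (DW * v i + W v * w i) -
      (DU * param_s d f (vec2 (U v) (V v)) i + DV * param_t d f (vec2 (U v) (V v)) i)) (at 0)"
      unfolding P_def by (rule DERIV_diff[OF 2 3])
  qed
  moreover have "dir_deriv (P i) v w = 0" for i
    using assms(3) P_hom P_van unfolding cone_tangent_space_def v_def dir_deriv_def by blast
  ultimately have eq: "W v * w i = DU * param_s d f (vec2 (U v) (V v)) i + DV * param_t d f (vec2 (U v) (V v)) i - DW * v i" for i
    by (simp add: algebra_simps)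
  have W0: "W v \<noteq> 0" using assms by (simp add: Wv)
  define A B where "A = param_s d f (vec2 s t)" and "B = param_t d f (vec2 s t)"
  have vi: "v i = r / of_nat d * (s * A i + t * B i)" for i
    using param_euler[of "vec2 s t" d f i] d by (simp add: v_def smul_def A_def B_def)
  have "w i = ((DU * \<mu> ^ (d - 1) - DW * r / of_nat d * s) / W v) * A i + ((DV * \<mu> ^ (d - 1) - DW * r / of_nat d * t) / W v) * B i" for i
  proof -
    have "W v * w i = (DU * \<mu> ^ (d - 1) - DW * r / of_nat d * s) * A i + (DV * \<mu> ^ (d - 1) - DW * r / of_nat d * t) * B i"
      unfolding eq Uv Vv param_partial_scale vi A_def[symmetric] B_def[symmetric] by (simp add: algebra_simps)
    hence "w i = ((DU * \<mu> ^ (d - 1) - DW * r / of_nat d * s) * A i + (DV * \<mu> ^ (d - 1) - DW * r / of_nat d * t) * B i) / W v"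
      using W0 by (simp add: field_simps)
    thus ?thesis by (simp add: add_divide_distrib)
  qed
  thus ?thesis unfolding A_def B_def by blast
qed

lemma tangent_dim_smooth:
  assumes "t \<noteq> 0" "r \<noteq> 0"
  shows "cfun.dim (cone_tangent_space C (smul r (param d f (vec2 s t)))) = 2"
proof -
  define A B where "A = param_s d f (vec2 s t)" and "B = param_t d f (vec2 s t)"
  define e where "e = (\<lambda>k :: nat. if k = 0 then smul r A else smul r B)"
  let ?V = "cone_tangent_space C (smul r (param d f (vec2 s t)))"
  have "cfun.dim ?V = card {..<2 :: nat}"
  proof (rule cfun_dim_family[where e = e])
    fix k :: nat assume "k \<in> {..<2}"
    show "e k \<in> ?V" using tangent_contains[OF assms(2), of 1 s t 0] tangent_contains[OF assms(2), of 0 s t 1]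
      by (auto simp: e_def A_def B_def)
  next
    show "?V \<subseteq> cfun.span (e ` {..<2})"
    proof
      fix w assume "w \<in> ?V"
      then obtain \<alpha> \<beta> where "\<forall>i. w i = \<alpha> * A i + \<beta> * B i"
        using tangent_subset[OF assms] unfolding A_def B_def by blast
      hence "w = smul (\<alpha> / r) (e 0) + smul (\<beta> / r) (e 1)"
        using assms(2) by (auto simp: e_def smul_def fun_eq_iff)
      moreover have "smul (\<alpha> / r) (e 0) + smul (\<beta> / r) (e 1) \<in> cfun.span (e ` {..<2})"
        by (intro cfun.span_add cfun.span_scale cfun.span_base) auto
      ultimately show "w \<in> cfun.span (e ` {..<2})" by (simp only:)
    qed
  next
    fix x i assume x: "\<And>a. (\<Sum>i<2. x i * e i a) = 0" "i \<in> {..<2 :: nat}"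
    have "x 0 * r * A a + x 1 * r * B a = 0" for a
      using x(1)[of a] by (simp add: e_def smul_def numeral_2_eq_2 mult.assoc)
    hence "x 0 * r = 0 \<and> x 1 * r = 0"
      using param_immersion[OF assms(1), of "x 0 * r" s "x 1 * r"] unfolding A_def B_def by blast
    thus "x i = 0" using assms(2) x(2) by (auto simp: less_2_cases_iff)
  qed auto
  thus ?thesis by simp
qed

text \<open>The first-order expansion of a form at the cusp, in the coordinates in which the curve is \<open>h\<close>.
  Products of two of the series \<open>h\<^sub>1, h\<^sub>2, h\<^sub>3\<close> have order at least \<open>4 m\<close>.\<close>

lemma word_first_order:
  assumes "set w \<subseteq> {..<4}"
  shows "\<exists>\<kappa>. fps_X ^ (4 * m) dvd hh 0 * prod_list (map hh w) - hh 0 ^ length w * (\<Sum>i<4. fps_const (\<kappa> i) * hh i) \<and>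
    (\<forall>r. prod_list (map (vec2 r 0) w) = \<kappa> 0 * r ^ length w) \<and>
    (\<forall>r \<eta>. r * dir_deriv (\<lambda>y. prod_list (map y w)) (vec2 r 0) \<eta> =
      r ^ length w * (of_nat (length w) * \<kappa> 0 * \<eta> 0 + (\<Sum>i\<in>{1,2,3}. \<kappa> i * \<eta> i)))"
  using assms
proof (induction w)
  case Nil
  show ?case
    by (intro exI[of _ "\<lambda>i. if i = 0 then 1 else 0"])
      (auto simp: dir_deriv_def numeral_eq_Suc)
next
  case (Cons j w)
  define n where "n = length w"
  define F where "F = prod_list (map hh w)"
  from Cons obtain \<kappa> where
    k1: "fps_X ^ (4 * m) dvd hh 0 * F - hh 0 ^ n * (\<Sum>i<4. fps_const (\<kappa> i) * hh i)"
    and k2: "\<And>r. prod_list (map (vec2 r 0) w) = \<kappa> 0 * r ^ n"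
    and k3: "\<And>r \<eta>. r * dir_deriv (\<lambda>y. prod_list (map y w)) (vec2 r 0) \<eta> =
      r ^ n * (of_nat n * \<kappa> 0 * \<eta> 0 + (\<Sum>i\<in>{1,2,3}. \<kappa> i * \<eta> i))"
    by (auto simp: n_def F_def)
  have prod_deriv: "dir_deriv (\<lambda>y. prod_list (map y (j # w))) (vec2 r 0) \<eta> =
    \<eta> j * prod_list (map (vec2 r 0) w) + vec2 r 0 j * dir_deriv (\<lambda>y. prod_list (map y w)) (vec2 r 0) \<eta>" for r \<eta>
  proof (rule dir_deriv_eqI)
    have 1: "((\<lambda>z. (vec2 r 0 + smul z \<eta>) j) has_field_derivative \<eta> j) (at 0)"
      by (auto simp: smul_def intro!: derivative_eq_intros)
    have v0: "vec2 r 0 + smul 0 \<eta> = vec2 r 0" by (simp add: smul_def plus_fun_def)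
    show "((\<lambda>z. prod_list (map (vec2 r 0 + smul z \<eta>) (j # w))) has_field_derivative
      \<eta> j * prod_list (map (vec2 r 0) w) + vec2 r 0 j * dir_deriv (\<lambda>y. prod_list (map y w)) (vec2 r 0) \<eta>) (at 0)"
      using DERIV_mult[OF 1 has_dir_deriv[OF hom_poly_imp_poly_fun[OF hom_poly_word[of w]], of "vec2 r 0" \<eta>]]
      unfolding v0 by (simp add: mult.commute)
  qed
  show ?case
  proof (cases "j = 0")
    case True
    have "hh 0 * prod_list (map hh (j # w)) - hh 0 ^ length (j # w) * (\<Sum>i<4. fps_const (\<kappa> i) * hh i) =
      hh 0 * (hh 0 * F - hh 0 ^ n * (\<Sum>i<4. fps_const (\<kappa> i) * hh i))"
      by (simp add: True F_def n_def algebra_simps)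
    hence "fps_X ^ (4 * m) dvd hh 0 * prod_list (map hh (j # w)) - hh 0 ^ length (j # w) * (\<Sum>i<4. fps_const (\<kappa> i) * hh i)"
      using k1 by simp
    moreover have "prod_list (map (vec2 r 0) (j # w)) = \<kappa> 0 * r ^ length (j # w)" for r
      using k2 by (simp add: True n_def)
    moreover have "r * dir_deriv (\<lambda>y. prod_list (map y (j # w))) (vec2 r 0) \<eta> =
      r ^ length (j # w) * (of_nat (length (j # w)) * \<kappa> 0 * \<eta> 0 + (\<Sum>i\<in>{1,2,3}. \<kappa> i * \<eta> i))" for r \<eta>
    proof -
      have "r * dir_deriv (\<lambda>y. prod_list (map y (j # w))) (vec2 r 0) \<eta> =
        r * \<eta> 0 * (\<kappa> 0 * r ^ n) + r * (r * dir_deriv (\<lambda>y. prod_list (map y w)) (vec2 r 0) \<eta>)"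
        unfolding prod_deriv unfolding k2 True vec2_simps by (simp only: ring_distribs mult_ac)
      also have "\<dots> = r * r ^ n * (of_nat (Suc n) * \<kappa> 0 * \<eta> 0 + (\<Sum>i\<in>{1,2,3}. \<kappa> i * \<eta> i))"
        unfolding k3 of_nat_Suc by (simp only: ring_distribs mult_ac mult_1_left mult_1_right add_ac)
      finally show ?thesis by (simp add: n_def)
    qed
    ultimately show ?thesis by blast
  next
    case False
    hence j: "j \<in> {1, 2, 3}" using Cons.prems by auto
    define \<kappa>' where "\<kappa>' = (\<lambda>i. if i = j then \<kappa> 0 else 0)"
    have sum: "(\<Sum>i<4. fps_const (\<kappa>' i) * hh i) = fps_const (\<kappa> 0) * hh j"
    proof -
      have "(\<Sum>i<4. fps_const (\<kappa>' i) * hh i) = (\<Sum>i<4. if i = j then fps_const (\<kappa> 0) * hh j else 0)"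
        by (intro sum.cong) (auto simp: \<kappa>'_def)
      thus ?thesis using j by auto
    qed
    have low: "fps_X ^ (2 * m) dvd hh i" if "i \<in> {1, 2, 3}" for i
      using that dvd_rows(1) power_le_dvd[OF dvd_rows(2), of "2 * m"] power_le_dvd[OF dvd_rows(3), of "2 * m"] by auto
    have split: "(\<Sum>i<4. fps_const (\<kappa> i) * hh i) = fps_const (\<kappa> 0) * hh 0 + (\<Sum>i\<in>{1,2,3}. fps_const (\<kappa> i) * hh i)"
      by (simp add: numeral_eq_Suc add.assoc)
    define R where "R = (\<Sum>i\<in>{1,2,3}. fps_const (\<kappa> i) * hh i)"
    have R: "fps_X ^ (2 * m) dvd R" unfolding R_def by (intro dvd_sum dvd_mult low)
    have "fps_X ^ (2 * m + 2 * m) dvd hh j * R" unfolding power_add by (intro mult_dvd_mono low j R)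
    hence jR: "fps_X ^ (4 * m) dvd hh j * R" by simp
    have "hh 0 * prod_list (map hh (j # w)) - hh 0 ^ length (j # w) * (\<Sum>i<4. fps_const (\<kappa>' i) * hh i) =
      hh j * (hh 0 * F - hh 0 ^ n * (\<Sum>i<4. fps_const (\<kappa> i) * hh i)) + hh 0 ^ n * (hh j * R)"
      unfolding sum split R_def[symmetric] by (simp add: F_def n_def algebra_simps)
    moreover have "fps_X ^ (4 * m) dvd hh j * (hh 0 * F - hh 0 ^ n * (\<Sum>i<4. fps_const (\<kappa> i) * hh i)) + hh 0 ^ n * (hh j * R)"
      by (intro dvd_add dvd_mult k1 jR)
    ultimately have "fps_X ^ (4 * m) dvd hh 0 * prod_list (map hh (j # w)) - hh 0 ^ length (j # w) * (\<Sum>i<4. fps_const (\<kappa>' i) * hh i)"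
      by metis
    moreover have v0: "vec2 r 0 j = 0" for r using False by (simp add: vec2_def)
    moreover have "prod_list (map (vec2 r 0) (j # w)) = \<kappa>' 0 * r ^ length (j # w)" for r
      using False v0 by (simp add: \<kappa>'_def)
    moreover have "r * dir_deriv (\<lambda>y. prod_list (map y (j # w))) (vec2 r 0) \<eta> =
      r ^ length (j # w) * (of_nat (length (j # w)) * \<kappa>' 0 * \<eta> 0 + (\<Sum>i\<in>{1,2,3}. \<kappa>' i * \<eta> i))" for r \<eta>
    proof -
      have "(\<Sum>i\<in>{1,2,3}. \<kappa>' i * \<eta> i) = \<kappa> 0 * \<eta> j" using j by (auto simp: \<kappa>'_def)
      moreover have "\<kappa>' 0 = 0" using False by (simp add: \<kappa>'_def)
      ultimately show ?thesis unfolding prod_deriv k2 v0 by (simp add: n_def)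
    qed
    ultimately show ?thesis by blast
  qed
qed

text \<open>The orders of the rows of \<open>h\<close> are different and less than \<open>4 m\<close>, since \<open>m > 2\<close>.\<close>

lemma rows_independent_mod:
  assumes "fps_X ^ (4 * m) dvd (\<Sum>i<4. fps_const (\<kappa> i) * hh i)"
  shows "\<forall>i<4. \<kappa> i = 0"
proof -
  have low: "fps_nth (hh i) j = 0" if "i < 4" "j < pord m i" for i j
    using h_cusp that by (auto simp: cusp_coeffs_def coord_space_def cusp_index_def coeff_rows_def)
  have piv: "fps_nth (hh i) (pord m i) \<noteq> 0" if "i < 4" for i
    using h_cusp that by (auto simp: cusp_coeffs_def pivots_nonzero coeff_rows_def)
  have "(\<Sum>i<4. fps_const (\<kappa> i) * hh i) = fps_const (\<kappa> 0) * hh 0 + fps_const (\<kappa> 1) * hh 1 + fps_const (\<kappa> 2) * hh 2 + fps_const (\<kappa> 3) * hh 3"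
    by (simp add: numeral_eq_Suc)
  hence N: "\<kappa> 0 * fps_nth (hh 0) j + \<kappa> 1 * fps_nth (hh 1) j + \<kappa> 2 * fps_nth (hh 2) j + \<kappa> 3 * fps_nth (hh 3) j = 0"
    if "j < 4 * m" for j
    using assms that unfolding X_power_dvd_iff by simp
  have "\<kappa> 0 = 0" using N[of 0] low[of 1 0] low[of 2 0] low[of 3 0] piv[of 0] m by (simp add: pord_simps)
  moreover from this have "\<kappa> 1 = 0" using N[of "2 * m"] low[of 2 "2 * m"] low[of 3 "2 * m"] piv[of 1] m by (simp add: pord_simps)
  moreover from calculation have "\<kappa> 2 = 0" using N[of "2 * m + 2"] low[of 3 "2 * m + 2"] piv[of 2] m by (simp add: pord_simps)
  moreover from calculation have "\<kappa> 3 = 0" using N[of "2 * m + 4"] piv[of 3] m by (simp add: pord_simps)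
  ultimately show ?thesis unfolding all_less_4 by simp
qed

text \<open>The unipotent matrix taking the curve \<open>h\<close> to \<open>f\<close>.\<close>

definition coord_change :: "(nat \<Rightarrow> complex) \<Rightarrow> nat \<Rightarrow> complex"
  where "coord_change y i = (if i < 4 then y i + (\<Sum>l<i. b i l * y l) else 0)"

lemma coord_change_line: "coord_change (y + smul z \<eta>) = coord_change y + smul z (coord_change \<eta>)"
  by (auto simp: coord_change_def smul_def fun_eq_iff sum.distrib sum_distrib_left algebra_simps)

lemma coord_change_smul: "coord_change (smul r y) = smul r (coord_change y)"
  by (auto simp: coord_change_def smul_def fun_eq_iff sum_distrib_left algebra_simps)

lemma coord_change_surj:
  assumes "w \<in> coord_space {..<4}" shows "\<exists>\<eta> \<in> coord_space {..<4}. coord_change \<eta> = w"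
proof -
  define e0 where "e0 = w 0"
  define e1 where "e1 = w 1 - b 1 0 * e0"
  define e2 where "e2 = w 2 - (b 2 0 * e0 + b 2 1 * e1)"
  define e3 where "e3 = w 3 - (b 3 0 * e0 + b 3 1 * e1 + b 3 2 * e2)"
  define \<eta> where "\<eta> = (\<lambda>i :: nat. if i = 0 then e0 else if i = 1 then e1 else if i = 2 then e2 else if i = 3 then e3 else 0)"
  have "\<forall>i<4. coord_change \<eta> i = w i" unfolding all_less_4
    by (simp add: coord_change_def \<eta>_def e0_def e1_def e2_def e3_def numeral_eq_Suc)
  moreover have "coord_change \<eta> i = w i" if "\<not> i < 4" for i using assms that by (simp add: coord_change_def coord_space_def)
  ultimately have "coord_change \<eta> = w" by (auto simp: fun_eq_iff)
  moreover have "\<eta> \<in> coord_space {..<4}" by (auto simp: coord_space_def \<eta>_def)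
  ultimately show ?thesis by blast
qed

lemma poly_fun_coord_change: "(\<lambda>y. coord_change y i) \<in> poly_fun"
  by (cases "i < 4") (auto simp: coord_change_def intro!: poly_fun.intros poly_fun_sum)

lemma param_eq_coord_change: "param d f x = coord_change (param d h x)"
proof (rule ext)
  fix i
  show "param d f x i = coord_change (param d h x) i"
  proof (cases "i < 4")
    case True
    have p: "param d h x i = bin_eval d (hh i) x" for i by (simp add: param_def bin_eval_def coeff_rows_def)
    have add: "bin_eval d (F + G) x = bin_eval d F x + bin_eval d G x" for F G
      by (simp add: bin_eval_def sum.distrib algebra_simps)
    show ?thesis unfolding param_eq_bin_eval rows_f[OF True] add bin_eval_sum coord_change_def p using True by simp
  next
    case False
    thus ?thesis using param_coord_space[of x] by (simp add: coord_change_def coord_space_def)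
  qed
qed

lemma param_h_cusp: "param d h (vec2 1 0) = vec2 (h (0, 0)) 0"
proof (rule ext)
  fix i
  have "param d h (vec2 1 0) i = (\<Sum>j\<le>d. if j = 0 then h (i, 0) else 0)"
    unfolding param_def by (intro sum.cong) auto
  moreover have "h (i, 0) = 0" if "i \<noteq> 0"
    using h_cusp m that by (auto simp: cusp_coeffs_def coord_space_def cusp_index_def pord_def)
  ultimately show "param d h (vec2 1 0) i = vec2 (h (0, 0)) 0 i" by (auto simp: vec2_def)
qed

lemma param_h_coord_space: "param d h x \<in> coord_space {..<4}"
  using h_coord by (auto simp: coord_space_def param_def param_index_def)

text \<open>In the coordinates of \<open>h\<close>, a form vanishing on the curve has no terms of order at most one at the cusp: they
  would be a relation between the rows of \<open>h\<close> modulo order \<open>4 m\<close>.\<close>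

lemma gradient_at_cusp:
  assumes "p \<in> hom_poly n" "\<forall>u\<in>\<Union>C. p u = 0" "w \<in> coord_space {..<4}" "r \<noteq> 0"
  shows "dir_deriv p (smul r (param d f (vec2 1 0))) w = 0"
proof -
  define q where "q = (\<lambda>y. p (coord_change y))"
  have q: "q \<in> hom_poly n"
    using assms(1) poly_fun_subst[OF hom_poly_imp_poly_fun[OF assms(1)] poly_fun_coord_change]
    by (auto simp: q_def hom_poly_def coord_change_smul)
  obtain A a where A: "finite A" "\<And>w. w \<in> A \<Longrightarrow> set w \<subseteq> {..<4} \<and> length w = n"
    "\<And>v. v \<in> coord_space {..<4} \<Longrightarrow> q v = (\<Sum>w\<in>A. a w * prod_list (map v w))"
    using hom_poly_words[OF q, of "{..<4}"] by metis
  define F where "F = (\<Sum>w\<in>A. fps_const (a w) * prod_list (map hh w))"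
  have word: "bin_eval (length w * d) (prod_list (map hh w)) x = prod_list (map (param d h x) w)
    \<and> deg_le (length w * d) (prod_list (map hh w))" for w x
  proof (induction w)
    case Nil
    show ?case by (simp add: bin_eval_def deg_le_def)
  next
    case (Cons i w)
    have p: "param d h x i = bin_eval d (hh i) x" by (simp add: param_def bin_eval_def coeff_rows_def)
    show ?case using Cons bin_eval_mult[OF deg_le_hh, of "length w * d" "prod_list (map hh w)" i x]
        deg_le_mult(1)[OF deg_le_hh, of "length w * d" "prod_list (map hh w)" i]
      by (simp add: p)
  qed
  have "F = 0"
  proof (rule bin_eval_eq_0_imp)
    show "deg_le (n * d) F" unfolding F_def deg_le_def fps_sum_nth
    proof (intro allI impI sum.neutral ballI)
      fix j w assume "n * d < j" "w \<in> A"
      thus "fps_nth (fps_const (a w) * prod_list (map hh w)) j = 0"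
        using word[of w undefined] A(2)[of w] deg_leD[of "n * d" "prod_list (map hh w)" j] by simp
    qed
    fix t
    have "bin_eval (n * d) F (vec2 1 t) = (\<Sum>w\<in>A. a w * prod_list (map (param d h (vec2 1 t)) w))"
      unfolding F_def bin_eval_sum
    proof (intro sum.cong refl)
      fix w assume "w \<in> A"
      thus "a w * bin_eval (n * d) (prod_list (map hh w)) (vec2 1 t) = a w * prod_list (map (param d h (vec2 1 t)) w)"
        using word[of w "vec2 1 t"] A(2)[of w] by auto
    qed
    also have "\<dots> = p (param d f (vec2 1 t))" by (simp add: A(3)[OF param_h_coord_space, symmetric] q_def param_eq_coord_change)
    also have "\<dots> = 0" using assms(2) param_cone[of "vec2 1 t"] vec2_nonzero[of 1 t] by auto
    finally show "bin_eval (n * d) F (vec2 1 t) = 0" .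
  qed
  have "\<forall>w\<in>A. \<exists>\<kappa>. fps_X ^ (4 * m) dvd hh 0 * prod_list (map hh w) - hh 0 ^ n * (\<Sum>i<4. fps_const (\<kappa> i) * hh i) \<and>
    (\<forall>r \<eta>. r * dir_deriv (\<lambda>y. prod_list (map y w)) (vec2 r 0) \<eta> =
      r ^ n * (of_nat n * \<kappa> 0 * \<eta> 0 + (\<Sum>i\<in>{1,2,3}. \<kappa> i * \<eta> i)))"
    using word_first_order A(2) by blast
  from bchoice[OF this] obtain \<kappa> where
    \<kappa>: "\<forall>w\<in>A. fps_X ^ (4 * m) dvd hh 0 * prod_list (map hh w) - hh 0 ^ n * (\<Sum>i<4. fps_const (\<kappa> w i) * hh i) \<and>
    (\<forall>r \<eta>. r * dir_deriv (\<lambda>y. prod_list (map y w)) (vec2 r 0) \<eta> =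
      r ^ n * (of_nat n * \<kappa> w 0 * \<eta> 0 + (\<Sum>i\<in>{1,2,3}. \<kappa> w i * \<eta> i)))" ..
  define K where "K = (\<lambda>i. \<Sum>w\<in>A. a w * \<kappa> w i)"
  have "fps_X ^ (4 * m) dvd (\<Sum>w\<in>A. fps_const (a w) * (hh 0 * prod_list (map hh w) - hh 0 ^ n * (\<Sum>i<4. fps_const (\<kappa> w i) * hh i)))"
    using \<kappa> by (intro dvd_sum dvd_mult) auto
  also have "(\<Sum>w\<in>A. fps_const (a w) * (hh 0 * prod_list (map hh w) - hh 0 ^ n * (\<Sum>i<4. fps_const (\<kappa> w i) * hh i))) =
    hh 0 * F - hh 0 ^ n * (\<Sum>w\<in>A. \<Sum>i<4. fps_const (a w * \<kappa> w i) * hh i)"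
    unfolding F_def sum_distrib_left right_diff_distrib sum_subtractf
    by (simp add: mult_ac fps_const_mult[symmetric] del: fps_const_mult)
  also have "(\<Sum>w\<in>A. \<Sum>i<4. fps_const (a w * \<kappa> w i) * hh i) = (\<Sum>i<4. fps_const (K i) * hh i)"
    unfolding K_def fps_const_of_sum sum_distrib_right by (rule sum.swap)
  finally have "fps_X ^ (4 * m) dvd hh 0 ^ n * (\<Sum>i<4. fps_const (K i) * hh i)"
    unfolding \<open>F = 0\<close> by (simp add: dvd_minus_iff)
  moreover have "is_unit (hh 0 ^ n)" using row0 by (simp add: is_unit_power_iff)
  ultimately have "fps_X ^ (4 * m) dvd (\<Sum>i<4. fps_const (K i) * hh i)"
    by (simp add: dvd_mult_unit_iff' mult.commute dvd_mult_unit_iff)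
  hence K: "\<forall>i<4. K i = 0" by (rule rows_independent_mod)
  obtain \<eta> where \<eta>: "\<eta> \<in> coord_space {..<4}" "coord_change \<eta> = w" using coord_change_surj[OF assms(3)] by blast
  define s where "s = r * h (0, 0)"
  have h0: "h (0, 0) \<noteq> 0" using row0 by (simp add: coeff_rows_def)
  have sv: "smul r (vec2 (h (0, 0)) 0) = vec2 s 0" by (auto simp: smul_def vec2_def s_def)
  have base: "smul r (param d f (vec2 1 0)) = coord_change (vec2 s 0)"
    unfolding param_eq_coord_change param_h_cusp coord_change_smul[symmetric] sv ..
  have "dir_deriv p (smul r (param d f (vec2 1 0))) w = dir_deriv q (vec2 s 0) \<eta>"
    unfolding dir_deriv_def base \<eta>(2)[symmetric] coord_change_line[symmetric] q_def ..
  also have "\<dots> = (\<Sum>w\<in>A. a w * dir_deriv (\<lambda>y. prod_list (map y w)) (vec2 s 0) \<eta>)"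
  proof (rule dir_deriv_eqI)
    have in4: "vec2 s 0 + smul z \<eta> \<in> coord_space {..<4}" for z
      using \<eta>(1) by (auto simp: coord_space_def vec2_def smul_def)
    show "((\<lambda>z. q (vec2 s 0 + smul z \<eta>)) has_field_derivative
      (\<Sum>w\<in>A. a w * dir_deriv (\<lambda>y. prod_list (map y w)) (vec2 s 0) \<eta>)) (at 0)"
      unfolding A(3)[OF in4]
      by (intro DERIV_sum DERIV_cmult has_dir_deriv hom_poly_imp_poly_fun[OF hom_poly_word])
  qed
  also have "s * \<dots> = (\<Sum>w\<in>A. a w * (s ^ n * (of_nat n * \<kappa> w 0 * \<eta> 0 + (\<Sum>i\<in>{1,2,3}. \<kappa> w i * \<eta> i))))"
    unfolding sum_distrib_left[of s]
  proof (intro sum.cong refl)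
    fix w assume "w \<in> A"
    hence e: "s * dir_deriv (\<lambda>y. prod_list (map y w)) (vec2 s 0) \<eta> =
      s ^ n * (of_nat n * \<kappa> w 0 * \<eta> 0 + (\<Sum>i\<in>{1,2,3}. \<kappa> w i * \<eta> i))" using \<kappa> by blast
    show "s * (a w * dir_deriv (\<lambda>y. prod_list (map y w)) (vec2 s 0) \<eta>) =
      a w * (s ^ n * (of_nat n * \<kappa> w 0 * \<eta> 0 + (\<Sum>i\<in>{1,2,3}. \<kappa> w i * \<eta> i)))"
      unfolding mult.left_commute[of s] e ..
  qed
  also have "\<dots> = s ^ n * (of_nat n * K 0 * \<eta> 0 + (\<Sum>i\<in>{1,2,3}. K i * \<eta> i))"
    unfolding K_def by (simp add: sum.distrib sum_distrib_left sum_distrib_right algebra_simps)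
  also have "\<dots> = 0" using K by simp
  finally have "s * dir_deriv p (smul r (param d f (vec2 1 0))) w = 0" .
  thus ?thesis using h0 assms(4) by (simp add: s_def)
qed

lemma tangent_dim_cusp:
  assumes "r \<noteq> 0"
  shows "cfun.dim (cone_tangent_space C (smul r (param d f (vec2 1 0)))) = 4"
proof -
  have "cone_tangent_space C (smul r (param d f (vec2 1 0))) = coord_space {..<4}"
    unfolding cone_tangent_space_def using gradient_at_cusp[OF _ _ _ assms] unfolding dir_deriv_def by auto
  moreover have "cfun.dim (coord_space {..<4 :: nat}) = card {..<4 :: nat}"
  proof (rule cfun_dim_family[where e = "\<lambda>k i. if i = k then 1 else 0"])
    show "coord_space {..<4} \<subseteq> cfun.span ((\<lambda>k i. if i = k then 1 else 0) ` {..<4 :: nat})"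
    proof
      fix v :: "nat \<Rightarrow> complex" assume v: "v \<in> coord_space {..<4}"
      have "v = (\<Sum>k<4. smul (v k) (\<lambda>i. if i = k then 1 else 0))"
      proof (rule ext)
        fix i
        have "(\<Sum>k<4. smul (v k) (\<lambda>i. if i = k then 1 else 0)) i = (\<Sum>k<4. if k = i then v i else 0)"
          unfolding sum_fun_apply smul_def by (intro sum.cong) auto
        thus "v i = (\<Sum>k<4. smul (v k) (\<lambda>i. if i = k then 1 else 0)) i"
          using v by (auto simp: coord_space_def)
      qed
      moreover have "(\<Sum>k<4. smul (v k) (\<lambda>i. if i = k then 1 else 0)) \<in>
          cfun.span ((\<lambda>k i. if i = k then 1 else 0) ` {..<4 :: nat})"
        by (intro cfun.span_sum cfun.span_scale cfun.span_base) auto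
      ultimately show "v \<in> cfun.span ((\<lambda>k i. if i = k then 1 else 0) ` {..<4 :: nat})" by (simp only:)
    qed
    fix x :: "nat \<Rightarrow> complex" and i :: nat
    assume *: "\<And>a :: nat. (\<Sum>k<4. x k * (if a = k then 1 else 0)) = 0" and i: "i \<in> {..<4}"
    have "(\<Sum>k<4. x k * (if i = k then 1 else 0)) = (\<Sum>k<4. if k = i then x i else 0)"
      by (intro sum.cong) auto
    thus "x i = 0" using *[of i] i by simp
  qed (auto simp: coord_space_def)
  ultimately show ?thesis by simp
qed

abbreviation "cusp_pt \<equiv> proj_pt (param d f (vec2 1 0))"

text \<open>There is a form which restricts to a power of \<open>t\<close>.\<close>

lemma preimage_of_cusp:
  assumes "x \<in> coord_space {..<2}" "proj_pt (param d f x) = cusp_pt"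
  shows "x 1 = 0"
proof -
  obtain n V where V: "n \<ge> 1" "V \<in> hom_poly n" "\<And>x. V (param d f x) = x 1 ^ (n * d)"
    using coordinate_forms by blast
  have "n * d > 0" using V(1) d by simp
  hence "V (param d f (vec2 1 0)) = 0" using V(3) by simp
  moreover have "param d f x \<in> cusp_pt" using assms(2) proj_pt_self by metis
  ultimately have "V (param d f x) = 0" using hom_poly_zero_on_proj_pt[OF V(2)] by blast
  thus ?thesis using V(3) by simp
qed

lemma singular_points_eq: "singular_points C = {cusp_pt}"
proof (intro set_eqI iffI)
  fix P assume P: "P \<in> singular_points C"
  then obtain x where x: "x \<in> coord_space {..<2}" "x \<noteq> 0" "P = proj_pt (param d f x)"
    and sing: "\<And>v. v \<in> P \<Longrightarrow> cfun.dim (cone_tangent_space C v) \<noteq> 2"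
    by (auto simp: singular_points_def image_curve_def)
  have x2: "vec2 (x 0) (x 1) = x" using vec2_eta[OF x(1)] .
  have "x 1 = 0"
  proof (rule ccontr)
    assume "x 1 \<noteq> 0"
    from tangent_dim_smooth[OF this, of 1 "x 0"] sing[of "smul 1 (param d f x)"] show False
      unfolding x2 using x(3) proj_pt_self[of "param d f x"] by (simp add: smul_def)
  qed
  hence x0: "x = vec2 (x 0) 0" using x2 by simp
  hence "x 0 \<noteq> 0" using x(2) vec2_nonzero[of "x 0" 0] by metis
  moreover have "param d f x = smul (x 0 ^ d) (param d f (vec2 1 0))"
    using param_at_cusp[of "x 0"] unfolding x0[symmetric] .
  ultimately have "param d f x \<in> cusp_pt" by (auto simp: proj_pt_def)
  thus "P \<in> {cusp_pt}" using proj_pt_eq x(3) by auto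
next
  fix P assume "P \<in> {cusp_pt}"
  moreover have "cusp_pt \<in> C" unfolding image_curve_def using vec2_nonzero[of 1 0]
    by (intro CollectI exI[of _ "vec2 1 0"]) simp
  moreover have "cfun.dim (cone_tangent_space C v) \<noteq> 2" if "v \<in> cusp_pt" for v
    using that tangent_dim_cusp by (auto simp: proj_pt_def)
  ultimately show "P \<in> singular_points C" by (auto simp: singular_points_def)
qed

text \<open>With \<open>x 1 = 0\<close>, the vectors \<open>x + t y\<close> and \<open>(1, \<tau>(t))\<close> span the same line.\<close>

lemma param_fps_compose:
  fixes x y :: "nat \<Rightarrow> complex"
  assumes "x 1 = 0" "x 0 \<noteq> 0"
  defines "u \<equiv> fps_const (x 0) + fps_const (y 0) * fps_X"
  shows "param_fps d f x y i = u ^ d * (ff i oo (fps_const (y 1) * fps_X / u))"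
    "fps_nth (fps_const (y 1) * fps_X / u) 0 = 0" "fps_nth u 0 \<noteq> 0"
proof -
  show u0: "fps_nth u 0 \<noteq> 0" using assms by (simp add: u_def)
  define \<tau> where "\<tau> = fps_const (y 1) * fps_X / u"
  have ut: "u * \<tau> = fps_const (y 1) * fps_X"
    using u0 by (simp add: \<tau>_def fps_divide_unit mult.left_commute inverse_mult_eq_1')
  show t0: "fps_nth (fps_const (y 1) * fps_X / u) 0 = 0"
    using u0 by (simp add: fps_divide_unit)
  have ff: "ff i = (\<Sum>j\<le>d. fps_const (f (i, j)) * fps_X ^ j)"
  proof (rule fps_ext)
    fix k
    have "fps_nth (\<Sum>j\<le>d. fps_const (f (i, j)) * fps_X ^ j) k = (\<Sum>j\<le>d. if j = k then f (i, k) else 0)"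
      unfolding fps_sum_nth by (intro sum.cong) (auto simp: fps_X_power_nth)
    also have "\<dots> = f (i, k)" using f_coord by (auto simp: coord_space_def param_index_def)
    finally show "fps_nth (ff i) k = fps_nth (\<Sum>j\<le>d. fps_const (f (i, j)) * fps_X ^ j) k"
      by (simp add: coeff_rows_def)
  qed
  have "ff i oo \<tau> = (\<Sum>j\<le>d. fps_const (f (i, j)) * \<tau> ^ j)"
    unfolding ff fps_compose_sum_distrib using t0 
    by (intro sum.cong refl) (simp add: fps_compose_mult_distrib fps_X_power_compose \<tau>_def)
  hence "u ^ d * (ff i oo \<tau>) = (\<Sum>j\<le>d. fps_const (f (i, j)) * (u ^ d * \<tau> ^ j))"
    by (simp add: sum_distrib_left mult.left_commute)
  also have "\<dots> = (\<Sum>j\<le>d. fps_const (f (i, j)) * u ^ (d - j) * (fps_const (x 1) + fps_const (y 1) * fps_X) ^ j)"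
  proof (intro sum.cong refl)
    fix j assume "j \<in> {..d}"
    hence "u ^ d = u ^ (d - j) * u ^ j" by (simp flip: power_add)
    hence "u ^ d * \<tau> ^ j = u ^ (d - j) * (u * \<tau>) ^ j" by (simp add: power_mult_distrib mult.assoc)
    thus "fps_const (f (i, j)) * (u ^ d * \<tau> ^ j) =
        fps_const (f (i, j)) * u ^ (d - j) * (fps_const (x 1) + fps_const (y 1) * fps_X) ^ j"
      unfolding ut using assms(1) by (simp add: mult.assoc)
  qed
  finally show "param_fps d f x y i = u ^ d * (ff i oo (fps_const (y 1) * fps_X / u))"
    by (simp add: param_fps_def u_def \<tau>_def)
qed

lemma ff0_unit: "fps_nth (ff 0) 0 \<noteq> 0"
  using row0 rows_explicit(1) by simp

definition cusp_triple :: "nat \<Rightarrow> complex fps"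
  where "cusp_triple i = ff (Suc i) / ff 0 - fps_const (fps_nth (ff (Suc i) / ff 0) 0)"

lemma local_param_compose:
  assumes "x 1 = 0" "x 0 \<noteq> 0"
  shows "\<exists>\<tau>. fps_nth \<tau> 0 = 0 \<and> (\<forall>i. local_param d f 0 x y i = cusp_triple i oo \<tau>)"
proof -
  define u where "u = fps_const (x 0) + fps_const (y 0) * fps_X"
  define \<tau> where "\<tau> = fps_const (y 1) * fps_X / u"
  note comp = param_fps_compose[of x y, OF assms, folded u_def, folded \<tau>_def]
  have "local_param d f 0 x y i = cusp_triple i oo \<tau>" for i
  proof -
    have un: "u \<noteq> 0" using comp(3) by auto
    have B0: "fps_nth (ff 0 oo \<tau>) 0 \<noteq> 0" using ff0_unit by simp
    have "param_fps d f x y (Suc i) / param_fps d f x y 0 = (ff (Suc i) oo \<tau>) / (ff 0 oo \<tau>)"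
      unfolding comp(1) using un by simp
    also have "\<dots> = (ff (Suc i) / ff 0) oo \<tau>"
      using fps_divide_compose[of \<tau> "ff 0" "ff (Suc i)"] comp(2) ff0_unit by simp
    finally have "param_fps d f x y (Suc i) / param_fps d f x y 0 = (ff (Suc i) / ff 0) oo \<tau>" .
    thus ?thesis by (simp add: local_param_def cusp_triple_def Let_def fps_compose_sub_distrib)
  qed
  thus ?thesis using comp(2) by blast
qed

lemma cusp_of_curve:
  assumes "finite (UNIV - semigroup_of ff)"
  shows "cusp_of_image d f cusp_pt (semigroup_of ff)"
  unfolding cusp_of_image_def
proof (intro conjI exI[of _ "0 :: nat"] exI[of _ cusp_triple] allI impI ballI)
  show "cusp_pt \<in> singular_points C" by (simp add: singular_points_eq)
  show "v 0 \<noteq> 0" if "v \<in> cusp_pt" for v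
    using that param_cusp_0 cusp_coord_nonzero by (auto simp: proj_pt_def smul_def)
  show "fps_nth (cusp_triple i) 0 = 0" for i by (simp add: cusp_triple_def)
  have "value_semigroup cusp_triple = semigroup_of ff"
    unfolding cusp_triple_def[abs_def] by (rule value_semigroup_quotients[where f = ff, OF ff0_unit])
  thus "value_semigroup cusp_triple = semigroup_of ff" "finite (UNIV - value_semigroup cusp_triple)"
    using assms by simp_all
  fix x y :: "nat \<Rightarrow> complex"
  assume x: "x \<in> coord_space {..<2}"
    and xy: "x 0 * y 1 - x 1 * y 0 \<noteq> 0 \<and> proj_pt (param d f x) = cusp_pt"
  have "x 1 = 0" by (rule preimage_of_cusp[OF x]) (use xy in simp)
  moreover from this xy have "x 0 \<noteq> 0" by auto
  ultimately show "\<exists>\<tau>. fps_nth \<tau> 0 = 0 \<and> (\<forall>i<3. local_param d f 0 x y i = cusp_triple i oo \<tau>)"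
    using local_param_compose by blast
qed auto

theorem in_severi:
  assumes "finite (UNIV - semigroup_of hh)"
  shows "proj_pt f \<in> severi d (card (UNIV - semigroup_of hh)) (semigroup_of hh)"
  unfolding severi_def
  using nondegenerate arith_genus cusp_of_curve singular_points_eq assms unfolding semigroup_eq by blast

end

section \<open>The family of curves with a cusp at a fixed point\<close>

text \<open>The coordinates on the family: the coefficients of \<open>h\<close>, and six more slots for the entries of a
  unipotent matrix, the entry \<open>(i, l)\<close> being stored in place of the coefficient of row \<open>i\<close> at the pivot of
  row \<open>l\<close>.\<close>

definition family_index :: "nat \<Rightarrow> nat \<Rightarrow> (nat \<times> nat) set"
  where "family_index m d = {(i, j). i < 4 \<and> j \<le> d \<and> (pord m i \<le> j \<or> (\<exists>l<i. j = pord m l))}"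

definition cusp_part :: "nat \<Rightarrow> (nat \<times> nat \<Rightarrow> complex) \<Rightarrow> nat \<times> nat \<Rightarrow> complex"
  where "cusp_part m y = (\<lambda>(i, j). if i < 4 \<and> pord m i \<le> j then y (i, j) else 0)"

definition unipotent_entry :: "nat \<Rightarrow> (nat \<times> nat \<Rightarrow> complex) \<Rightarrow> nat \<Rightarrow> nat \<Rightarrow> complex"
  where "unipotent_entry m y i l = y (i, pord m l)"

definition family :: "nat \<Rightarrow> (nat \<times> nat \<Rightarrow> complex) \<Rightarrow> nat \<times> nat \<Rightarrow> complex"
  where "family m y = (\<lambda>(i, j). if i < 4 then cusp_part m y (i, j) + (\<Sum>l<i. unipotent_entry m y i l * cusp_part m y (l, j)) else 0)"

lemma finite_family_index: "finite (family_index m d)"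
  by (rule finite_subset[of _ "{..<4} \<times> {..d}"]) (auto simp: family_index_def)

text \<open>There are \<open>6 m + 6\<close> vanishing conditions, and six matrix entries.\<close>

lemma card_family_index:
  assumes "d \<ge> 2 * m + 4" "m \<ge> 1"
  shows "card (family_index m d) = 4 * (d + 1) - 6 * m"
proof -
  define R where "R = (\<lambda>i. {pord m i..d} \<union> pord m ` {..<i})"
  have eq: "family_index m d = Sigma {..<4} R"
  proof (intro set_eqI iffI)
    fix x assume "x \<in> family_index m d"
    thus "x \<in> Sigma {..<4} R" by (auto simp: family_index_def R_def)
  next
    fix x assume "x \<in> Sigma {..<4} R"
    moreover have "pord m l \<le> d" if "l < 4" for l using assms that by (auto simp: pord_def)
    ultimately show "x \<in> family_index m d" by (auto simp: family_index_def R_def)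
  qed
  have "card (R i) = d + 1 - pord m i + i" if "i < 4" for i
  proof -
    have inj: "inj_on (pord m) {..<i}" using assms by (auto simp: inj_on_def pord_def split: if_splits)
    have "{pord m i..d} \<inter> pord m ` {..<i} = {}" using assms by (auto simp: pord_def split: if_splits)
    hence "card (R i) = card {pord m i..d} + card (pord m ` {..<i})"
      unfolding R_def by (intro card_Un_disjoint) auto
    thus ?thesis using card_image[OF inj] by simp
  qed
  hence "card (family_index m d) = (\<Sum>i<4. d + 1 - pord m i + i)"
    unfolding eq by (subst card_SigmaI) (auto simp: R_def)
  also have "\<dots> = (d + 1) + (d + 1 - 2 * m + 1) + (d + 1 - (2 * m + 2) + 2) + (d + 1 - (2 * m + 4) + 3)"
    by (simp add: numeral_eq_Suc pord_def)
  also have "\<dots> = 4 * (d + 1) - 6 * m" using assms by simp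
  finally show ?thesis .
qed

lemma poly_fun_cusp_part: "(\<lambda>y. cusp_part m y i) \<in> poly_fun"
  by (cases i; cases "fst i < 4 \<and> pord m (fst i) \<le> snd i") (auto simp: cusp_part_def intro: poly_fun.intros)

lemma poly_fun_family: "(\<lambda>y. family m y i) \<in> poly_fun"
proof (cases i)
  case (Pair k j)
  show ?thesis
  proof (cases "k < 4")
    case True
    thus ?thesis unfolding Pair family_def unipotent_entry_def
      by (auto intro!: poly_fun.add poly_fun_sum poly_fun.mult poly_fun_cusp_part poly_fun.coord)
  qed (auto simp: Pair family_def intro: poly_fun.const)
qed

lemma cusp_part_in:
  assumes "y \<in> coord_space (family_index m d)" "pivots m y \<noteq> 0"
  shows "cusp_part m y \<in> cusp_coeffs m" "cusp_part m y \<in> coord_space (param_index d)"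
proof -
  show "cusp_part m y \<in> cusp_coeffs m"
    using assms(2) by (auto simp: cusp_coeffs_def coord_space_def cusp_index_def cusp_part_def pivots_nonzero)
  show "cusp_part m y \<in> coord_space (param_index d)"
    using assms(1) by (auto simp: coord_space_def cusp_part_def param_index_def family_index_def)
qed

lemma family_in:
  assumes "y \<in> coord_space (family_index m d)"
  shows "family m y \<in> coord_space (param_index d)"
proof -
  have "cusp_part m y (i, j) = 0" if "d < j" for i j
    using assms that by (auto simp: coord_space_def cusp_part_def family_index_def)
  thus ?thesis by (auto simp: coord_space_def family_def param_index_def not_le)
qed

lemma coeff_rows_family:
  assumes "i < 4"
  shows "coeff_rows (family m y) i = coeff_rows (cusp_part m y) i +
    (\<Sum>l<i. fps_const (unipotent_entry m y i l) * coeff_rows (cusp_part m y) l)"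
  using assms by (simp add: fps_eq_iff coeff_rows_def family_def fps_sum_nth)

lemma cusp_part_self:
  assumes "a \<in> cusp_coeffs m" shows "cusp_part m a = a"
  using assms by (auto simp: cusp_coeffs_def coord_space_def cusp_index_def cusp_part_def fun_eq_iff)

lemma cusp_coeffs_in_family:
  assumes "a \<in> cusp_coeffs m" "a \<in> coord_space (param_index d)"
  shows "a \<in> coord_space (family_index m d)"
proof -
  have "a (i, j) = 0" if "(i, j) \<notin> family_index m d" for i j
  proof (cases "(i, j) \<in> cusp_index m")
    case True
    hence "(i, j) \<notin> param_index d" using that by (auto simp: cusp_index_def family_index_def param_index_def)
    thus ?thesis using assms(2) by (auto simp: coord_space_def)
  next
    case False
    thus ?thesis using assms(1) by (auto simp: coord_space_def cusp_coeffs_def)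
  qed
  thus ?thesis by (auto simp: coord_space_def)
qed

lemma triangular_solvable:
  fixes M :: "nat \<Rightarrow> nat \<Rightarrow> complex"
  assumes "\<And>t. t < n \<Longrightarrow> M t t \<noteq> 0"
  shows "\<exists>x. \<forall>t<n. (\<Sum>l\<le>t. x l * M l t) = c t"
  using assms
proof (induction n)
  case (Suc n)
  then obtain x where x: "\<forall>t<n. (\<Sum>l\<le>t. x l * M l t) = c t" by auto
  define y where "y = x(n := (c n - (\<Sum>l<n. x l * M l n)) / M n n)"
  have "(\<Sum>l\<le>t. y l * M l t) = c t" if "t < Suc n" for t
  proof (cases "t = n")
    case True
    have "(\<Sum>l<n. y l * M l n) = (\<Sum>l<n. x l * M l n)" by (intro sum.cong) (auto simp: y_def)
    thus ?thesis using Suc.prems[of n] by (simp add: True lessThan_Suc_atMost[symmetric]) (simp add: y_def)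
  next
    case False
    hence "(\<Sum>l\<le>t. y l * M l t) = (\<Sum>l\<le>t. x l * M l t)" using that
      by (intro sum.cong) (auto simp: y_def)
    thus ?thesis using x False that by simp
  qed
  thus ?case by blast
qed auto

text \<open>The parameterization \<open>family\<close> is decomposed into steps that change a single row, so that dominance can be
  proved row by row.\<close>

definition row_step :: "nat \<Rightarrow> nat \<Rightarrow> nat \<Rightarrow> (nat \<times> nat \<Rightarrow> complex) \<Rightarrow> nat \<times> nat \<Rightarrow> complex"
  where "row_step m d k y = (\<lambda>i. if i \<in> family_index m d then
    (if fst i = k then family m y i else y i) else 0)"

lemma poly_fun_row_step: "(\<lambda>y. row_step m d k y i) \<in> poly_fun"
  by (cases "i \<in> family_index m d"; cases "fst i = k")
    (auto simp: row_step_def intro: poly_fun_family poly_fun.intros)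

lemma row_step_in: "row_step m d k y \<in> coord_space (family_index m d)"
  by (auto simp: coord_space_def row_step_def)

text \<open>The entries of row \<open>k\<close> of the matrix solve a triangular system whose diagonal consists of pivots of \<open>y\<close>.\<close>

lemma row_step_surj:
  assumes "y \<in> coord_space (family_index m d)" "pivots m y \<noteq> 0" "k < 4" "m \<ge> 1" "d \<ge> 2 * m + 4"
  shows "\<exists>b \<in> coord_space (family_index m d). row_step m d k b = y"
proof -
  define M where "M = (\<lambda>l t. cusp_part m y (l, pord m t))"
  have piv: "M t t \<noteq> 0" if "t < k" for t
    using assms(2,3) that by (auto simp: M_def cusp_part_def pivots_nonzero)
  obtain x where x: "\<And>t. t < k \<Longrightarrow> (\<Sum>l\<le>t. x l * M l t) = y (k, pord m t)"
    using triangular_solvable[of k M "\<lambda>t. y (k, pord m t)"] piv by blast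
  have mono: "pord m l < pord m t" if "l < t" for l t using that assms(4) by (auto simp: pord_def)
  have inj: "pord m l = pord m t \<longleftrightarrow> l = t" for l t using mono[of l t] mono[of t l] by (cases l t rule: linorder_cases) auto
  define b where "b = (\<lambda>(i, j). if i = k then
      (if pord m k \<le> j then y (k, j) - (\<Sum>l<k. x l * cusp_part m y (l, j))
       else if \<exists>l<k. j = pord m l then x (THE l. l < k \<and> j = pord m l) else 0)
    else y (i, j))"
  have cp: "cusp_part m b (l, j) = cusp_part m y (l, j)" if "l < k" for l j
    using that by (auto simp: cusp_part_def b_def)
  have un: "unipotent_entry m b k l = x l" if "l < k" for l
  proof -
    have "\<not> pord m k \<le> pord m l" using mono[OF that] by simp
    moreover have "(THE l'. l' < k \<and> pord m l = pord m l') = l"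
      using that by (intro the_equality) (auto simp: inj)
    ultimately show ?thesis using that by (auto simp: unipotent_entry_def b_def)
  qed
  have b_in: "b \<in> coord_space (family_index m d)"
  proof -
    have "b (i, j) = 0" if "(i, j) \<notin> family_index m d" for i j
    proof (cases "i = k")
      case True
      have pd: "pord m l \<le> d" if "l < k" for l using assms(3,5) that by (auto simp: pord_def)
      have y0: "y (k, j) = 0" using that assms(1) True by (auto simp: coord_space_def)
      show ?thesis
      proof (cases "pord m k \<le> j")
        case le: True
        hence "\<not> j \<le> d" using that True assms(3) by (auto simp: family_index_def)
        hence "cusp_part m y (l, j) = 0" for l
          using assms(1) by (auto simp: coord_space_def cusp_part_def family_index_def)
        thus ?thesis using le y0 True by (simp add: b_def)
      next
        case False
        hence "\<not> (\<exists>l<k. j = pord m l)" using that True assms(3) pd by (auto simp: family_index_def)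
        thus ?thesis using False True by (auto simp: b_def)
      qed
    next
      case False
      thus ?thesis using that assms(1) by (auto simp: coord_space_def b_def)
    qed
    thus ?thesis by (auto simp: coord_space_def)
  qed
  have "row_step m d k b i = y i" for i
  proof (cases i)
    case (Pair i' j)
    show ?thesis
    proof (cases "i \<in> family_index m d")
      case False
      thus ?thesis using assms(1) by (cases i) (auto simp: row_step_def coord_space_def)
    next
      case True
      show ?thesis
      proof (cases "i' = k")
        case k: True
        have fam: "row_step m d k b i = cusp_part m b (k, j) + (\<Sum>l<k. x l * cusp_part m y (l, j))"
          using True k assms(3) un cp by (simp add: row_step_def Pair family_def)
        show ?thesis
        proof (cases "pord m k \<le> j")
          case True
          thus ?thesis unfolding fam using assms(3) by (simp add: cusp_part_def b_def Pair k)
        next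
          case False
          then obtain t where t: "t < k" "j = pord m t" using True k by (auto simp: family_index_def Pair)
          have "(\<Sum>l<k. x l * cusp_part m y (l, j)) = (\<Sum>l\<le>t. x l * M l t)"
          proof (rule sum.mono_neutral_cong_right)
            show "\<forall>l\<in>{..<k} - {..t}. x l * cusp_part m y (l, j) = 0"
            proof
              fix l assume "l \<in> {..<k} - {..t}"
              hence "\<not> pord m l \<le> j" using mono[of t l] t by auto
              thus "x l * cusp_part m y (l, j) = 0" by (simp add: cusp_part_def)
            qed
          qed (use t in \<open>auto simp: M_def\<close>)
          thus ?thesis unfolding fam x[OF t(1)] using False t by (simp add: cusp_part_def Pair k)
        qed
      qed (use True in \<open>auto simp: row_step_def Pair b_def\<close>)
    qed
  qed
  thus ?thesis using b_in by blast
qed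

lemma row_step_dominant:
  assumes "q \<in> poly_fun" "y \<in> coord_space (family_index m d)" "q y \<noteq> 0" "k < 4" "m \<ge> 1" "d \<ge> 2 * m + 4"
  shows "\<exists>b \<in> coord_space (family_index m d). q (row_step m d k b) \<noteq> 0"
proof -
  define one where "one = (\<lambda>i. if i \<in> family_index m d then 1 else 0 :: complex)"
  have "pord m i \<le> d" if "i < 4" for i using that assms(6) by (auto simp: pord_def)
  hence "pivots m one \<noteq> 0" by (auto simp: pivots_nonzero one_def family_index_def)
  moreover have "one \<in> coord_space (family_index m d)" by (auto simp: one_def coord_space_def)
  ultimately obtain z where z: "z \<in> coord_space (family_index m d)" "q z \<noteq> 0" "pivots m z \<noteq> 0"
    using coord_space_irreducible[OF assms(1) poly_fun_pivots assms(2) _ assms(3)] by blast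
  obtain b where "b \<in> coord_space (family_index m d)" "row_step m d k b = z"
    using row_step_surj[OF z(1,3) assms(4,5,6)] by blast
  thus ?thesis using z(2) by auto
qed

text \<open>The unipotent matrix acts on the rows of \<open>h\<close>, so row 3 has to be replaced first: this step reads the other rows,
  and they must still be those of \<open>h\<close>.\<close>

lemma family_eq_row_steps:
  assumes "y \<in> coord_space (family_index m d)"
  shows "(\<lambda>i. if i \<in> family_index m d then family m y i else 0) =
    row_step m d 1 (row_step m d 2 (row_step m d 3 y))"
proof -
  have cp: "cusp_part m (row_step m d k z) (l, j) = cusp_part m z (l, j)"
    if "l < k" "z \<in> coord_space (family_index m d)" for l j k z
    using that by (auto simp: cusp_part_def row_step_def coord_space_def)
  have un: "unipotent_entry m (row_step m d k z) i l = unipotent_entry m z i l" if "i < k" "z \<in> coord_space (family_index m d)" for i k l z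
    using that by (auto simp: unipotent_entry_def row_step_def coord_space_def)
  have fam: "family m (row_step m d k z) (i, j) = family m z (i, j)"
    if "i < k" "z \<in> coord_space (family_index m d)" for i j k z
    using that cp un by (auto simp: family_def intro!: sum.cong)
  have val: "row_step m d k z i = (if fst i = k then family m z i else z i)" if "i \<in> family_index m d" for k z i
    using that by (simp add: row_step_def)
  show ?thesis
  proof (rule ext)
    fix i :: "nat \<times> nat"
    obtain i' j where i: "i = (i', j)" by (cases i)
    show "(if i \<in> family_index m d then family m y i else 0) =
      row_step m d 1 (row_step m d 2 (row_step m d 3 y)) i"
    proof (cases "i \<in> family_index m d")
      case True
      hence "i' = 0 \<or> i' = 1 \<or> i' = 2 \<or> i' = 3" by (auto simp: family_index_def i)
      moreover have "family m y (0, j) = y (0, j)" by (auto simp: family_def cusp_part_def pord_def)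
      ultimately show ?thesis using True
        by (elim disjE) (simp_all add: val i fam[OF _ row_step_in] fam[OF _ assms])
    qed (simp add: row_step_def)
  qed
qed

text \<open>The coefficients with index in \<open>family_index m d\<close> are algebraically independent on the family: each of the three
  steps is dominant, because it is surjective over the open set where the pivots are not zero.\<close>

lemma family_dominant:
  assumes "q \<in> poly_fun" "y \<in> coord_space (family_index m d)" "q y \<noteq> 0" "m \<ge> 1" "d \<ge> 2 * m + 4"
  shows "\<exists>b \<in> coord_space (family_index m d). q (\<lambda>i. if i \<in> family_index m d then family m b i else 0) \<noteq> 0"
proof -
  obtain b1 where b1: "b1 \<in> coord_space (family_index m d)" "q (row_step m d 1 b1) \<noteq> 0"
    using row_step_dominant[OF assms(1-3) _ assms(4,5), of 1] by auto
  have q1: "(\<lambda>b. q (row_step m d 1 b)) \<in> poly_fun" by (rule poly_fun_subst[OF assms(1) poly_fun_row_step])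
  obtain b2 where b2: "b2 \<in> coord_space (family_index m d)" "q (row_step m d 1 (row_step m d 2 b2)) \<noteq> 0"
    using row_step_dominant[OF q1 b1 _ assms(4,5), of 2] by auto
  have q2: "(\<lambda>b. q (row_step m d 1 (row_step m d 2 b))) \<in> poly_fun" by (rule poly_fun_subst[OF q1 poly_fun_row_step])
  obtain b3 where "b3 \<in> coord_space (family_index m d)" "q (row_step m d 1 (row_step m d 2 (row_step m d 3 b3))) \<noteq> 0"
    using row_step_dominant[OF q2 b2 _ assms(4,5), of 3] by auto
  thus ?thesis using family_eq_row_steps by metis
qed

text \<open>A general member of the family satisfies both genericity conditions, so it lies in the Severi variety.\<close>

theorem codim_severi_S_gen_le:
  assumes "m \<ge> 3"
  shows "\<exists>N. \<forall>d\<ge>N. codim (morphism_space d) (severi d (card (UNIV - S_gen m)) (S_gen m)) \<le> enat (6 * m)"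
proof -
  have m2: "m \<ge> 2" using assms by simp
  obtain N where N: "finite (UNIV - S_gen m)" "\<forall>d\<ge>N. \<exists>p \<in> poly_fun. (\<exists>a \<in> cusp_coeffs m \<inter> coord_space (param_index d). p a \<noteq> 0) \<and>
    (\<forall>a \<in> cusp_coeffs m. p a \<noteq> 0 \<longrightarrow> semigroup_of (coeff_rows a) = S_gen m)"
    using S_gen_generic[OF m2] by blast
  have "codim (morphism_space d) (severi d (card (UNIV - S_gen m)) (S_gen m)) \<le> enat (6 * m)"
    if d: "d \<ge> N + 2 * m + 6" for d
  proof -
    have d1: "N \<le> d" "2 * m + 6 \<le> d" using d by auto
    let ?K = "family_index m d"
    obtain p a where p: "p \<in> poly_fun" and a: "a \<in> cusp_coeffs m \<inter> coord_space (param_index d)" "p a \<noteq> 0"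
      and pS: "\<forall>a \<in> cusp_coeffs m. p a \<noteq> 0 \<longrightarrow> semigroup_of (coeff_rows a) = S_gen m"
      using N(2)[rule_format, OF d1(1)] by (elim bexE conjE) 
    obtain c T q a' where q: "q \<in> poly_fun" and a': "a' \<in> cusp_coeffs m \<inter> coord_space (param_index d)" "q a' \<noteq> 0"
      and qT: "\<forall>a \<in> cusp_coeffs m \<inter> coord_space (param_index d). q a \<noteq> 0 \<longrightarrow> (\<forall>n\<ge>T. many_monomials d c (coeff_rows a) n)"
      using generic_many_monomials[OF m2 d1(2)] by (elim exE bexE conjE)
    define G where "G = (\<lambda>y. p (cusp_part m y) * q (cusp_part m y) * pivots m y)"
    have P: "(\<lambda>y. p (cusp_part m y)) \<in> poly_fun" "(\<lambda>y. q (cusp_part m y)) \<in> poly_fun"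
      by (intro poly_fun_subst[OF p poly_fun_cusp_part] poly_fun_subst[OF q poly_fun_cusp_part])+
    have G: "G \<in> poly_fun" unfolding G_def by (intro poly_fun.mult P poly_fun_pivots)
    have "\<exists>y\<in>coord_space ?K. \<forall>F\<in>{\<lambda>y. p (cusp_part m y), \<lambda>y. q (cusp_part m y), pivots m}. F y \<noteq> 0"
    proof (rule coord_space_irreducible_finite[where p = "\<lambda>F. F"])
      have aK: "a \<in> coord_space ?K" "p (cusp_part m a) \<noteq> 0" "pivots m a \<noteq> 0"
        using a cusp_coeffs_in_family cusp_part_self by (auto simp: cusp_coeffs_def)
      have aK': "a' \<in> coord_space ?K" "q (cusp_part m a') \<noteq> 0"
        using a' cusp_coeffs_in_family cusp_part_self by auto
      show "coord_space ?K \<noteq> {}" using aK by blast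
      fix F assume "F \<in> {\<lambda>y. p (cusp_part m y), \<lambda>y. q (cusp_part m y), pivots m}"
      thus "F \<in> poly_fun" "\<exists>v\<in>coord_space ?K. F v \<noteq> 0" using P poly_fun_pivots aK aK' by auto
    qed auto
    then obtain y0 where y0: "y0 \<in> coord_space ?K" "G y0 \<noteq> 0" by (auto simp: G_def)
    have curve: "nondegenerate_morphism d (family m y) \<and>
        proj_pt (family m y) \<in> severi d (card (UNIV - S_gen m)) (S_gen m)"
      if y: "y \<in> coord_space ?K" "G y \<noteq> 0" for y
    proof -
      have yG: "p (cusp_part m y) \<noteq> 0" "q (cusp_part m y) \<noteq> 0" "pivots m y \<noteq> 0" using y(2) by (auto simp: G_def)
      note cin = cusp_part_in[OF y(1) yG(3)]
      interpret cuspidal_curve m d c T "family m y" "cusp_part m y" "unipotent_entry m y"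
      proof
        show "3 \<le> m" by fact
        show "1 \<le> d" using d by simp
        show "many_monomials d c (coeff_rows (cusp_part m y)) n" if "T \<le> n" for n
          using qT cin yG(2) that by blast
      qed (use cin family_in[OF y(1)] coeff_rows_family in auto)
      have S: "semigroup_of (coeff_rows (cusp_part m y)) = S_gen m" using pS cin yG(1) by blast
      show ?thesis using nondegenerate in_severi N(1) unfolding S by blast
    qed
    have ne: "?K \<noteq> {}" using card_family_index[of m d] d assms by auto
    have "codim (morphism_space d) (severi d (card (UNIV - S_gen m)) (S_gen m)) \<le> enat (4 * (d + 1) - card ?K)"
    proof (rule codim_le_of_family[where \<Phi> = "family m", OF finite_family_index ne poly_fun_family G y0])
      show "\<exists>b\<in>coord_space ?K. q (\<lambda>i. if i \<in> ?K then family m b i else 0) \<noteq> 0"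
        if "q \<in> poly_fun" "y \<in> coord_space ?K" "q y \<noteq> 0" for q y
        using family_dominant[OF that] assms d by auto
    qed (use curve in auto)
    thus ?thesis using card_family_index[of m d] d assms by simp
  qed
  thus ?thesis by blast
qed

theorem corollary3p17:
  shows "\<exists>D :: nat \<Rightarrow> nat. \<forall>m \<ge> (9::nat).
    (let S = S_gen m; g = card (UNIV - S) in
      \<forall>d \<ge> D g. codim (morphism_space d) (severi d g S) < enat g)"
proof -
  have "\<forall>m. \<exists>N. m \<ge> 3 \<longrightarrow> (\<forall>d\<ge>N. codim (morphism_space d) (severi d (card (UNIV - S_gen m)) (S_gen m)) \<le> enat (6 * m))"
    using codim_severi_S_gen_le by blast
  from choice[OF this] obtain N where N: "\<And>m d. m \<ge> 3 \<Longrightarrow> d \<ge> N m \<Longrightarrow>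
    codim (morphism_space d) (severi d (card (UNIV - S_gen m)) (S_gen m)) \<le> enat (6 * m)" by blast
  show ?thesis
  \<comment> \<open>The degree bound may depend on \<open>g\<close> only, but \<open>m \<le> g\<close>, so finitely many \<open>m\<close> are involved.\<close>
  proof (intro exI[of _ "\<lambda>g. \<Sum>m\<le>g. N m"] allI impI)
    fix m :: nat assume m: "m \<ge> 9"
    define g where "g = card (UNIV - S_gen m)"
    have g: "10 * m - 35 \<le> g" unfolding g_def using m by (intro S_gen_gaps) simp
    hence "m \<le> g" "6 * m < g" using m by auto
    have "codim (morphism_space d) (severi d g (S_gen m)) < enat g" if d: "d \<ge> (\<Sum>m\<le>g. N m)" for d
    proof -
      have "N m \<le> (\<Sum>m\<le>g. N m)" using \<open>m \<le> g\<close> by (intro member_le_sum) auto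
      hence "N m \<le> d" using d by simp
      hence "codim (morphism_space d) (severi d g (S_gen m)) \<le> enat (6 * m)"
        unfolding g_def using N[of m d] m by simp
      also have "\<dots> < enat g" using \<open>6 * m < g\<close> by simp
      finally show ?thesis .
    qed
    thus "let S = S_gen m; g = card (UNIV - S) in
      \<forall>d \<ge> \<Sum>m\<le>g. N m. codim (morphism_space d) (severi d g S) < enat g"
      unfolding Let_def g_def by blast
  qed
qed

end
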